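(* Consider the two left $\mathcal{O}_q(\mathrm{SU}_3)$-covariant almost complex structures on $\Omega^\bullet_q(\mathrm{F}_3)$ (unique up to identification of opposite structures) extending the first-order structures $\Omega^1_q(\mathrm{F}_3)=\Omega^{(1,0)}\oplus\Omega^{(0,1)}$ corresponding to the decompositions $V^1=V^{(1,0)}\oplus V^{(0,1)}$ of the cotangent space given by (I) $V^{(1,0)}=\mathrm{span}\{e_{\alpha_1},e_{\alpha_2},e_{\alpha_1+\alpha_2}\}$, $V^{(0,1)}=\mathrm{span}\{f_{\alpha_1},f_{\alpha_2},f_{\alpha_1+\alpha_2}\}$; (II) $V^{(1,0)}=\mathrm{span}\{e_{\alpha_1},f_{\alpha_2},e_{\alpha_1+\alpha_2}\}$, $V^{(0,1)}=\mathrm{span}\{f_{\alpha_1},e_{\alpha_2},f_{\alpha_1+\alpha_2}\}$. Both of these almost complex structures are integrable.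
   Context: An almost complex structure for a $*$-differential calculus $(\Omega^\bullet,\mathrm{d})$ over $B$ is a $\mathbb{Z}_{\ge0}^2$-algebra grading $\Omega^{(\bullet,\bullet)}$ of $\Omega^\bullet$ with $\Omega^k=\bigoplus_{a+b=k}\Omega^{(a,b)}$ and $(\Omega^{(a,b)})^*=\Omega^{(b,a)}$. It is integrable (a complex structure) if $\mathrm{d}=\partial+\overline{\partial}$ with $\partial$ of degree $(1,0)$ and $\overline{\partial}$ of degree $(0,1)$. The opposite structure is $\overline{\Omega}^{(a,b)}:=\Omega^{(b,a)}$. It is left $A$-covariant if each $\Omega^{(a,b)}$ is a left $A$-subcomodule. An almost complex structure is determined by its first-order part $\Omega^1=\Omega^{(1,0)}\oplus\Omega^{(0,1)}$. Let $q\in\mathbb{R}\setminus\{-1,0,1\}$. Let $\Delta^+=\{\alpha_1,\alpha_2,\alpha_1+\alpha_2\}$ be the positive roots of $\mathfrak{sl}_3$, with Cartan matrix $a_{11}=a_{22}=2$, $a_{12}=a_{21}=-1$. $U_q(\mathfrak{sl}_3)$ is the complex algebra generated by $E_i,F_i,K_i^{\pm1}$ ($i=1,2$) with $K_iK_j=K_jK_i$, $K_iE_j=q^{a_{ij}}E_jK_i$, $K_iF_j=q^{-a_{ij}}F_jK_i$, $[E_i,F_j]=\delta_{ij}\frac{K_i-K_i^{-1}}{q-q^{-1}}$, and $E_i^2E_j-(q+q^{-1})E_iE_jE_i+E_jE_i^2=0$, $F_i^2F_j-(q+q^{-1})F_iF_jF_i+F_jF_i^2=0$ for $i\ne j$.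 It is a Hopf $*$-algebra with $\Delta(E_i)=E_i\otimes K_i+1\otimes E_i$, $\Delta(F_i)=F_i\otimes1+K_i^{-1}\otimes F_i$, $\Delta(K_i)=K_i\otimes K_i$, $\varepsilon(E_i)=\varepsilon(F_i)=0$, $\varepsilon(K_i)=1$, $E_i^*=K_iF_i$, $F_i^*=E_iK_i^{-1}$, $K_i^*=K_i$. $A:=\mathcal{O}_q(\mathrm{SU}_3)$ is the Hopf subalgebra of the Hopf dual of $U_q(\mathfrak{sl}_3)$ generated by $u_{ij}$ ($1\le i,j\le3$), where $\Delta(u_{ij})=\sum_a u_{ia}\otimes u_{aj}$ and the only nonzero pairings of the $u_{ij}$ with the generators are $\langle E_1,u_{21}\rangle=\langle E_2,u_{32}\rangle=\langle F_1,u_{12}\rangle=\langle F_2,u_{23}\rangle=1$, $\langle K_i^{\pm1},u_{jj}\rangle=q^{\pm(\delta_{i,j-1}-\delta_{ij})}$. It is a Hopf $*$-algebra with $u_{ij}^*=S(u_{ji})$. Put $X\triangleright a:=a_{(1)}\langle X,a_{(2)}\rangle$. Then $B:=\mathcal{O}_q(\mathrm{F}_3):=\{b\in A: K_i^{\pm1}\triangleright b=b,\ i=1,2\}$. Put $E_{\alpha_i}:=E_i$, $E_{\alpha_1+\alpha_2}:=E_2E_1-q^{-1}E_1E_2$, $F_\gamma:=E_\gamma^*$, and $T:=\mathrm{span}_{\mathbb{C}}\{E_\gamma,F_\gamma:\gamma\in\Delta^+\}$. $T$ defines the left $A$-covariant $*$-first-order differential calculus $\Omega^1_q(\mathrm{SU}_3)=A\otimes\Lambda^1$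 over $A$: $\Lambda^1:=A^+/\{y\in A^+:X(y)=0\ \forall X\in T\}$ (with $A^+=\ker\varepsilon$) is a right $A$-module with basis $\{e_\gamma,f_\gamma\}$ dual to $\{E_\gamma,F_\gamma\}$, the bimodule structure is $a(b\otimes v)c=abc_{(1)}\otimes vc_{(2)}$, and $\mathrm{d}a=\sum_\gamma (E_\gamma\triangleright a)\otimes e_\gamma+(F_\gamma\triangleright a)\otimes f_\gamma$. $\Omega^1_q(\mathrm{F}_3)$ is its restriction to $B$ (the $B$-sub-bimodule generated by $\mathrm{d}b$, $b\in B$). Its cotangent space is $V^1:=B^+/\{y\in B^+:X(y)=0\ \forall X\in T\}\cong\Omega^1_q(\mathrm{F}_3)/B^+\Omega^1_q(\mathrm{F}_3)$, identified with $\Lambda^1$ via $[b]\mapsto[b]$; a decomposition of $V^1$ into right $B$-submodules and left $\pi_B(A)$-subcomodules ($\pi_B(A)=A/B^+A$) corresponds to the bimodule decomposition with $\Omega^{(i,j)}=A\square_{\pi_B(A)}V^{(i,j)}$ inside $\Omega^1_q(\mathrm{F}_3)=A\square_{\pi_B(A)}V^1$. $\Omega^\bullet_q(\mathrm{F}_3)$ is the maximal prolongation of $\Omega^1_q(\mathrm{F}_3)$: the quotient of the tensor algebra of the $B$-bimodule $\Omega^1_q(\mathrm{F}_3)$ by the two-sided ideal generated by all $\sum_i\mathrm{d}b_i\otimes\mathrm{d}c_i$ with $\sum_ib_i\,\mathrm{d}c_i=0$; it is a $*$-differential calculus. Both first-order structures (I), (II) are known to extend to almost complex structures on $\Omega^\bullet_q(\mathrm{F}_3)$.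 *)

theory Defs
  imports
    "HOL-Analysis.Analysis"
    "HOL-Library.Poly_Mapping"
    "HOL-Library.Product_Plus"
    "HOL-Algebra.QuotRing"
    "HOL-Algebra.Generated_Groups"
begin

datatype 'x word = Word (word_letters: "'x list")

instantiation word :: (type) monoid_add
begin

definition zero_word :: "'a word" where "0 = Word []"

definition plus_word :: "'a word \<Rightarrow> 'a word \<Rightarrow> 'a word"
  where "v + w = Word (word_letters v @ word_letters w)"

instance
  by standard (simp_all add: zero_word_def plus_word_def)

end

type_synonym 'x free = "'x word \<Rightarrow>\<^sub>0 complex"

definition gen_of :: "'x \<Rightarrow> 'x free"
  where "gen_of x = Poly_Mapping.single (Word [x]) 1"

definition scal :: "complex \<Rightarrow> 'm::monoid_add \<Rightarrow>\<^sub>0 complex"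
  where "scal c = Poly_Mapping.single 0 c"

definition free_alg :: "'x set \<Rightarrow> 'x free ring"
  where "free_alg X =
    \<lparr>carrier = {p. \<forall>w \<in> Poly_Mapping.keys p. set (word_letters w) \<subseteq> X},
     mult = (*), one = 1, zero = 0, add = (+)\<rparr>"

datatype uq_gen = gE 2 | gF 2 | gK 2 | gKinv 2

abbreviation EE :: "2 \<Rightarrow> uq_gen free" where "EE i \<equiv> gen_of (gE i)"
abbreviation FF :: "2 \<Rightarrow> uq_gen free" where "FF i \<equiv> gen_of (gF i)"
abbreviation KK :: "2 \<Rightarrow> uq_gen free" where "KK i \<equiv> gen_of (gK i)"
abbreviation KKinv :: "2 \<Rightarrow> uq_gen free" where "KKinv i \<equiv> gen_of (gKinv i)"

definition cartan :: "2 \<Rightarrow> 2 \<Rightarrow> int"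
  where "cartan i j = (if i = j then 2 else -1)"

definition uq_relations :: "real \<Rightarrow> uq_gen free set"
  where "uq_relations q =
    {KK i * KKinv i - 1 | i. True} \<union> {KKinv i * KK i - 1 | i. True} \<union>
    {KK i * KK j - KK j * KK i | i j. True} \<union>
    {KK i * EE j - scal (of_real (q powi cartan i j)) * EE j * KK i | i j. True} \<union>
    {KK i * FF j - scal (of_real (q powi (- cartan i j))) * FF j * KK i | i j. True} \<union>
    {EE i * FF j - FF j * EE i
       - (if i = j then scal (of_real (1 / (q - 1 / q))) * (KK i - KKinv i) else 0) | i j. True} \<union>
    {EE i * EE i * EE j - scal (of_real (q + 1 / q)) * EE i * EE j * EE i
       + EE j * EE i * EE i | i j. i \<noteq> j} \<union>
    {FF i * FF i * FF j - scal (of_real (q + 1 / q)) * FF i * FF j * FF i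
       + FF j * FF i * FF i | i j. i \<noteq> j}"

text \<open>
  U_q(sl_3) is the free algebra modulo this ideal. Its elements are written below through
  representatives in the free algebra, and a linear functional on U_q(sl_3) is a linear
  functional on the free algebra that vanishes on the ideal.
\<close>

definition uq_ideal :: "real \<Rightarrow> uq_gen free set"
  where "uq_ideal q = Idl\<^bsub>free_alg UNIV\<^esub> (uq_relations q)"

definition tens :: "uq_gen free \<Rightarrow> uq_gen free \<Rightarrow> (uq_gen word \<times> uq_gen word) \<Rightarrow>\<^sub>0 complex"
  where "tens x y = (\<Sum>v \<in> Poly_Mapping.keys x. \<Sum>w \<in> Poly_Mapping.keys y.
    Poly_Mapping.single (v, w) (Poly_Mapping.lookup x v * Poly_Mapping.lookup y w))"

fun coprod_gen :: "uq_gen \<Rightarrow> (uq_gen word \<times> uq_gen word) \<Rightarrow>\<^sub>0 complex"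
  where
    "coprod_gen (gE i) = tens (EE i) (KK i) + tens 1 (EE i)"
  | "coprod_gen (gF i) = tens (FF i) 1 + tens (KKinv i) (FF i)"
  | "coprod_gen (gK i) = tens (KK i) (KK i)"
  | "coprod_gen (gKinv i) = tens (KKinv i) (KKinv i)"

definition coprod :: "uq_gen free \<Rightarrow> (uq_gen word \<times> uq_gen word) \<Rightarrow>\<^sub>0 complex"
  where "coprod x = (\<Sum>w \<in> Poly_Mapping.keys x.
    scal (Poly_Mapping.lookup x w) * prod_list (map coprod_gen (word_letters w)))"

fun counit_gen :: "uq_gen \<Rightarrow> complex"
  where
    "counit_gen (gE i) = 0"
  | "counit_gen (gF i) = 0"
  | "counit_gen (gK i) = 1"
  | "counit_gen (gKinv i) = 1"

definition counit :: "uq_gen free \<Rightarrow> complex"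
  where "counit x = (\<Sum>w \<in> Poly_Mapping.keys x.
    Poly_Mapping.lookup x w * prod_list (map counit_gen (word_letters w)))"

text \<open>The antipode is forced by the coproduct and the counit.\<close>

fun antipode_gen :: "uq_gen \<Rightarrow> uq_gen free"
  where
    "antipode_gen (gE i) = - (EE i * KKinv i)"
  | "antipode_gen (gF i) = - (KK i * FF i)"
  | "antipode_gen (gK i) = KKinv i"
  | "antipode_gen (gKinv i) = KK i"

definition antipode :: "uq_gen free \<Rightarrow> uq_gen free"
  where "antipode x = (\<Sum>w \<in> Poly_Mapping.keys x.
    scal (Poly_Mapping.lookup x w) * prod_list (map antipode_gen (rev (word_letters w))))"

fun uq_star_gen :: "uq_gen \<Rightarrow> uq_gen free"
  where
    "uq_star_gen (gE i) = KK i * FF i"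
  | "uq_star_gen (gF i) = EE i * KKinv i"
  | "uq_star_gen (gK i) = KK i"
  | "uq_star_gen (gKinv i) = KKinv i"

definition uq_star :: "uq_gen free \<Rightarrow> uq_gen free"
  where "uq_star x = (\<Sum>w \<in> Poly_Mapping.keys x.
    scal (cnj (Poly_Mapping.lookup x w)) * prod_list (map uq_star_gen (rev (word_letters w))))"

type_synonym qfun = "uq_gen free \<Rightarrow> complex"

definition uq_dual :: "real \<Rightarrow> qfun set"
  where "uq_dual q = {f. (\<forall>x y. f (x + y) = f x + f y) \<and> (\<forall>c x. f (scal c * x) = c * f x)
    \<and> (\<forall>x \<in> uq_ideal q. f x = 0)}"

text \<open>The product of the Hopf dual; its unit is the counit of U_q(sl_3).\<close>

definition conv :: "qfun \<Rightarrow> qfun \<Rightarrow> qfun"  (infixl \<open>\<star>\<close> 70)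
  where "f \<star> g = (\<lambda>x. \<Sum>(v, w) \<in> Poly_Mapping.keys (coprod x).
    Poly_Mapping.lookup (coprod x) (v, w)
      * f (Poly_Mapping.single v 1) * g (Poly_Mapping.single w 1))"

text \<open>Entry (i, j) of the matrix attached to a generator is its pairing with u_ij.\<close>

fun pair_gen :: "real \<Rightarrow> uq_gen \<Rightarrow> complex ^ 3 ^ 3"
  where
    "pair_gen q (gE k) =
      (\<chi> i j. if (k = 1 \<and> i = 2 \<and> j = 1) \<or> (k = 2 \<and> i = 3 \<and> j = 2) then 1 else 0)"
  | "pair_gen q (gF k) =
      (\<chi> i j. if (k = 1 \<and> i = 1 \<and> j = 2) \<or> (k = 2 \<and> i = 2 \<and> j = 3) then 1 else 0)"
  | "pair_gen q (gK k) = (\<chi> i j. if i \<noteq> j then 0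
      else if (k = 1 \<and> j = 2) \<or> (k = 2 \<and> j = 3) then of_real q
      else if (k = 1 \<and> j = 1) \<or> (k = 2 \<and> j = 2) then of_real (1 / q) else 1)"
  | "pair_gen q (gKinv k) = (\<chi> i j. if i \<noteq> j then 0
      else if (k = 1 \<and> j = 2) \<or> (k = 2 \<and> j = 3) then of_real (1 / q)
      else if (k = 1 \<and> j = 1) \<or> (k = 2 \<and> j = 2) then of_real q else 1)"

text \<open>
  Since the coproduct of u_ij is the sum over a of u_ia (x) u_aj, the functional u_ij takes
  products of generators to entry (i, j) of the product of their matrices.
\<close>

definition ucoef :: "real \<Rightarrow> 3 \<Rightarrow> 3 \<Rightarrow> qfun"
  where "ucoef q i j = (\<lambda>x. \<Sum>w \<in> Poly_Mapping.keys x.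
    Poly_Mapping.lookup x w * foldr (\<lambda>g M. pair_gen q g ** M) (word_letters w) (mat 1) $ i $ j)"

inductive_set hopf_gen :: "real \<Rightarrow> qfun set" for q :: real
  where
    "ucoef q i j \<in> hopf_gen q"
  | "counit \<in> hopf_gen q"
  | "a \<in> hopf_gen q \<Longrightarrow> b \<in> hopf_gen q \<Longrightarrow> (\<lambda>x. a x + b x) \<in> hopf_gen q"
  | "a \<in> hopf_gen q \<Longrightarrow> (\<lambda>x. c * a x) \<in> hopf_gen q"
  | "a \<in> hopf_gen q \<Longrightarrow> b \<in> hopf_gen q \<Longrightarrow> a \<star> b \<in> hopf_gen q"
  | "a \<in> hopf_gen q \<Longrightarrow> (\<lambda>x. a (antipode x)) \<in> hopf_gen q"

definition oq_su3 :: "real \<Rightarrow> qfun set"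
  where "oq_su3 q = uq_dual q \<inter> hopf_gen q"

text \<open>The graph of the antilinear antimultiplicative extension of u_ij |-> S(u_ji).\<close>

inductive star_graph :: "real \<Rightarrow> qfun \<Rightarrow> qfun \<Rightarrow> bool" for q :: real
  where
    "star_graph q (ucoef q i j) (\<lambda>x. ucoef q j i (antipode x))"
  | "star_graph q counit counit"
  | "star_graph q a a' \<Longrightarrow> star_graph q b b' \<Longrightarrow> star_graph q (\<lambda>x. a x + b x) (\<lambda>x. a' x + b' x)"
  | "star_graph q a a' \<Longrightarrow> star_graph q (\<lambda>x. c * a x) (\<lambda>x. cnj c * a' x)"
  | "star_graph q a a' \<Longrightarrow> star_graph q b b' \<Longrightarrow> star_graph q (a \<star> b) (b' \<star> a')"

definition qstar :: "real \<Rightarrow> qfun \<Rightarrow> qfun"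
  where "qstar q a = (THE a'. star_graph q a a')"

text \<open>
  The coproduct of a functional a is determined by a(Y X) = a_(1)(Y) a_(2)(X). Hence
  a_(1) a_(2)(X) is the right translate below, and a_(1)(Z) a_(2) is the left translate.
\<close>

definition act :: "uq_gen free \<Rightarrow> qfun \<Rightarrow> qfun"
  where "act X a = (\<lambda>Y. a (Y * X))"

definition ltrans :: "uq_gen free \<Rightarrow> qfun \<Rightarrow> qfun"
  where "ltrans Z a = (\<lambda>Y. a (Z * Y))"

definition oq_f3 :: "real \<Rightarrow> qfun set"
  where "oq_f3 q = {b \<in> oq_su3 q. \<forall>i. act (KK i) b = b \<and> act (KKinv i) b = b}"

datatype root = Alpha1 | Alpha2 | Alpha12

text \<open>Index set of the basis E_gamma, F_gamma of T and of the dual basis e_gamma, f_gamma.\<close>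

datatype tindex = Ei root | Fi root

instance tindex :: finite
proof
  have "k \<in> Ei ` {Alpha1, Alpha2, Alpha12} \<union> Fi ` {Alpha1, Alpha2, Alpha12}" for k
  proof (cases k)
    case (Ei r)
    then show ?thesis by (cases r) simp_all
  next
    case (Fi r)
    then show ?thesis by (cases r) simp_all
  qed
  then show "finite (UNIV :: tindex set)"
    by (intro finite_subset[of UNIV "Ei ` {Alpha1, Alpha2, Alpha12} \<union> Fi ` {Alpha1, Alpha2, Alpha12}"])
      auto
qed

fun root_vec :: "real \<Rightarrow> root \<Rightarrow> uq_gen free"
  where
    "root_vec q Alpha1 = EE 1"
  | "root_vec q Alpha2 = EE 2"
  | "root_vec q Alpha12 = EE 2 * EE 1 - scal (of_real (1 / q)) * EE 1 * EE 2"

fun tvec :: "real \<Rightarrow> tindex \<Rightarrow> uq_gen free"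
  where
    "tvec q (Ei r) = root_vec q r"
  | "tvec q (Fi r) = uq_star (root_vec q r)"

text \<open>
  Elements of Lambda^1 are given by their coordinates in the basis e_gamma, f_gamma. As this
  basis is dual to E_gamma, F_gamma, the class of y has coordinates X(y), X running through
  the basis of T; the kernel of y |-> [y] on A^+ is the annihilator of T.
\<close>

type_synonym cotangent = "tindex \<Rightarrow> complex"

definition lam_class :: "real \<Rightarrow> qfun \<Rightarrow> cotangent"
  where "lam_class q y = (\<lambda>k. y (tvec q k))"

definition lam_basis :: "tindex \<Rightarrow> cotangent"
  where "lam_basis k = (\<lambda>j. if j = k then 1 else 0)"

text \<open>The right action [y] c = [y c]; a 1 is the counit of A applied to a.\<close>

definition lam_act :: "real \<Rightarrow> cotangent \<Rightarrow> qfun \<Rightarrow> cotangent"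
  where "lam_act q v c =
    lam_class q ((SOME y. y \<in> oq_su3 q \<and> y 1 = 0 \<and> lam_class q y = v) \<star> c)"

text \<open>A family w of elements of A stands for the sum over k of w k (x) lam_basis k.\<close>

type_synonym form = "tindex \<Rightarrow> qfun"

definition lmul :: "qfun \<Rightarrow> form \<Rightarrow> form"
  where "lmul a w = (\<lambda>k. a \<star> w k)"

text \<open>
  (a (x) v) c = a c_(1) (x) v c_(2): the coordinate j of c_(1) (x) v c_(2) is the functional
  that sends Z to coordinate j of v (c_(1)(Z) c_(2)).
\<close>

definition rmul :: "real \<Rightarrow> form \<Rightarrow> qfun \<Rightarrow> form"
  where "rmul q w c = (\<lambda>j x. \<Sum>k\<in>UNIV.
    (w k \<star> (\<lambda>Z. lam_act q (lam_basis k) (ltrans Z c) j)) x)"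

definition d1 :: "real \<Rightarrow> qfun \<Rightarrow> form"
  where "d1 q a = (\<lambda>k. act (tvec q k) a)"

inductive_set omega1 :: "real \<Rightarrow> form set" for q :: real
  where
    "b \<in> oq_f3 q \<Longrightarrow> d1 q b \<in> omega1 q"
  | "v \<in> omega1 q \<Longrightarrow> w \<in> omega1 q \<Longrightarrow> (\<lambda>k x. v k x + w k x) \<in> omega1 q"
  | "b \<in> oq_f3 q \<Longrightarrow> w \<in> omega1 q \<Longrightarrow> lmul b w \<in> omega1 q"
  | "b \<in> oq_f3 q \<Longrightarrow> w \<in> omega1 q \<Longrightarrow> rmul q w b \<in> omega1 q"

definition cot_span :: "tindex set \<Rightarrow> cotangent set"
  where "cot_span I = {\<lambda>j. \<Sum>k\<in>I. c k * lam_basis k j | c. True}"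

text \<open>
  The sub-bimodule of Omega^1 attached to a subspace V of the cotangent space: the cotensor
  product of A with V sits in that of A with V^1, which is Omega^1, as the set of elements
  lying in A (x) V. Membership in A (x) V is tested by evaluating the first leg, since
  elements of A are separated by U_q(sl_3).
\<close>

definition cotensor_part :: "real \<Rightarrow> cotangent set \<Rightarrow> form set"
  where "cotensor_part q V = {w \<in> omega1 q. \<forall>Z. (\<lambda>k. w k Z) \<in> V}"

datatype tletter = Fun qfun | Form form

definition tletters :: "real \<Rightarrow> tletter set"
  where "tletters q = Fun ` oq_f3 q \<union> Form ` omega1 q"

text \<open>
  The tensor algebra of the B-bimodule Omega^1 is generated by B and Omega^1, subject to
  the relations that its product restricts to that of B and to the bimodule structure.
\<close>

definition tensor_relations :: "real \<Rightarrow> tletter free set"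
  where "tensor_relations q =
    {gen_of (Fun counit) - 1} \<union>
    {gen_of (Fun (\<lambda>x. b x + c x)) - gen_of (Fun b) - gen_of (Fun c)
       | b c. b \<in> oq_f3 q \<and> c \<in> oq_f3 q} \<union>
    {gen_of (Fun (\<lambda>x. z * b x)) - scal z * gen_of (Fun b) | z b. b \<in> oq_f3 q} \<union>
    {gen_of (Fun (b \<star> c)) - gen_of (Fun b) * gen_of (Fun c)
       | b c. b \<in> oq_f3 q \<and> c \<in> oq_f3 q} \<union>
    {gen_of (Form (\<lambda>k x. v k x + w k x)) - gen_of (Form v) - gen_of (Form w)
       | v w. v \<in> omega1 q \<and> w \<in> omega1 q} \<union>
    {gen_of (Form (lmul b w)) - gen_of (Fun b) * gen_of (Form w)
       | b w. b \<in> oq_f3 q \<and> w \<in> omega1 q} \<union>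
    {gen_of (Form (rmul q w b)) - gen_of (Form w) * gen_of (Fun b)
       | b w. b \<in> oq_f3 q \<and> w \<in> omega1 q}"

definition prolongation_relations :: "real \<Rightarrow> tletter free set"
  where "prolongation_relations q =
    {(\<Sum>(b, c) \<leftarrow> bcs. gen_of (Form (d1 q b)) * gen_of (Form (d1 q c))) | bcs.
       set bcs \<subseteq> oq_f3 q \<times> oq_f3 q \<and>
       (\<forall>k x. (\<Sum>(b, c) \<leftarrow> bcs. lmul b (d1 q c) k x) = 0)}"

definition omega_ideal :: "real \<Rightarrow> tletter free set"
  where "omega_ideal q =
    Idl\<^bsub>free_alg (tletters q)\<^esub> (tensor_relations q \<union> prolongation_relations q)"

type_synonym dform = "tletter free set"

definition Omega :: "real \<Rightarrow> dform ring"
  where "Omega q = free_alg (tletters q) Quot omega_ideal q"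

definition omega_class :: "real \<Rightarrow> tletter free \<Rightarrow> dform"
  where "omega_class q x = omega_ideal q +>\<^bsub>free_alg (tletters q)\<^esub> x"

definition of_fun :: "real \<Rightarrow> qfun \<Rightarrow> dform"
  where "of_fun q b = omega_class q (gen_of (Fun b))"

definition of_form :: "real \<Rightarrow> form \<Rightarrow> dform"
  where "of_form q w = omega_class q (gen_of (Form w))"

definition cscale :: "real \<Rightarrow> complex \<Rightarrow> dform \<Rightarrow> dform"
  where "cscale q z w = omega_class q (scal z) \<otimes>\<^bsub>Omega q\<^esub> w"

fun omega_deg :: "real \<Rightarrow> nat \<Rightarrow> dform set"
  where
    "omega_deg q 0 = of_fun q ` oq_f3 q"
  | "omega_deg q (Suc k) = generate (add_monoid (Omega q))
      {v \<otimes>\<^bsub>Omega q\<^esub> of_form q w | v w. v \<in> omega_deg q k \<and> w \<in> omega1 q}"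

definition sgn_pow :: "real \<Rightarrow> nat \<Rightarrow> dform"
  where "sgn_pow q k = (\<ominus>\<^bsub>Omega q\<^esub> \<one>\<^bsub>Omega q\<^esub>) [^]\<^bsub>Omega q\<^esub> k"

definition omega_additive :: "real \<Rightarrow> (dform \<Rightarrow> dform) \<Rightarrow> bool"
  where "omega_additive q f \<longleftrightarrow> f \<in> carrier (Omega q) \<rightarrow> carrier (Omega q) \<and>
    (\<forall>v \<in> carrier (Omega q). \<forall>w \<in> carrier (Omega q).
       f (v \<oplus>\<^bsub>Omega q\<^esub> w) = f v \<oplus>\<^bsub>Omega q\<^esub> f w)"

definition omega_linear :: "real \<Rightarrow> (dform \<Rightarrow> dform) \<Rightarrow> bool"
  where "omega_linear q f \<longleftrightarrow> omega_additive q f \<and>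
    (\<forall>z. \<forall>w \<in> carrier (Omega q). f (cscale q z w) = cscale q z (f w))"

text \<open>
  The differential, the *-structure and the left coaction of the maximal prolongation are
  each the only map with the following properties, because B and dB generate the algebra.
\<close>

definition is_differential :: "real \<Rightarrow> (dform \<Rightarrow> dform) \<Rightarrow> bool"
  where "is_differential q d \<longleftrightarrow> omega_linear q d \<and>
    (\<forall>b \<in> oq_f3 q. d (of_fun q b) = of_form q (d1 q b)) \<and>
    (\<forall>k. \<forall>w \<in> omega_deg q k. d w \<in> omega_deg q (Suc k)) \<and>
    (\<forall>w \<in> carrier (Omega q). d (d w) = \<zero>\<^bsub>Omega q\<^esub>) \<and>
    (\<forall>k. \<forall>v \<in> omega_deg q k. \<forall>w \<in> carrier (Omega q).
       d (v \<otimes>\<^bsub>Omega q\<^esub> w) =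
         d v \<otimes>\<^bsub>Omega q\<^esub> w \<oplus>\<^bsub>Omega q\<^esub> sgn_pow q k \<otimes>\<^bsub>Omega q\<^esub> (v \<otimes>\<^bsub>Omega q\<^esub> d w))"

definition is_star :: "real \<Rightarrow> (dform \<Rightarrow> dform) \<Rightarrow> (dform \<Rightarrow> dform) \<Rightarrow> bool"
  where "is_star q d st \<longleftrightarrow> omega_additive q st \<and>
    (\<forall>z. \<forall>w \<in> carrier (Omega q). st (cscale q z w) = cscale q (cnj z) (st w)) \<and>
    (\<forall>w \<in> carrier (Omega q). st (st w) = w) \<and>
    (\<forall>b \<in> oq_f3 q. st (of_fun q b) = of_fun q (qstar q b)) \<and>
    (\<forall>w \<in> carrier (Omega q). st (d w) = d (st w)) \<and>
    (\<forall>k l. \<forall>v \<in> omega_deg q k. \<forall>w \<in> omega_deg q l.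
       st (v \<otimes>\<^bsub>Omega q\<^esub> w) = sgn_pow q (k * l) \<otimes>\<^bsub>Omega q\<^esub> (st w \<otimes>\<^bsub>Omega q\<^esub> st v))"

text \<open>
  An element of A (x) Omega is viewed as a map from U_q(sl_3) to Omega by evaluating the first
  leg; this loses nothing since A consists of functionals on U_q(sl_3).
\<close>

definition tensor_map :: "real \<Rightarrow> (qfun \<times> dform) list \<Rightarrow> uq_gen free \<Rightarrow> dform"
  where "tensor_map q ts X =
    foldr (\<lambda>(a, w) s. cscale q (a X) w \<oplus>\<^bsub>Omega q\<^esub> s) ts \<zero>\<^bsub>Omega q\<^esub>"

definition tensor_with :: "real \<Rightarrow> dform set \<Rightarrow> (uq_gen free \<Rightarrow> dform) set"
  where "tensor_with q W = {tensor_map q ts | ts. set ts \<subseteq> oq_su3 q \<times> W}"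

definition is_coaction :: "real \<Rightarrow> (dform \<Rightarrow> dform) \<Rightarrow> (dform \<Rightarrow> uq_gen free \<Rightarrow> dform) \<Rightarrow> bool"
  where "is_coaction q d co \<longleftrightarrow>
    (\<forall>w \<in> carrier (Omega q). co w \<in> tensor_with q (carrier (Omega q))) \<and>
    (\<forall>X. omega_linear q (\<lambda>w. co w X)) \<and>
    (\<forall>b \<in> oq_f3 q. \<forall>X. co (of_fun q b) X = of_fun q (ltrans X b)) \<and>
    (\<forall>w \<in> carrier (Omega q). \<forall>X. co (d w) X = d (co w X)) \<and>
    (\<forall>v \<in> carrier (Omega q). \<forall>w \<in> carrier (Omega q). \<forall>X.
       co (v \<otimes>\<^bsub>Omega q\<^esub> w) X = (\<Oplus>\<^bsub>Omega q\<^esub>rs \<in> Poly_Mapping.keys (coprod X).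
         cscale q (Poly_Mapping.lookup (coprod X) rs)
           (co v (Poly_Mapping.single (fst rs) 1) \<otimes>\<^bsub>Omega q\<^esub> co w (Poly_Mapping.single (snd rs) 1))))"

definition is_direct_sum :: "('a, 'm) ring_scheme \<Rightarrow> 'i set \<Rightarrow> ('i \<Rightarrow> 'a set) \<Rightarrow> 'a set \<Rightarrow> bool"
  where "is_direct_sum R I M W \<longleftrightarrow>
    W = {finsum R f J | f J. finite J \<and> J \<subseteq> I \<and> f \<in> Pi J M} \<and>
    (\<forall>J f. finite J \<and> J \<subseteq> I \<and> f \<in> Pi J M \<and> finsum R f J = \<zero>\<^bsub>R\<^esub> \<longrightarrow>
       (\<forall>i \<in> J. f i = \<zero>\<^bsub>R\<^esub>))"

definition almost_complex :: "real \<Rightarrow> (dform \<Rightarrow> dform) \<Rightarrow> (nat \<Rightarrow> nat \<Rightarrow> dform set) \<Rightarrow> bool"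
  where "almost_complex q st Om \<longleftrightarrow>
    (\<forall>a b. additive_subgroup (Om a b) (Omega q)) \<and>
    (\<forall>a b z. \<forall>w \<in> Om a b. cscale q z w \<in> Om a b) \<and>
    is_direct_sum (Omega q) UNIV (\<lambda>(a, b). Om a b) (carrier (Omega q)) \<and>
    (\<forall>a b a' b'. \<forall>v \<in> Om a b. \<forall>w \<in> Om a' b'. v \<otimes>\<^bsub>Omega q\<^esub> w \<in> Om (a + a') (b + b')) \<and>
    (\<forall>k. is_direct_sum (Omega q) {(a, b). a + b = k} (\<lambda>(a, b). Om a b) (omega_deg q k)) \<and>
    (\<forall>a b. st ` Om a b = Om b a)"

definition left_covariant ::
    "real \<Rightarrow> (dform \<Rightarrow> uq_gen free \<Rightarrow> dform) \<Rightarrow> (nat \<Rightarrow> nat \<Rightarrow> dform set) \<Rightarrow> bool"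
  where "left_covariant q co Om \<longleftrightarrow> (\<forall>a b. \<forall>w \<in> Om a b. co w \<in> tensor_with q (Om a b))"

definition extends_first_order ::
    "real \<Rightarrow> cotangent set \<Rightarrow> cotangent set \<Rightarrow> (nat \<Rightarrow> nat \<Rightarrow> dform set) \<Rightarrow> bool"
  where "extends_first_order q V10 V01 Om \<longleftrightarrow>
    Om 1 0 = of_form q ` cotensor_part q V10 \<and> Om 0 1 = of_form q ` cotensor_part q V01"

definition integrable_structure ::
    "real \<Rightarrow> (dform \<Rightarrow> dform) \<Rightarrow> (nat \<Rightarrow> nat \<Rightarrow> dform set) \<Rightarrow> bool"
  where "integrable_structure q d Om \<longleftrightarrow> (\<exists>del delbar.
    omega_linear q del \<and> omega_linear q delbar \<and>
    (\<forall>a b. del ` Om a b \<subseteq> Om (a + 1) b) \<and>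
    (\<forall>a b. delbar ` Om a b \<subseteq> Om a (b + 1)) \<and>
    (\<forall>w \<in> carrier (Omega q). d w = del w \<oplus>\<^bsub>Omega q\<^esub> delbar w))"

end

theory Submission
  imports Defs
begin

text \<open>
  Let P m be the 3 x 3 matrix over B with entries u_im S(u_mj). These matrices are orthogonal
  idempotents with sum 1, and the entries of the matrix products eta m p = P m dP p for m \<noteq> p
  generate Omega^1 as a left B-module: eta m p lives in the weight space of the matrix unit
  (m, p), up to a term in f_{alpha_1 + alpha_2} for (m, p) = (1, 2), and the coefficients are
  recovered with a quantum trace. In structure (I) the form eta m p has type (1, 0) if m > p and
  type (0, 1) if m < p; in structure (II) the same holds for the order 1 < 3 < 2.

  As d is a derivation, only the (0, 2) part of d (eta m p) for m > p, and symmetrically the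
  (2, 0) part for m < p, has to be shown to vanish. It is D m D p, where D s is the (0, 1) part
  of dP s. Now D m D p is the sum over s of D m P s D p. If s > p then P s D p is the (0, 1) part
  of eta s p, which is 0. Otherwise s < m, and D m P s = - P m D s is the (0, 1) part of
  - eta m s, which is 0.
\<close>


subsection \<open>Linear extensions on monoid algebras\<close>

text \<open>The relations of the maximal prolongation are never solved. Besides the Leibniz rule and
  d d = 0, the decisive input is that P m P p = 0 for m \<noteq> p: differentiated, it turns dP m P
  p into - eta m p, so the forms eta control dP under multiplication by P from either side. The
  right B-action on Omega^1, given through a choice, is not evaluated either; in the algebra it is
  multiplication.

  Having only the two admissible bidegrees in d x is stable under sums and products, so it passes
  from B and the forms eta to all degrees.

  A plain trace would not recover coefficients: the antipode axiom does not contract u_ja S(u_bj)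
  over j, and A is not commutative.

  The extra term of eta 1 2 has coefficient (1 - q^2) / q^5, which is not 0. It is harmless because
  f_{alpha_1} and f_{alpha_1 + alpha_2} have the same type in (I) and in (II). For the order 2 < 1 <
  3 they would have different types and eta 1 2 would have none; up to reversal only the orders of
  (I) and (II) remain.\<close>

definition lin_ext :: "(complex \<Rightarrow> 'r::ring_1) \<Rightarrow> ('m \<Rightarrow> 'r) \<Rightarrow> ('m \<Rightarrow>\<^sub>0 complex) \<Rightarrow> 'r"
  where "lin_ext s h x = (\<Sum>w \<in> Poly_Mapping.keys x. s (Poly_Mapping.lookup x w) * h w)"

definition lin_fun :: "(('m::monoid_add \<Rightarrow>\<^sub>0 complex) \<Rightarrow> complex) \<Rightarrow> bool"
  where "lin_fun f \<longleftrightarrow> (\<forall>x y. f (x + y) = f x + f y) \<and> (\<forall>c x. f (scal c * x) = c * f x)"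

text \<open>Both base case and step are free of conditions on supports, which suits statements that
  are additive in x.\<close>

lemma poly_mapping_single_induct [case_names single add]:
  fixes x :: "'m \<Rightarrow>\<^sub>0 complex"
  assumes "\<And>w c. P (Poly_Mapping.single w c)" and "\<And>x y. P x \<Longrightarrow> P y \<Longrightarrow> P (x + y)"
  shows "P x"
proof (induction x rule: update_induct)
  case const
  show ?case using assms(1)[of undefined 0] by simp
next
  case (update f a b)
  have "Poly_Mapping.update a b f = f + Poly_Mapping.single a b"
    using update(1)
    by (intro poly_mapping_eqI)
      (auto simp: lookup_update lookup_add lookup_single when_def in_keys_iff)
  then show ?case using assms(1)[of a b] assms(2) update(3) by simp
qed

lemma lin_ext_superset:
  assumes "finite A" "Poly_Mapping.keys x \<subseteq> A" "s 0 = 0"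
  shows "lin_ext s h x = (\<Sum>w \<in> A. s (Poly_Mapping.lookup x w) * h w)"
  unfolding lin_ext_def using assms
  by (intro sum.mono_neutral_left) (auto simp: in_keys_iff)

lemma lin_ext_single [simp]: "s 0 = 0 \<Longrightarrow> lin_ext s h (Poly_Mapping.single w c) = s c * h w"
  by (subst lin_ext_superset[where A = "{w}"]) auto

lemma lin_ext_id_1: "lin_ext id h (1 :: 'm::monoid_add \<Rightarrow>\<^sub>0 complex) = h 0"
  by (metis id_apply lin_ext_single mult_1 single_one)

lemma lin_ext_add:
  assumes "\<And>a b. s (a + b) = s a + s b"
  shows "lin_ext s h (x + y) = lin_ext s h x + lin_ext s h y"
proof -
  have s0: "s 0 = 0" using assms[of 0 0] by simp
  let ?A = "Poly_Mapping.keys x \<union> Poly_Mapping.keys y"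
  have "Poly_Mapping.keys (x + y) \<subseteq> ?A" by (rule Poly_Mapping.keys_add)
  then show ?thesis
    by (subst (1 2 3) lin_ext_superset[where A = ?A])
      (auto simp: s0 lookup_add assms distrib_right sum.distrib)
qed

lemma scal_mult_single [simp]: "scal c * Poly_Mapping.single w a = Poly_Mapping.single w (c * a)"
  by (simp add: scal_def mult_single)

lemma single_mult_scal [simp]: "Poly_Mapping.single w a * scal c = Poly_Mapping.single w (c * a)"
  by (simp add: scal_def mult_single mult.commute)

lemma scal_central: "scal c * x = x * scal c"
  by (induction x rule: poly_mapping_single_induct) (simp_all add: distrib_left distrib_right)

lemma scal_add: "scal (a + b) = scal a + scal b"
  by (simp add: scal_def single_add)

lemma scal_mult: "scal (a * b) = scal a * scal b"
  by (simp add: scal_def mult_single)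

lemma scal_0 [simp]: "scal 0 = 0"
  by (simp add: scal_def)

lemma scal_1 [simp]: "scal 1 = 1"
  by (simp add: scal_def)

text \<open>The map \<open>s\<close> carries the scalars into the target: \<open>id\<close> for
  functionals, \<open>scal\<close> for maps into an algebra, \<open>scal\<close> after
  \<open>cnj\<close> for the antilinear star. As the target may be noncommutative, the image of
  \<open>s\<close> has to be central.\<close>

lemma lin_ext_mult:
  assumes "\<And>a b. s (a + b) = s a + s b" "\<And>a b. s (a * b) = s a * s b" "\<And>a r. s a * r = r * s a"
    and "\<And>v w. h (v + w) = h v * h w"
  shows "lin_ext s h (x * y) = lin_ext s h x * lin_ext s h y"
proof -
  have s0: "s 0 = 0" using assms(1)[of 0 0] by simp
  note add = lin_ext_add[of s, OF assms(1)]
  have "lin_ext s h (Poly_Mapping.single v a * y)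
      = lin_ext s h (Poly_Mapping.single v a) * lin_ext s h y" for v a
  proof (induction y rule: poly_mapping_single_induct)
    case (single w c)
    have "s a * s c * (h v * h w) = s a * h v * (s c * h w)"
      using assms(3)[of c "h v"] by (simp add: mult.assoc[symmetric]) (simp add: mult.assoc)
    then show ?case by (simp add: mult_single s0 assms(2,4))
  qed (simp add: distrib_left add)
  then show ?thesis
    by (induction x rule: poly_mapping_single_induct) (simp_all add: distrib_right add)
qed

lemma lin_ext_anti_mult:
  assumes "\<And>a b. s (a + b) = s a + s b" "\<And>a b. s (a * b) = s a * s b" "\<And>a r. s a * r = r * s a"
    and "\<And>v w. h (v + w) = h w * h v"
  shows "lin_ext s h (x * y) = lin_ext s h y * lin_ext s h x"
proof -
  have s0: "s 0 = 0" using assms(1)[of 0 0] by simp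
  note add = lin_ext_add[of s, OF assms(1)]
  have "lin_ext s h (Poly_Mapping.single v a * y)
      = lin_ext s h y * lin_ext s h (Poly_Mapping.single v a)" for v a
  proof (induction y rule: poly_mapping_single_induct)
    case (single w c)
    have "s a * s c * (h w * h v) = s c * h w * (s a * h v)"
      using assms(3)[of a "h w"] assms(3)[of a "s c"]
      by (simp add: mult.assoc[symmetric]) (simp add: mult.assoc)
    then show ?case by (simp add: mult_single s0 assms(2,4))
  qed (simp add: distrib_left distrib_right add)
  then show ?thesis
    by (induction x rule: poly_mapping_single_induct) (simp_all add: distrib_right distrib_left add)
qed

lemma lin_ext_scal:
  assumes "\<And>a b. s (a + b) = s a + s b" "\<And>a b. s (a * b) = s a * s b"
  shows "lin_ext s h (scal c * x) = s c * lin_ext s h x"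
proof -
  have s0: "s 0 = 0" using assms(1)[of 0 0] by simp
  show ?thesis
    by (induction x rule: poly_mapping_single_induct)
      (simp_all add: s0 assms mult.assoc distrib_left lin_ext_add)
qed

text \<open>Multiplication by a monomial shifts the argument of \<open>h\<close>. With a coproduct
  for t this becomes a translation of the two factors of a convolution.\<close>

lemma lin_ext_id_single_mult:
  "lin_ext id h (Poly_Mapping.single a c * t) = c * lin_ext id (\<lambda>w. h (a + w)) t"
  by (induction t rule: poly_mapping_single_induct)
    (simp_all add: mult_single distrib_left lin_ext_add)

lemma lin_ext_id_mult_single:
  "lin_ext id h (t * Poly_Mapping.single a c) = c * lin_ext id (\<lambda>w. h (w + a)) t"
  by (induction t rule: poly_mapping_single_induct)
    (simp_all add: mult_single distrib_left distrib_right lin_ext_add)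

lemma lin_fun_lin_ext: "lin_fun (lin_ext id h)"
  by (simp add: lin_fun_def lin_ext_add lin_ext_scal)

lemma lin_fun_add: "lin_fun f \<Longrightarrow> f (x + y) = f x + f y"
  and lin_fun_scal: "lin_fun f \<Longrightarrow> f (scal c * x) = c * f x"
  by (auto simp: lin_fun_def)

lemma lin_fun_0: "lin_fun f \<Longrightarrow> f 0 = 0"
  using lin_fun_add[of f 0 0] by simp

lemma lin_fun_minus: "lin_fun f \<Longrightarrow> f (- x) = - f x"
  using lin_fun_add[of f x "- x"] lin_fun_0[of f] by (simp add: eq_neg_iff_add_eq_0 add.commute)

lemma lin_fun_diff: "lin_fun f \<Longrightarrow> f (x - y) = f x - f y"
  using lin_fun_add[of f x "- y"] by (simp add: lin_fun_minus)

lemma lin_fun_mult_scal: "lin_fun f \<Longrightarrow> f (x * scal c) = c * f x"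
  using lin_fun_scal[of f c x] scal_central[of c x] by simp

lemma lin_fun_mult_scal_mult: "lin_fun f \<Longrightarrow> f (x * (scal c * y)) = c * f (x * y)"
  by (metis lin_fun_scal mult.assoc scal_central)

lemmas lin_fun_simps = lin_fun_add lin_fun_scal lin_fun_0 lin_fun_minus lin_fun_diff
  lin_fun_mult_scal

lemma lin_fun_eqI:
  assumes "lin_fun f" "lin_fun g"
    and "\<And>w. f (Poly_Mapping.single w 1) = g (Poly_Mapping.single w 1)"
  shows "f = g"
proof
  fix x show "f x = g x"
  proof (induction x rule: poly_mapping_single_induct)
    case (single w c)
    have "Poly_Mapping.single w c = scal c * Poly_Mapping.single w 1" by simp
    then show ?case using assms by (metis lin_fun_scal)
  qed (simp add: assms lin_fun_add)
qed

lemma word_single_Nil: "Poly_Mapping.single (Word []) 1 = 1"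
  by (simp flip: zero_word_def)

lemma word_single_Cons:
  "Poly_Mapping.single (Word (a # w)) 1 = gen_of a * Poly_Mapping.single (Word w) 1"
  by (simp add: gen_of_def mult_single plus_word_def)

lemma word_single_snoc:
  "Poly_Mapping.single (Word (w @ [a])) 1 = Poly_Mapping.single (Word w) 1 * gen_of a"
  by (simp add: gen_of_def mult_single plus_word_def)

lemma lin_fun_word_eqI:
  assumes "lin_fun f" "lin_fun g"
    and "\<And>w. f (Poly_Mapping.single (Word w) 1) = g (Poly_Mapping.single (Word w) 1)"
  shows "f = g"
  using assms by (intro lin_fun_eqI) (metis word.exhaust)+

subsection \<open>The Hopf algebra structure on the free algebra\<close>

lemma coprod_lin_ext: "coprod = lin_ext scal (\<lambda>w. prod_list (map coprod_gen (word_letters w)))"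
  by (simp add: fun_eq_iff coprod_def lin_ext_def)

lemma counit_lin_ext: "counit = lin_ext id (\<lambda>w. prod_list (map counit_gen (word_letters w)))"
  by (simp add: fun_eq_iff counit_def lin_ext_def)

lemma antipode_lin_ext:
  "antipode = lin_ext scal (\<lambda>w. prod_list (map antipode_gen (rev (word_letters w))))"
  by (simp add: fun_eq_iff antipode_def lin_ext_def)

lemma uq_star_lin_ext:
  "uq_star = lin_ext (\<lambda>c. scal (cnj c)) (\<lambda>w. prod_list (map uq_star_gen (rev (word_letters w))))"
  by (simp add: fun_eq_iff uq_star_def lin_ext_def)

lemma ucoef_lin_ext:
  "ucoef q i j = lin_ext id (\<lambda>w. foldr (\<lambda>g M. pair_gen q g ** M) (word_letters w) (mat 1) $ i $ j)"
  by (simp add: fun_eq_iff ucoef_def lin_ext_def)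

lemma coprod_mult: "coprod (x * y) = coprod x * coprod y"
  unfolding coprod_lin_ext
  by (intro lin_ext_mult) (rule scal_central | simp add: scal_add scal_mult plus_word_def)+

lemma coprod_add: "coprod (x + y) = coprod x + coprod y"
  by (simp add: coprod_lin_ext lin_ext_add scal_add)

lemma coprod_scal: "coprod (scal c * x) = scal c * coprod x"
  by (simp add: coprod_lin_ext lin_ext_scal scal_add scal_mult)

lemma coprod_gen_of: "coprod (gen_of g) = coprod_gen g"
  by (simp add: coprod_lin_ext gen_of_def)

lemma coprod_1: "coprod 1 = 1"
  unfolding coprod_lin_ext single_one[symmetric]
  by (subst lin_ext_single) (simp_all add: zero_word_def del: single_one, simp)

lemma counit_mult: "counit (x * y) = counit x * counit y"
  unfolding counit_lin_ext by (intro lin_ext_mult) (simp_all add: plus_word_def)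

lemma counit_gen_of: "counit (gen_of g) = counit_gen g"
  by (simp add: counit_lin_ext gen_of_def)

lemma counit_1 [simp]: "counit 1 = 1"
  by (simp add: counit_lin_ext zero_word_def flip: single_one)

lemma lin_fun_counit: "lin_fun counit"
  by (simp add: counit_lin_ext lin_fun_lin_ext)

lemma antipode_mult: "antipode (x * y) = antipode y * antipode x"
  unfolding antipode_lin_ext
  by (intro lin_ext_anti_mult) (rule scal_central | simp add: scal_add scal_mult plus_word_def)+

lemma antipode_gen_of: "antipode (gen_of g) = antipode_gen g"
  by (simp add: antipode_lin_ext gen_of_def)

lemma antipode_1: "antipode 1 = 1"
  unfolding antipode_lin_ext single_one[symmetric]
  by (subst lin_ext_single) (simp_all add: zero_word_def del: single_one, simp add: zero_word_def[symmetric])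

lemma antipode_add: "antipode (x + y) = antipode x + antipode y"
  by (simp add: antipode_lin_ext lin_ext_add scal_add)

lemma antipode_scal: "antipode (scal c * x) = scal c * antipode x"
  by (simp add: antipode_lin_ext lin_ext_scal scal_add scal_mult)

lemma uq_star_mult: "uq_star (x * y) = uq_star y * uq_star x"
  unfolding uq_star_lin_ext
  by (intro lin_ext_anti_mult) (rule scal_central | simp add: scal_add scal_mult plus_word_def)+

lemma uq_star_gen_of: "uq_star (gen_of g) = uq_star_gen g"
  by (simp add: uq_star_lin_ext gen_of_def)

lemma uq_star_add: "uq_star (x + y) = uq_star x + uq_star y"
  by (simp add: uq_star_lin_ext lin_ext_add scal_add)

lemma uq_star_scal: "uq_star (scal c * x) = scal (cnj c) * uq_star x"
  by (simp add: uq_star_lin_ext lin_ext_scal scal_add scal_mult)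

lemma uq_star_diff: "uq_star (x - y) = uq_star x - uq_star y"
  using uq_star_add[of "x - y" y] by simp

lemma lin_fun_ltrans: "lin_fun f \<Longrightarrow> lin_fun (ltrans z f)"
  by (simp add: lin_fun_def ltrans_def distrib_left)
    (metis mult.assoc scal_central)

lemma lin_fun_act: "lin_fun f \<Longrightarrow> lin_fun (act z f)"
  by (simp add: lin_fun_def act_def distrib_right mult.assoc)

lemma act_mult: "act (x * y) f = act x (act y f)"
  by (simp add: act_def mult.assoc)

lemma act_diff: "lin_fun f \<Longrightarrow> act (x - y) f = (\<lambda>z. act x f z - act y f z)"
  by (simp add: act_def right_diff_distrib lin_fun_diff)

lemma act_scal: "lin_fun f \<Longrightarrow> act (scal c * x) f = (\<lambda>z. c * act x f z)"
  by (simp add: act_def fun_eq_iff lin_fun_mult_scal_mult)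

lemma ltrans_mult: "ltrans (x * y) f = ltrans y (ltrans x f)"
  by (simp add: ltrans_def mult.assoc)

subsection \<open>Convolution\<close>

text \<open>In this form the multiplicativity of \<open>coprod\<close> can be used letter by
  letter.\<close>

lemma conv_lin_ext:
  "f \<star> g = (\<lambda>x. lin_ext id (\<lambda>(v, w). f (Poly_Mapping.single v 1) * g (Poly_Mapping.single w 1))
     (coprod x))"
  by (auto simp: conv_def lin_ext_def fun_eq_iff mult.assoc split_def intro!: sum.cong)

lemma tens_single [simp]:
  "tens (Poly_Mapping.single v 1) (Poly_Mapping.single w 1) = Poly_Mapping.single (v, w) 1"
  by (simp add: tens_def)

lemma tens_one_single [simp]:
  "tens 1 (Poly_Mapping.single w 1) = Poly_Mapping.single (0, w) 1"
  "tens (Poly_Mapping.single w 1) 1 = Poly_Mapping.single (w, 0) 1"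
  by (metis single_one tens_single)+

lemma lin_fun_conv: "lin_fun (f \<star> g)"
  by (simp add: lin_fun_def conv_lin_ext coprod_add coprod_scal lin_ext_add lin_ext_scal)

lemma conv_1: "(f \<star> g) 1 = f 1 * g 1"
  by (simp add: conv_lin_ext coprod_1 lin_ext_id_1 zero_prod_def)

lemma conv_add_left: "(\<lambda>x. f x + f' x) \<star> g = (\<lambda>x. (f \<star> g) x + (f' \<star> g) x)"
  by (simp add: conv_def fun_eq_iff split_def algebra_simps sum.distrib)

lemma conv_add_right: "f \<star> (\<lambda>x. g x + g' x) = (\<lambda>x. (f \<star> g) x + (f \<star> g') x)"
  by (simp add: conv_def fun_eq_iff split_def algebra_simps sum.distrib)

lemma conv_scale_left: "(\<lambda>x. c * f x) \<star> g = (\<lambda>x. c * (f \<star> g) x)"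
  by (simp add: conv_def fun_eq_iff split_def sum_distrib_left mult_ac)

lemma conv_scale_right: "f \<star> (\<lambda>x. c * g x) = (\<lambda>x. c * (f \<star> g) x)"
  by (simp add: conv_def fun_eq_iff split_def sum_distrib_left mult_ac)

lemma conv_zero_left: "(\<lambda>x. 0) \<star> g = (\<lambda>x. 0)"
  by (simp add: conv_def)

lemma conv_zero_right: "f \<star> (\<lambda>x. 0) = (\<lambda>x. 0)"
  by (simp add: conv_def)

lemma conv_uminus_left: "(\<lambda>x. - f x) \<star> g = (\<lambda>x. - (f \<star> g) x)"
  using conv_scale_left[of "-1" f g] by simp

lemma conv_uminus_right: "f \<star> (\<lambda>x. - g x) = (\<lambda>x. - (f \<star> g) x)"
  using conv_scale_right[of f "-1" g] by simp

lemma conv_sum_left: "(\<lambda>x. \<Sum>i\<in>I. f i x) \<star> g = (\<lambda>x. \<Sum>i\<in>I. (f i \<star> g) x)"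
  by (induction I rule: infinite_finite_induct) (simp_all add: conv_zero_left conv_add_left)

lemma conv_sum_right: "f \<star> (\<lambda>x. \<Sum>i\<in>I. g i x) = (\<lambda>x. \<Sum>i\<in>I. (f \<star> g i) x)"
  by (induction I rule: infinite_finite_induct) (simp_all add: conv_zero_right conv_add_right)

lemmas conv_linear_simps = conv_add_left conv_add_right conv_scale_left conv_scale_right
  conv_zero_left conv_zero_right conv_uminus_left conv_uminus_right

lemma lin_ext_conv_ltrans:
  "lin_ext id (\<lambda>(v, w). f (Poly_Mapping.single v 1) * g (Poly_Mapping.single w 1))
      (Poly_Mapping.single (a, b) 1 * coprod x)
    = (ltrans (Poly_Mapping.single a 1) f \<star> ltrans (Poly_Mapping.single b 1) g) x"
  by (simp add: lin_ext_id_single_mult conv_lin_ext ltrans_def mult_single split_def)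

lemma lin_ext_conv_act:
  "lin_ext id (\<lambda>(v, w). f (Poly_Mapping.single v 1) * g (Poly_Mapping.single w 1))
      (coprod x * Poly_Mapping.single (a, b) 1)
    = (act (Poly_Mapping.single a 1) f \<star> act (Poly_Mapping.single b 1) g) x"
  by (simp add: lin_ext_id_mult_single conv_lin_ext act_def mult_single split_def)

lemma ltrans_1 [simp]: "ltrans 1 f = f" and act_1 [simp]: "act 1 f = f"
  by (simp_all add: ltrans_def act_def)

lemma ltrans_conv_apply: "ltrans (gen_of a) (f \<star> g) x =
    lin_ext id (\<lambda>(v, w). f (Poly_Mapping.single v 1) * g (Poly_Mapping.single w 1))
      (coprod_gen a * coprod x)"
  by (simp add: ltrans_def conv_lin_ext coprod_mult coprod_gen_of)

lemma act_conv_apply: "act (gen_of a) (f \<star> g) x =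
    lin_ext id (\<lambda>(v, w). f (Poly_Mapping.single v 1) * g (Poly_Mapping.single w 1))
      (coprod x * coprod_gen a)"
  by (simp add: act_def conv_lin_ext coprod_mult coprod_gen_of)

text \<open>The coproducts of the generators read as twisted Leibniz rules. After these formulas and
  their analogues for \<open>act\<close>, the coproduct enters only through them and through the
  value of a convolution at 1.\<close>

lemma ltrans_conv:
  "ltrans (EE i) (f \<star> g) = (\<lambda>x. (ltrans (EE i) f \<star> ltrans (KK i) g) x + (f \<star> ltrans (EE i) g) x)"
  "ltrans (FF i) (f \<star> g) = (\<lambda>x. (ltrans (FF i) f \<star> g) x + (ltrans (KKinv i) f \<star> ltrans (FF i) g) x)"
  "ltrans (KK i) (f \<star> g) = ltrans (KK i) f \<star> ltrans (KK i) g"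
  "ltrans (KKinv i) (f \<star> g) = ltrans (KKinv i) f \<star> ltrans (KKinv i) g"
  by (rule ext, simp only: ltrans_conv_apply,
      simp add: gen_of_def distrib_right lin_ext_add lin_ext_conv_ltrans)+

lemma act_conv:
  "act (EE i) (f \<star> g) = (\<lambda>x. (act (EE i) f \<star> act (KK i) g) x + (f \<star> act (EE i) g) x)"
  "act (FF i) (f \<star> g) = (\<lambda>x. (act (FF i) f \<star> g) x + (act (KKinv i) f \<star> act (FF i) g) x)"
  "act (KK i) (f \<star> g) = act (KK i) f \<star> act (KK i) g"
  "act (KKinv i) (f \<star> g) = act (KKinv i) f \<star> act (KKinv i) g"
  by (rule ext, simp only: act_conv_apply,
      simp add: gen_of_def distrib_left lin_ext_add lin_ext_conv_act)+

lemma ltrans_counit: "ltrans (gen_of g) counit = (\<lambda>x. counit_gen g * counit x)"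
  by (simp add: ltrans_def counit_mult counit_gen_of)

lemma act_counit: "act (gen_of g) counit = (\<lambda>x. counit_gen g * counit x)"
  by (simp add: act_def counit_mult counit_gen_of mult.commute)

lemma ltrans_add_fun: "ltrans z (\<lambda>x. f x + g x) = (\<lambda>x. ltrans z f x + ltrans z g x)"
  by (simp add: ltrans_def)

text \<open>Left translation moves the first letter of a word into the factors. Induction on the
  word, with f, g, h arbitrary, thus reduces the claim to coassociativity on generators.\<close>

lemma conv_assoc: "(f \<star> g) \<star> h = f \<star> (g \<star> h)"
proof (rule lin_fun_word_eqI)
  fix w
  show "(f \<star> g \<star> h) (Poly_Mapping.single (Word w) 1) = (f \<star> (g \<star> h)) (Poly_Mapping.single (Word w) 1)"
  proof (induction w arbitrary: f g h)
    case Nil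
    then show ?case by (simp add: word_single_Nil conv_1)
  next
    case (Cons a w)
    have "ltrans (gen_of a) (f \<star> g \<star> h) (Poly_Mapping.single (Word w) 1)
        = ltrans (gen_of a) (f \<star> (g \<star> h)) (Poly_Mapping.single (Word w) 1)"
      by (cases a) (simp_all add: ltrans_conv conv_linear_simps Cons)
    then show ?case by (simp add: word_single_Cons ltrans_def)
  qed
qed (rule lin_fun_conv)+

lemma conv_counit_right:
  assumes "lin_fun f" shows "f \<star> counit = f"
proof (rule lin_fun_word_eqI)
  fix w
  show "(f \<star> counit) (Poly_Mapping.single (Word w) 1) = f (Poly_Mapping.single (Word w) 1)"
    using assms
  proof (induction w arbitrary: f)
    case Nil
    then show ?case by (simp add: word_single_Nil conv_1)
  next
    case (Cons a w)
    have "ltrans (gen_of a) (f \<star> counit) (Poly_Mapping.single (Word w) 1)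
        = ltrans (gen_of a) f (Poly_Mapping.single (Word w) 1)"
      by (cases a) (simp_all add: ltrans_conv ltrans_counit conv_linear_simps Cons lin_fun_ltrans)
    then show ?case by (simp add: word_single_Cons ltrans_def)
  qed
qed (rule lin_fun_conv, rule assms)

lemma conv_counit_left:
  assumes "lin_fun f" shows "counit \<star> f = f"
proof (rule lin_fun_word_eqI)
  fix w
  show "(counit \<star> f) (Poly_Mapping.single (Word w) 1) = f (Poly_Mapping.single (Word w) 1)"
    using assms
  proof (induction w arbitrary: f)
    case Nil
    then show ?case by (simp add: word_single_Nil conv_1)
  next
    case (Cons a w)
    have "ltrans (gen_of a) (counit \<star> f) (Poly_Mapping.single (Word w) 1)
        = ltrans (gen_of a) f (Poly_Mapping.single (Word w) 1)"
      by (cases a) (simp_all add: ltrans_conv ltrans_counit conv_linear_simps Cons lin_fun_ltrans)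
    then show ?case by (simp add: word_single_Cons ltrans_def)
  qed
qed (rule lin_fun_conv, rule assms)

subsection \<open>Functionals on the quantised enveloping algebra\<close>

lemma free_alg_ring: "ring (free_alg X)"
proof (rule ringI)
  show "abelian_group (free_alg X)"
  proof (rule abelian_groupI)
    fix x assume "x \<in> carrier (free_alg X)"
    then show "\<exists>y\<in>carrier (free_alg X). y \<oplus>\<^bsub>free_alg X\<^esub> x = \<zero>\<^bsub>free_alg X\<^esub>"
      by (intro bexI[of _ "- x"]) (auto simp: free_alg_def)
  qed (use Poly_Mapping.keys_add in \<open>fastforce simp: free_alg_def add_ac\<close>)+
  show "Group.monoid (free_alg X)"
  proof (rule monoidI)
    fix x y assume "x \<in> carrier (free_alg X)" "y \<in> carrier (free_alg X)"
    then show "x \<otimes>\<^bsub>free_alg X\<^esub> y \<in> carrier (free_alg X)"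
      using keys_mult[of x y] by (fastforce simp: free_alg_def plus_word_def)
  qed (auto simp: free_alg_def mult.assoc zero_word_def)
qed (auto simp: free_alg_def algebra_simps)

text \<open>An element of the ideal is reached from sandwiched relations by sums, so vanishing
  becomes a condition on finitely many families of words.\<close>

lemma uq_dual_iff:
  "f \<in> uq_dual q \<longleftrightarrow> lin_fun f \<and> (\<forall>r\<in>uq_relations q. \<forall>y z. f (y * r * z) = 0)"
proof -
  interpret ring "free_alg UNIV :: uq_gen free ring" by (rule free_alg_ring)
  have sub: "uq_relations q \<subseteq> carrier (free_alg UNIV)" by (auto simp: free_alg_def)
  interpret I: ideal "uq_ideal q" "free_alg UNIV :: uq_gen free ring"
    unfolding uq_ideal_def using sub by (rule genideal_ideal)
  have 1: "y * r * z \<in> uq_ideal q" if "r \<in> uq_relations q" for r y z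
  proof -
    have "r \<in> uq_ideal q" unfolding uq_ideal_def using sub genideal_self that by blast
    then have "y \<otimes>\<^bsub>free_alg UNIV\<^esub> r \<otimes>\<^bsub>free_alg UNIV\<^esub> z \<in> uq_ideal q"
      by (intro I.I_l_closed I.I_r_closed) (auto simp: free_alg_def)
    then show ?thesis by (simp add: free_alg_def)
  qed
  have 2: "f x = 0" if f: "lin_fun f" "\<forall>r\<in>uq_relations q. \<forall>y z. f (y * r * z) = 0"
    and x: "x \<in> uq_ideal q" for x
  proof -
    \<comment> \<open>The largest two-sided ideal inside the kernel of f. It contains the relations,
      hence the ideal they generate.\<close>
    let ?J = "{x. \<forall>y z. f (y * x * z) = 0}"
    have "ideal ?J (free_alg UNIV)"
    proof (rule idealI)
      show "subgroup ?J (add_monoid (free_alg UNIV))"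
      proof
        fix x assume "x \<in> ?J"
        moreover have "inv\<^bsub>add_monoid (free_alg UNIV)\<^esub> x = - x"
          unfolding a_inv_def[symmetric] by (rule minus_equality) (auto simp: free_alg_def)
        ultimately show "inv\<^bsub>add_monoid (free_alg UNIV)\<^esub> x \<in> ?J"
          using f(1) by (simp add: lin_fun_minus)
      qed (use f(1) in \<open>auto simp: free_alg_def lin_fun_simps distrib_left distrib_right\<close>)
    next
      fix a x assume a: "a \<in> ?J"
      show "x \<otimes>\<^bsub>free_alg UNIV\<^esub> a \<in> ?J"
        using a by (simp add: free_alg_def) (metis mult.assoc)
      show "a \<otimes>\<^bsub>free_alg UNIV\<^esub> x \<in> ?J"
        using a by (simp add: free_alg_def) (metis mult.assoc)
    qed (rule free_alg_ring)
    then have "uq_ideal q \<subseteq> ?J"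
      unfolding uq_ideal_def using f(2) by (intro genideal_minimal) auto
    with x have "f (1 * x * 1) = 0" by blast
    then show ?thesis by simp
  qed
  show ?thesis
  proof
    assume "f \<in> uq_dual q"
    then have "lin_fun f" "\<And>x. x \<in> uq_ideal q \<Longrightarrow> f x = 0"
      unfolding uq_dual_def lin_fun_def by blast+
    with 1 show "lin_fun f \<and> (\<forall>r\<in>uq_relations q. \<forall>y z. f (y * r * z) = 0)" by blast
  next
    assume "lin_fun f \<and> (\<forall>r\<in>uq_relations q. \<forall>y z. f (y * r * z) = 0)"
    with 2 show "f \<in> uq_dual q" unfolding uq_dual_def lin_fun_def by blast
  qed
qed

lemma uq_dual_lin: "f \<in> uq_dual q \<Longrightarrow> lin_fun f"
  by (simp add: uq_dual_iff)

lemma uq_dual_rel: "f \<in> uq_dual q \<Longrightarrow> r \<in> uq_relations q \<Longrightarrow> f (y * r * z) = 0"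
  by (simp add: uq_dual_iff)

lemma uq_dual_act: "f \<in> uq_dual q \<Longrightarrow> act z f \<in> uq_dual q"
  unfolding uq_dual_iff by (intro conjI lin_fun_act) (auto simp: act_def mult.assoc[of _ _ z])

lemma uq_dual_ltrans: "f \<in> uq_dual q \<Longrightarrow> ltrans z f \<in> uq_dual q"
  unfolding uq_dual_iff
  by (intro conjI lin_fun_ltrans) (auto simp: ltrans_def mult.assoc[of z, symmetric])

lemma uq_dual_add: "f \<in> uq_dual q \<Longrightarrow> g \<in> uq_dual q \<Longrightarrow> (\<lambda>x. f x + g x) \<in> uq_dual q"
  by (simp add: uq_dual_iff lin_fun_def algebra_simps)

lemma uq_dual_scale: "f \<in> uq_dual q \<Longrightarrow> (\<lambda>x. c * f x) \<in> uq_dual q"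
  by (simp add: uq_dual_iff lin_fun_def algebra_simps)

section \<open>Reordering words with the defining relations\<close>

lemma uq_relations_cases [consumes 1, case_names KKinv KinvK KK KE KF EF EEE FFF]:
  assumes "r \<in> uq_relations q"
    and "\<And>i. P (KK i * KKinv i - 1)" and "\<And>i. P (KKinv i * KK i - 1)"
    and "\<And>i j. P (KK i * KK j - KK j * KK i)"
    and "\<And>i j. P (KK i * EE j - scal (of_real (q powi cartan i j)) * EE j * KK i)"
    and "\<And>i j. P (KK i * FF j - scal (of_real (q powi (- cartan i j))) * FF j * KK i)"
    and "\<And>i j. P (EE i * FF j - FF j * EE i
       - (if i = j then scal (of_real (1 / (q - 1 / q))) * (KK i - KKinv i) else 0))"
    and "\<And>i j. i \<noteq> j \<Longrightarrow> P (EE i * EE i * EE j - scal (of_real (q + 1 / q)) * EE i * EE j * EE i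
       + EE j * EE i * EE i)"
    and "\<And>i j. i \<noteq> j \<Longrightarrow> P (FF i * FF i * FF j - scal (of_real (q + 1 / q)) * FF i * FF j * FF i
       + FF j * FF i * FF i)"
  shows "P r"
  using assms(1) unfolding uq_relations_def
  by (elim UnE CollectE exE conjE) (simp_all only: assms(2-) simp_thms not_False_eq_True)

lemma uq_relations_intros:
  shows "KK i * KKinv i - 1 \<in> uq_relations q"
    "KKinv i * KK i - 1 \<in> uq_relations q"
    "KK i * KK j - KK j * KK i \<in> uq_relations q"
    "KK i * EE j - scal (of_real (q powi cartan i j)) * EE j * KK i \<in> uq_relations q"
    "KK i * FF j - scal (of_real (q powi (- cartan i j))) * FF j * KK i \<in> uq_relations q"
    "EE i * FF j - FF j * EE i
       - (if i = j then scal (of_real (1 / (q - 1 / q))) * (KK i - KKinv i) else 0) \<in> uq_relations q"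
    "i \<noteq> j \<Longrightarrow> EE i * EE i * EE j - scal (of_real (q + 1 / q)) * EE i * EE j * EE i + EE j * EE i * EE i \<in> uq_relations q"
    "i \<noteq> j \<Longrightarrow> FF i * FF i * FF j - scal (of_real (q + 1 / q)) * FF i * FF j * FF i + FF j * FF i * FF i \<in> uq_relations q"
  unfolding uq_relations_def
  subgoal by (rule UnI1, rule UnI1, rule UnI1, rule UnI1, rule UnI1, rule UnI1, rule UnI1, rule CollectI, rule exI, rule conjI, rule refl, rule TrueI)
  subgoal by (rule UnI1, rule UnI1, rule UnI1, rule UnI1, rule UnI1, rule UnI1, rule UnI2, rule CollectI, rule exI, rule conjI, rule refl, rule TrueI)
  subgoal by (rule UnI1, rule UnI1, rule UnI1, rule UnI1, rule UnI1, rule UnI2, rule CollectI, (rule exI)+, rule conjI, rule refl, rule TrueI)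
  subgoal by (rule UnI1, rule UnI1, rule UnI1, rule UnI1, rule UnI2, rule CollectI, (rule exI)+, rule conjI, rule refl, rule TrueI)
  subgoal by (rule UnI1, rule UnI1, rule UnI1, rule UnI2, rule CollectI, (rule exI)+, rule conjI, rule refl, rule TrueI)
  subgoal by (rule UnI1, rule UnI1, rule UnI2, rule CollectI, (rule exI)+, rule conjI, rule refl, rule TrueI)
  subgoal by (rule UnI1, rule UnI2, rule CollectI, rule exI, rule exI, rule conjI, rule refl, assumption)
  subgoal by (rule UnI2, rule CollectI, rule exI, rule exI, rule conjI, rule refl, assumption)
  done

lemma lin_fun_scal_prod:
  assumes "lin_fun f"
  shows "f (scal c * x * y) = c * f (x * y)" "f (scal c * x * y * z) = c * f (x * y * z)"
  by (simp_all add: mult.assoc lin_fun_scal[OF assms])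

lemma lin_fun_scal_1: "lin_fun f \<Longrightarrow> f (scal c) = c * f 1"
  using lin_fun_scal[of f c 1] by simp

text \<open>The relations as rewriting rules: y and z are arbitrary contexts, so a functional on the
  quotient may be evaluated after reordering letters anywhere in a word.\<close>

lemma uq_dual_commute:
  assumes "f \<in> uq_dual q"
  shows "f (y * KK i * KKinv i * z) = f (y * z)" "f (y * KKinv i * KK i * z) = f (y * z)"
    "f (y * KK i * KK j * z) = f (y * KK j * KK i * z)"
    "f (y * KK i * EE j * z) = of_real (q powi cartan i j) * f (y * EE j * KK i * z)"
    "f (y * KK i * FF j * z) = of_real (q powi (- cartan i j)) * f (y * FF j * KK i * z)"
    "f (y * EE i * FF j * z) = f (y * FF j * EE i * z) +
       (if i = j then of_real (1 / (q - 1 / q)) * (f (y * KK i * z) - f (y * KKinv i * z)) else 0)"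
    "i \<noteq> j \<Longrightarrow> f (y * EE i * EE i * EE j * z) = of_real (q + 1 / q) * f (y * EE i * EE j * EE i * z)
       - f (y * EE j * EE i * EE i * z)"
    "i \<noteq> j \<Longrightarrow> f (y * FF i * FF i * FF j * z) = of_real (q + 1 / q) * f (y * FF i * FF j * FF i * z)
       - f (y * FF j * FF i * FF i * z)"
proof -
  note lin = uq_dual_lin[OF assms]
  have r: "f (y * r * z) = 0" if "r \<in> uq_relations q" for r
    using uq_dual_rel[OF assms that] .
  have s: "y * (scal c * a * b) * z = scal c * (y * a * b * z)" for c a b
    by (simp add: mult.assoc[symmetric] scal_central[of c y, symmetric])
  have s3: "y * (scal c * a * b * d) * z = scal c * (y * a * b * d * z)" for c a b d
    by (simp add: mult.assoc[symmetric] scal_central[of c y, symmetric])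
  have s1: "y * (scal c * a) * z = scal c * (y * a * z)" for c a
    by (simp add: mult.assoc[symmetric] scal_central[of c y, symmetric])
  have s1': "y * (scal c * (a - b)) * z = scal c * (y * a * z - y * b * z)" for c a b
    unfolding s1 by (simp add: right_diff_distrib left_diff_distrib)
  have move: "a = b - c" if "a - b + c = 0" for a b c :: complex
    using that by (simp add: algebra_simps)
  note dist = right_diff_distrib[of y] left_diff_distrib[of _ _ z] distrib_left[of y]
    distrib_right[of _ _ z] lin_fun_simps[OF lin]
  have "KK i * KKinv i - 1 \<in> uq_relations q" by (intro uq_relations_intros)
  from r[OF this] show "f (y * KK i * KKinv i * z) = f (y * z)"
    by (simp only: dist) (simp add: mult.assoc)
  have "KKinv i * KK i - 1 \<in> uq_relations q" by (intro uq_relations_intros)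
  from r[OF this] show "f (y * KKinv i * KK i * z) = f (y * z)"
    by (simp only: dist) (simp add: mult.assoc)
  have "KK i * KK j - KK j * KK i \<in> uq_relations q" by (intro uq_relations_intros)
  from r[OF this] show "f (y * KK i * KK j * z) = f (y * KK j * KK i * z)"
    by (simp only: dist) (simp add: mult.assoc)
  have "KK i * EE j - scal (of_real (q powi cartan i j)) * EE j * KK i \<in> uq_relations q"
    by (intro uq_relations_intros)
  from r[OF this] show "f (y * KK i * EE j * z) = of_real (q powi cartan i j) * f (y * EE j * KK i * z)"
    by (simp only: dist s)
      (simp add: mult.assoc)
  have "KK i * FF j - scal (of_real (q powi (- cartan i j))) * FF j * KK i \<in> uq_relations q"
    by (intro uq_relations_intros)
  from r[OF this] show "f (y * KK i * FF j * z) = of_real (q powi (- cartan i j)) * f (y * FF j * KK i * z)"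
    by (simp only: dist s)
      (simp add: mult.assoc)
  have "EE i * FF j - FF j * EE i
       - (if i = j then scal (of_real (1 / (q - 1 / q))) * (KK i - KKinv i) else 0) \<in> uq_relations q"
    by (intro uq_relations_intros)
  from r[OF this] show "f (y * EE i * FF j * z) = f (y * FF j * EE i * z) +
       (if i = j then of_real (1 / (q - 1 / q)) * (f (y * KK i * z) - f (y * KKinv i * z)) else 0)"
    by (cases "i = j"; simp only: dist s1' simp_thms if_True if_False)
      (simp_all add: mult.assoc lin_fun_simps[OF lin] diff_eq_eq)
  assume "i \<noteq> j"
  then have "EE i * EE i * EE j - scal (of_real (q + 1 / q)) * EE i * EE j * EE i + EE j * EE i * EE i
      \<in> uq_relations q" by (intro uq_relations_intros)
  from r[OF this] show "f (y * EE i * EE i * EE j * z) = of_real (q + 1 / q) * f (y * EE i * EE j * EE i * z)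
       - f (y * EE j * EE i * EE i * z)"
    by (intro move) (simp only: dist s3, simp add: mult.assoc)
  from \<open>i \<noteq> j\<close> have "FF i * FF i * FF j - scal (of_real (q + 1 / q)) * FF i * FF j * FF i + FF j * FF i * FF i
      \<in> uq_relations q" by (intro uq_relations_intros)
  from r[OF this] show "f (y * FF i * FF i * FF j * z) = of_real (q + 1 / q) * f (y * FF i * FF j * FF i * z)
       - f (y * FF j * FF i * FF i * z)"
    by (intro move) (simp only: dist s3, simp add: mult.assoc)
qed

text \<open>The relations do not say how \<open>KKinv\<close> passes E or F. Each rule comes from
  inserting K_i^(-1) K_i, moving K_i across and cancelling.\<close>

lemma uq_dual_commute_inv:
  assumes f: "f \<in> uq_dual q" and q: "q \<noteq> 0"
  shows "f (y * KKinv i * EE j * z) = of_real (q powi (- cartan i j)) * f (y * EE j * KKinv i * z)"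
    "f (y * KKinv i * FF j * z) = of_real (q powi cartan i j) * f (y * FF j * KKinv i * z)"
    "f (y * KKinv i * KKinv j * z) = f (y * KKinv j * KKinv i * z)"
    "f (y * KK i * KKinv j * z) = f (y * KKinv j * KK i * z)"
proof -
  have "f (y * KK i * KKinv j * z) = f (y * KKinv j * KK j * KK i * KKinv j * z)"
    using uq_dual_commute(2)[OF f, of y j "KK i * KKinv j * z"] by (simp add: mult.assoc)
  also have "\<dots> = f (y * KKinv j * KK i * KK j * KKinv j * z)"
    using uq_dual_commute(3)[OF f, of "y * KKinv j" j i "KKinv j * z"] by (simp add: mult.assoc)
  also have "\<dots> = f (y * KKinv j * KK i * z)"
    using uq_dual_commute(1)[OF f, of "y * KKinv j * KK i" j z] by simp
  finally show "f (y * KK i * KKinv j * z) = f (y * KKinv j * KK i * z)" .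
  have "f (y * EE j * KKinv i * z) = f (y * KKinv i * KK i * EE j * KKinv i * z)"
    using uq_dual_commute(2)[OF f, of y i "EE j * KKinv i * z"] by (simp add: mult.assoc)
  also have "\<dots> = of_real (q powi cartan i j) * f (y * KKinv i * EE j * KK i * KKinv i * z)"
    using uq_dual_commute(4)[OF f, of "y * KKinv i" i j "KKinv i * z"] by (simp add: mult.assoc)
  also have "\<dots> = of_real (q powi cartan i j) * f (y * KKinv i * EE j * z)"
    using uq_dual_commute(1)[OF f, of "y * KKinv i * EE j" i z] by simp
  finally show "f (y * KKinv i * EE j * z) = of_real (q powi (- cartan i j)) * f (y * EE j * KKinv i * z)"
    using q by (simp add: power_int_minus)
  have "f (y * FF j * KKinv i * z) = f (y * KKinv i * KK i * FF j * KKinv i * z)"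
    using uq_dual_commute(2)[OF f, of y i "FF j * KKinv i * z"] by (simp add: mult.assoc)
  also have "\<dots> = of_real (q powi (- cartan i j)) * f (y * KKinv i * FF j * KK i * KKinv i * z)"
    using uq_dual_commute(5)[OF f, of "y * KKinv i" i j "KKinv i * z"] by (simp add: mult.assoc)
  also have "\<dots> = of_real (q powi (- cartan i j)) * f (y * KKinv i * FF j * z)"
    using uq_dual_commute(1)[OF f, of "y * KKinv i * FF j" i z] by simp
  finally show "f (y * KKinv i * FF j * z) = of_real (q powi cartan i j) * f (y * FF j * KKinv i * z)"
    using q by (simp add: power_int_minus)
  have "f (y * KKinv i * KKinv j * z) = f (y * KKinv i * KKinv j * KK i * KKinv i * z)"
    using uq_dual_commute(1)[OF f, of "y * KKinv i * KKinv j" i z] by simp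
  also have "\<dots> = f (y * KKinv i * KKinv j * KK i * KK j * KKinv j * KKinv i * z)"
    using uq_dual_commute(1)[OF f, of "y * KKinv i * KKinv j * KK i" j "KKinv i * z"]
    by (simp add: mult.assoc)
  also have "\<dots> = f (y * KKinv i * KKinv j * KK j * KK i * KKinv j * KKinv i * z)"
    using uq_dual_commute(3)[OF f, of "y * KKinv i * KKinv j" i j "KKinv j * KKinv i * z"]
    by (simp add: mult.assoc)
  also have "\<dots> = f (y * KKinv i * KK i * KKinv j * KKinv i * z)"
    using uq_dual_commute(2)[OF f, of "y * KKinv i" j "KK i * KKinv j * KKinv i * z"]
    by (simp add: mult.assoc)
  also have "\<dots> = f (y * KKinv j * KKinv i * z)"
    using uq_dual_commute(2)[OF f, of y i "KKinv j * KKinv i * z"] by (simp add: mult.assoc)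
  finally show "f (y * KKinv i * KKinv j * z) = f (y * KKinv j * KKinv i * z)" .
qed

text \<open>Letters to the right or left of r are absorbed by \<open>act\<close> or
  \<open>ltrans\<close> into f and g, and the translates stay in the dual. So a relation has to be
  tested only without context.\<close>

lemma conv_vanish_extend:
  assumes base: "\<And>f g. f \<in> uq_dual q \<Longrightarrow> g \<in> uq_dual q \<Longrightarrow> (f \<star> g) r = 0"
    and "f \<in> uq_dual q" "g \<in> uq_dual q"
  shows "(f \<star> g) (y * r * z) = 0"
proof -
  have 1: "(f \<star> g) (r * Poly_Mapping.single (Word w) 1) = 0"
    if "f \<in> uq_dual q" "g \<in> uq_dual q" for f g w
    using that
  proof (induction w arbitrary: f g rule: rev_induct)
    case Nil
    then show ?case by (simp add: word_single_Nil base)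
  next
    case (snoc a w)
    have "act (gen_of a) (f \<star> g) (r * Poly_Mapping.single (Word w) 1) = 0"
      by (cases a) (simp_all add: act_conv snoc uq_dual_act)
    then show ?case by (simp add: word_single_snoc act_def mult.assoc)
  qed
  have 2: "(f \<star> g) (r * z) = 0" if "f \<in> uq_dual q" "g \<in> uq_dual q" for f g
  proof -
    have "ltrans r (f \<star> g) = (\<lambda>_. 0)"
      using 1[OF that] by (intro lin_fun_word_eqI lin_fun_ltrans lin_fun_conv) (simp_all add: lin_fun_def ltrans_def)
    then show ?thesis by (metis ltrans_def)
  qed
  have 3: "(f \<star> g) (Poly_Mapping.single (Word w) 1 * (r * z)) = 0"
    if "f \<in> uq_dual q" "g \<in> uq_dual q" for f g w
    using that
  proof (induction w arbitrary: f g)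
    case Nil
    then show ?case by (simp add: word_single_Nil 2)
  next
    case (Cons a w)
    have "ltrans (gen_of a) (f \<star> g) (Poly_Mapping.single (Word w) 1 * (r * z)) = 0"
      by (cases a) (simp_all add: ltrans_conv Cons uq_dual_ltrans)
    then show ?case by (simp add: word_single_Cons ltrans_def mult.assoc)
  qed
  have "act (r * z) (f \<star> g) = (\<lambda>_. 0)"
    using 3[OF assms(2,3)]
    by (intro lin_fun_word_eqI lin_fun_act lin_fun_conv) (simp_all add: lin_fun_def act_def)
  then show ?thesis by (metis act_def mult.assoc)
qed

lemma conv_mult_gen:
  "(f \<star> g) (x * EE i) = (act (EE i) f \<star> act (KK i) g) x + (f \<star> act (EE i) g) x"
  "(f \<star> g) (x * FF i) = (act (FF i) f \<star> g) x + (act (KKinv i) f \<star> act (FF i) g) x"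
  "(f \<star> g) (x * KK i) = (act (KK i) f \<star> act (KK i) g) x"
  "(f \<star> g) (x * KKinv i) = (act (KKinv i) f \<star> act (KKinv i) g) x"
  using act_conv[of i f g, unfolded fun_eq_iff] by (simp_all add: act_def[of _ "f \<star> g"])

lemma conv_gen:
  "(f \<star> g) (EE i) = f (EE i) * g (KK i) + f 1 * g (EE i)"
  "(f \<star> g) (FF i) = f (FF i) * g 1 + f (KKinv i) * g (FF i)"
  "(f \<star> g) (KK i) = f (KK i) * g (KK i)"
  "(f \<star> g) (KKinv i) = f (KKinv i) * g (KKinv i)"
  using conv_mult_gen[of f g 1 i] by (simp_all add: conv_1 act_def)

text \<open>This is dual to the coproduct being well defined on the quotient: each relation is
  expanded by the coproduct and both legs are brought to a normal form.\<close>

lemma uq_dual_conv: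
  assumes q: "q \<notin> {-1, 0, 1}" and "f \<in> uq_dual q" "g \<in> uq_dual q"
  shows "f \<star> g \<in> uq_dual q"
proof -
  have q0: "q \<noteq> 0" using q by simp
  define Q R where "Q = complex_of_real q" and "R = 1 / complex_of_real q"
  have R_eq: "R = 1 / Q" and Q0: "Q \<noteq> 0" using q0 by (simp_all add: Q_def R_def)
  have "(f \<star> g) r = 0" if r: "r \<in> uq_relations q" and f: "f \<in> uq_dual q" and g: "g \<in> uq_dual q" for f g r
    using r
  proof (induct rule: uq_relations_cases)
    case (KKinv i)
    show ?case
      using uq_dual_commute(1)[OF f, of 1 i 1] uq_dual_commute(1)[OF g, of 1 i 1]
      by (simp add: lin_fun_simps[OF lin_fun_conv] conv_mult_gen conv_gen conv_1 act_def)
  next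
    case (KinvK i)
    show ?case
      using uq_dual_commute(2)[OF f, of 1 i 1] uq_dual_commute(2)[OF g, of 1 i 1]
      by (simp add: lin_fun_simps[OF lin_fun_conv] conv_mult_gen conv_gen conv_1 act_def)
  next
    case (KK i j)
    show ?case
      using uq_dual_commute(3)[OF f, of 1 i j 1] uq_dual_commute(3)[OF g, of 1 i j 1]
      by (simp add: lin_fun_simps[OF lin_fun_conv] conv_mult_gen conv_gen conv_1 act_def)
  next
    case (KE i j)
    show ?case
      using uq_dual_commute(4)[OF f, of 1 i j 1] uq_dual_commute(4)[OF g, of 1 i j 1]
         uq_dual_commute(3)[OF g, of 1 i j 1]
      by (simp add: lin_fun_simps[OF lin_fun_conv] lin_fun_scal_prod[OF lin_fun_conv]
         conv_mult_gen conv_gen conv_1 act_def algebra_simps)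
  next
    case (KF i j)
    show ?case
      using uq_dual_commute(5)[OF f, of 1 i j 1] uq_dual_commute(5)[OF g, of 1 i j 1]
        uq_dual_commute_inv(4)[OF f q0, of 1 i j 1]
      by (simp add: lin_fun_simps[OF lin_fun_conv] lin_fun_scal_prod[OF lin_fun_conv]
         conv_mult_gen conv_gen conv_1 act_def algebra_simps)
  next
    case (EF i j)
    have "cartan i j = cartan j i" by (simp add: cartan_def)
    then show ?case 
      using uq_dual_commute(6)[OF f, of 1 i j 1] uq_dual_commute(6)[OF g, of 1 i j 1]
        uq_dual_commute(5)[OF g, of 1 i j 1] uq_dual_commute_inv(1)[OF f q0, of 1 j i 1]
      by (simp add: lin_fun_scal_1[OF lin_fun_conv] lin_fun_simps[OF lin_fun_conv] lin_fun_scal_prod[OF lin_fun_conv]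
         conv_mult_gen conv_gen conv_1 act_def algebra_simps add_divide_distrib diff_divide_distrib)
  next
    case (EEE i j)
    \<comment> \<open>In the coproduct E (x) K + 1 (x) E only the second leg contains letters K.
      Hence the words in g are sorted, K to the right, while f sees words in E alone.\<close>
    have KE: "g (KK i * EE i * z) = Q * Q * g (EE i * KK i * z)"
      "g (y * KK i * EE i) = Q * Q * g (y * EE i * KK i)"
      "g (KK i * EE j * z) = R * g (EE j * KK i * z)"
      "g (y * KK i * EE j) = R * g (y * EE j * KK i)"
      "g (KK j * EE i * z) = R * g (EE i * KK j * z)"
      "g (y * KK j * EE i) = R * g (y * EE i * KK j)" for y z
      using uq_dual_commute(4)[OF g, of 1 i i z] uq_dual_commute(4)[OF g, of y i i 1] uq_dual_commute(4)[OF g, of 1 i j z]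
        uq_dual_commute(4)[OF g, of y i j 1] uq_dual_commute(4)[OF g, of 1 j i z] uq_dual_commute(4)[OF g, of y j i 1] EEE
      by (simp_all add: cartan_def Q_def R_def power2_eq_square divide_inverse)
    have KK: "g (KK j * KK i * z) = g (KK i * KK j * z)"
      "g (y * KK j * KK i) = g (y * KK i * KK j)" for y z
      using uq_dual_commute(3)[OF g, of 1 j i z] uq_dual_commute(3)[OF g, of y j i 1] by simp_all
    have S: "h (EE i * EE i * EE j) = (Q + R) * h (EE i * EE j * EE i) - h (EE j * EE i * EE i)"
      if "h \<in> uq_dual q" for h
      using uq_dual_commute(7)[OF that EEE, of 1 1] by (simp add: Q_def R_def)
    have "complex_of_real (q + 1 / q) = Q + R" by (simp add: Q_def R_def)
    then show ?case
      by (simp only: lin_fun_simps[OF lin_fun_conv] lin_fun_scal_prod[OF lin_fun_conv])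
       (simp only: conv_mult_gen conv_gen conv_1 act_def KE KK S[OF f] S[OF g] mult_1 mult_1_right,
        simp add: R_eq Q0 field_simps)
  next
    case (FFF i j)
    \<comment> \<open>For F (x) 1 + K^(-1) (x) F the letters K^(-1) occur in the first leg, so here
      the words in f are sorted.\<close>
    have KE: "f (KKinv i * FF i * z) = Q * Q * f (FF i * KKinv i * z)"
      "f (y * KKinv i * FF i) = Q * Q * f (y * FF i * KKinv i)"
      "f (KKinv i * FF j * z) = R * f (FF j * KKinv i * z)"
      "f (y * KKinv i * FF j) = R * f (y * FF j * KKinv i)"
      "f (KKinv j * FF i * z) = R * f (FF i * KKinv j * z)"
      "f (y * KKinv j * FF i) = R * f (y * FF i * KKinv j)" for y z
      using uq_dual_commute_inv(2)[OF f q0, of 1 i i z] uq_dual_commute_inv(2)[OF f q0, of y i i 1] uq_dual_commute_inv(2)[OF f q0, of 1 i j z]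
        uq_dual_commute_inv(2)[OF f q0, of y i j 1] uq_dual_commute_inv(2)[OF f q0, of 1 j i z] uq_dual_commute_inv(2)[OF f q0, of y j i 1] FFF
      by (simp_all add: cartan_def Q_def R_def power2_eq_square divide_inverse)
    have KK: "f (KKinv j * KKinv i * z) = f (KKinv i * KKinv j * z)"
      "f (y * KKinv j * KKinv i) = f (y * KKinv i * KKinv j)" for y z
      using uq_dual_commute_inv(3)[OF f q0, of 1 j i z] uq_dual_commute_inv(3)[OF f q0, of y j i 1] by simp_all
    have S: "h (FF i * FF i * FF j) = (Q + R) * h (FF i * FF j * FF i) - h (FF j * FF i * FF i)"
      if "h \<in> uq_dual q" for h
      using uq_dual_commute(8)[OF that FFF, of 1 1] by (simp add: Q_def R_def)
    have "complex_of_real (q + 1 / q) = Q + R" by (simp add: Q_def R_def)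
    then show ?case
      by (simp only: lin_fun_simps[OF lin_fun_conv] lin_fun_scal_prod[OF lin_fun_conv])
       (simp only: conv_mult_gen conv_gen conv_1 act_def KE KK S[OF f] S[OF g] mult_1 mult_1_right,
        simp add: R_eq Q0 field_simps)
  qed
  then have "(f \<star> g) (y * r * z) = 0" if "r \<in> uq_relations q" for r y z
    using conv_vanish_extend assms(2,3) that by metis
  then show ?thesis by (simp add: uq_dual_iff[of "f \<star> g"] lin_fun_conv)
qed

lemma powi_cartan:
  "complex_of_real q powi cartan i j = (if i = j then of_real q * of_real q else 1 / of_real q)"
  "complex_of_real q powi (- cartan i j) = (if i = j then 1 / (of_real q * of_real q) else of_real q)"
  by (simp_all add: cartan_def power2_eq_square power_int_minus divide_inverse)

subsection \<open>The matrix coefficients of the vector representation\<close>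

lemma neq_2 [simp]: "(1::2) \<noteq> 2" "(2::2) \<noteq> 1"
  and neq_3 [simp]: "(1::3) \<noteq> 2" "(2::3) \<noteq> 1" "(1::3) \<noteq> 3" "(3::3) \<noteq> 1" "(2::3) \<noteq> 3" "(3::3) \<noteq> 2"
  by simp_all

lemma lin_fun_ucoef: "lin_fun (ucoef q i j)"
  by (simp add: ucoef_lin_ext lin_fun_lin_ext)

lemma ucoef_1: "ucoef q i j 1 = (if i = j then 1 else 0)"
  by (simp add: ucoef_lin_ext lin_ext_id_1 zero_word_def mat_def)

lemma ucoef_gen_mult:
  "ucoef q i j (gen_of g * x) = (\<Sum>a\<in>UNIV. pair_gen q g $ i $ a * ucoef q a j x)"
  unfolding ucoef_lin_ext
  by (induction x rule: poly_mapping_single_induct)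
    (simp_all add: gen_of_def mult_single plus_word_def matrix_matrix_mult_def sum_distrib_left
      mult_ac distrib_left lin_ext_add sum.distrib)

lemma ucoef_mult: "ucoef q i j (x * y) = (\<Sum>a\<in>UNIV. ucoef q i a x * ucoef q a j y)"
proof -
  have *: "ucoef q i j (Poly_Mapping.single (Word w) 1 * y)
     = (\<Sum>a\<in>UNIV. ucoef q i a (Poly_Mapping.single (Word w) 1) * ucoef q a j y)" for w
  proof (induction w arbitrary: i)
    case Nil
    have "(\<Sum>a\<in>UNIV. (if i = a then 1 else 0) * ucoef q a j y) = ucoef q i j y"
      by (simp add: if_distrib[of "\<lambda>c. c * _"] cong: if_cong)
    then show ?case by (simp add: word_single_Nil ucoef_1)
  next
    case (Cons g w)
    then show ?case
      by (simp add: word_single_Cons mult.assoc ucoef_gen_mult sum_distrib_left sum_distrib_right)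
        (subst sum.swap, simp add: mult.assoc)
  qed
  have "act y (ucoef q i j) = (\<lambda>x. \<Sum>a\<in>UNIV. ucoef q i a x * ucoef q a j y)"
  proof (rule lin_fun_word_eqI)
    show "lin_fun (\<lambda>x. \<Sum>a\<in>UNIV. ucoef q i a x * ucoef q a j y)"
      by (simp add: lin_fun_def lin_fun_simps[OF lin_fun_ucoef] algebra_simps sum.distrib sum_distrib_left)
  qed (rule lin_fun_act, rule lin_fun_ucoef, simp add: act_def *)
  then show ?thesis by (metis act_def)
qed

lemma ucoef_gen: "ucoef q i j (gen_of g) = pair_gen q g $ i $ j"
  using ucoef_gen_mult[of q i j g 1]
  by (simp add: ucoef_1 if_distrib[of "\<lambda>c. _ * c"] cong: if_cong)

definition sucoef :: "real \<Rightarrow> 3 \<Rightarrow> 3 \<Rightarrow> qfun"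
  where "sucoef q i j = (\<lambda>x. ucoef q i j (antipode x))"

lemma lin_fun_sucoef: "lin_fun (sucoef q i j)"
  by (simp add: lin_fun_def sucoef_def antipode_add antipode_scal lin_fun_simps[OF lin_fun_ucoef])

lemma sucoef_1: "sucoef q i j 1 = (if i = j then 1 else 0)"
  by (simp add: sucoef_def antipode_1 ucoef_1)

lemma sucoef_mult: "sucoef q i j (x * y) = (\<Sum>a\<in>UNIV. sucoef q a j x * sucoef q i a y)"
  by (simp add: sucoef_def antipode_mult ucoef_mult mult.commute)

lemma sucoef_gen:
  "sucoef q i j (EE k) = (if k = 1 \<and> i = 2 \<and> j = 1 \<or> k = 2 \<and> i = 3 \<and> j = 2 then - of_real q else 0)"
  "sucoef q i j (FF k) = (if k = 1 \<and> i = 1 \<and> j = 2 \<or> k = 2 \<and> i = 2 \<and> j = 3 then - of_real (1 / q) else 0)"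
  "sucoef q i j (KK k) = pair_gen q (gKinv k) $ i $ j"
  "sucoef q i j (KKinv k) = pair_gen q (gK k) $ i $ j"
  using exhaust_2[of k] exhaust_3[of i] exhaust_3[of j]
  by (auto simp: sucoef_def antipode_gen_of lin_fun_simps[OF lin_fun_ucoef] ucoef_mult ucoef_gen sum_3)

lemma uq_dual_ucoef:
  assumes q: "q \<notin> {-1, 0, 1}"
  shows "ucoef q i j \<in> uq_dual q"
proof -
  have q0: "q \<noteq> 0" using q by simp
  \<comment> \<open>This is the denominator in the relation between E_i and F_i; for real q it
    vanishes only if q^2 = 1.\<close>
  have q1: "complex_of_real q - 1 / complex_of_real q \<noteq> 0"
    using q by (auto simp: field_simps power2_eq_1_iff simp flip: power2_eq_square of_real_power)
  have "ucoef q i j r = 0" if "r \<in> uq_relations q" for i j r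
    using that
  proof (induct rule: uq_relations_cases)
    case (KKinv k)
    show ?case using exhaust_2[of k] exhaust_3[of i] exhaust_3[of j]
      by (safe; simp add: lin_fun_simps[OF lin_fun_ucoef] ucoef_mult ucoef_gen ucoef_1 sum_3 q0)
  next
    case (KinvK k)
    show ?case using exhaust_2[of k] exhaust_3[of i] exhaust_3[of j]
      by (safe; simp add: lin_fun_simps[OF lin_fun_ucoef] ucoef_mult ucoef_gen ucoef_1 sum_3 q0)
  next
    case (KK k l)
    show ?case using exhaust_2[of k] exhaust_2[of l] exhaust_3[of i] exhaust_3[of j]
      by (safe; simp add: lin_fun_simps[OF lin_fun_ucoef] ucoef_mult ucoef_gen ucoef_1 sum_3 q0)
  next
    case (KE k l)
    show ?case using exhaust_2[of k] exhaust_2[of l] exhaust_3[of i] exhaust_3[of j]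
      by (safe; simp add: lin_fun_simps[OF lin_fun_ucoef] lin_fun_scal_prod[OF lin_fun_ucoef] lin_fun_scal_1[OF lin_fun_ucoef]
          ucoef_mult ucoef_gen ucoef_1 sum_3 q0 powi_cartan)
  next
    case (KF k l)
    show ?case using exhaust_2[of k] exhaust_2[of l] exhaust_3[of i] exhaust_3[of j]
      by (safe; simp add: lin_fun_simps[OF lin_fun_ucoef] lin_fun_scal_prod[OF lin_fun_ucoef] lin_fun_scal_1[OF lin_fun_ucoef]
          ucoef_mult ucoef_gen ucoef_1 sum_3 q0 powi_cartan)
  next
    case (EF k l)
    show ?case using exhaust_2[of k] exhaust_2[of l] exhaust_3[of i] exhaust_3[of j] q1
      by (safe; simp add: lin_fun_simps[OF lin_fun_ucoef] lin_fun_scal_prod[OF lin_fun_ucoef] lin_fun_scal_1[OF lin_fun_ucoef]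
          ucoef_mult ucoef_gen ucoef_1 sum_3 q0 divide_simps)
  next
    case (EEE k l)
    show ?case using exhaust_2[of k] exhaust_2[of l] exhaust_3[of i] exhaust_3[of j]
      by (safe; simp add: lin_fun_simps[OF lin_fun_ucoef] lin_fun_scal_prod[OF lin_fun_ucoef] lin_fun_scal_1[OF lin_fun_ucoef]
          ucoef_mult ucoef_gen ucoef_1 sum_3)
  next
    case (FFF k l)
    show ?case using exhaust_2[of k] exhaust_2[of l] exhaust_3[of i] exhaust_3[of j]
      by (safe; simp add: lin_fun_simps[OF lin_fun_ucoef] lin_fun_scal_prod[OF lin_fun_ucoef] lin_fun_scal_1[OF lin_fun_ucoef]
          ucoef_mult ucoef_gen ucoef_1 sum_3)
  qed
  then show ?thesis by (simp add: uq_dual_iff lin_fun_ucoef ucoef_mult)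
qed

text \<open>These functionals reverse products and belong to the contragredient representation.
  Checking the relations there directly takes the place of showing that the antipode preserves the
  ideal.\<close>

lemma uq_dual_sucoef:
  assumes q: "q \<notin> {-1, 0, 1}"
  shows "sucoef q i j \<in> uq_dual q"
proof -
  have q0: "q \<noteq> 0" using q by simp
  have q1: "complex_of_real q - 1 / complex_of_real q \<noteq> 0"
    using q by (auto simp: field_simps power2_eq_1_iff simp flip: power2_eq_square of_real_power)
  have "sucoef q i j r = 0" if "r \<in> uq_relations q" for i j r
    using that
  proof (induct rule: uq_relations_cases)
    case (KKinv k)
    show ?case using exhaust_2[of k] exhaust_3[of i] exhaust_3[of j]
      by (safe; simp add: lin_fun_simps[OF lin_fun_sucoef] sucoef_mult sucoef_gen sucoef_1 sum_3 q0)
  next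
    case (KinvK k)
    show ?case using exhaust_2[of k] exhaust_3[of i] exhaust_3[of j]
      by (safe; simp add: lin_fun_simps[OF lin_fun_sucoef] sucoef_mult sucoef_gen sucoef_1 sum_3 q0)
  next
    case (KK k l)
    show ?case using exhaust_2[of k] exhaust_2[of l] exhaust_3[of i] exhaust_3[of j]
      by (safe; simp add: lin_fun_simps[OF lin_fun_sucoef] sucoef_mult sucoef_gen sucoef_1 sum_3 q0)
  next
    case (KE k l)
    show ?case using exhaust_2[of k] exhaust_2[of l] exhaust_3[of i] exhaust_3[of j]
      by (safe; simp add: lin_fun_simps[OF lin_fun_sucoef] lin_fun_scal_prod[OF lin_fun_sucoef] lin_fun_scal_1[OF lin_fun_sucoef]
          sucoef_mult sucoef_gen sucoef_1 sum_3 q0 powi_cartan)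
  next
    case (KF k l)
    show ?case using exhaust_2[of k] exhaust_2[of l] exhaust_3[of i] exhaust_3[of j]
      by (safe; simp add: lin_fun_simps[OF lin_fun_sucoef] lin_fun_scal_prod[OF lin_fun_sucoef] lin_fun_scal_1[OF lin_fun_sucoef]
          sucoef_mult sucoef_gen sucoef_1 sum_3 q0 powi_cartan)
  next
    case (EF k l)
    show ?case using exhaust_2[of k] exhaust_2[of l] exhaust_3[of i] exhaust_3[of j] q1
      by (safe; simp add: lin_fun_simps[OF lin_fun_sucoef] lin_fun_scal_prod[OF lin_fun_sucoef] lin_fun_scal_1[OF lin_fun_sucoef]
          sucoef_mult sucoef_gen sucoef_1 sum_3 q0 divide_simps)
  next
    case (EEE k l)
    show ?case using exhaust_2[of k] exhaust_2[of l] exhaust_3[of i] exhaust_3[of j]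
      by (safe; simp add: lin_fun_simps[OF lin_fun_sucoef] lin_fun_scal_prod[OF lin_fun_sucoef] lin_fun_scal_1[OF lin_fun_sucoef]
          sucoef_mult sucoef_gen sucoef_1 sum_3)
  next
    case (FFF k l)
    show ?case using exhaust_2[of k] exhaust_2[of l] exhaust_3[of i] exhaust_3[of j]
      by (safe; simp add: lin_fun_simps[OF lin_fun_sucoef] lin_fun_scal_prod[OF lin_fun_sucoef] lin_fun_scal_1[OF lin_fun_sucoef]
          sucoef_mult sucoef_gen sucoef_1 sum_3)
  qed
  then show ?thesis by (simp add: uq_dual_iff lin_fun_sucoef sucoef_mult)
qed

lemma uq_dual_counit:
  assumes q: "q \<notin> {-1, 0, 1}"
  shows "counit \<in> uq_dual q"
proof -
  have "counit r = 0" if "r \<in> uq_relations q" for r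
    using that
    by (induct rule: uq_relations_cases)
      (auto simp: lin_fun_simps[OF lin_fun_counit] counit_mult counit_gen_of lin_fun_scal_1[OF lin_fun_counit])
  then show ?thesis by (simp add: uq_dual_iff lin_fun_counit counit_mult)
qed

subsection \<open>Translates of elements of the quantum function algebra\<close>

lemma act_add_fun: "act z (\<lambda>x. f x + g x) = (\<lambda>x. act z f x + act z g x)"
  and act_scale_fun: "act z (\<lambda>x. c * f x) = (\<lambda>x. c * act z f x)"
  and act_diff_fun: "act z (\<lambda>x. f x - g x) = (\<lambda>x. act z f x - act z g x)"
  and act_uminus_fun: "act z (\<lambda>x. - f x) = (\<lambda>x. - act z f x)"
  and act_zero_fun: "act z (\<lambda>x. 0) = (\<lambda>x. 0)"
  by (simp_all add: act_def)

lemma conv_divide: "(\<lambda>x. f x / c) \<star> g = (\<lambda>x. (f \<star> g) x / c)"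
  "f \<star> (\<lambda>x. g x / c) = (\<lambda>x. (f \<star> g) x / c)"
  using conv_scale_left[of "1 / c" f g] conv_scale_right[of f "1 / c" g] by simp_all

lemma act_divide_fun: "act z (\<lambda>x. f x / c) = (\<lambda>x. act z f x / c)"
  by (simp add: act_def)

lemma ltrans_scale_fun: "ltrans z (\<lambda>x. c * f x) = (\<lambda>x. c * ltrans z f x)"
  by (simp add: ltrans_def)

lemmas act_linear_simps = act_add_fun act_scale_fun act_diff_fun act_uminus_fun act_zero_fun

lemma hopf_gen_scale: "a \<in> hopf_gen q \<Longrightarrow> (\<lambda>x. c * a x) \<in> hopf_gen q"
  by (rule hopf_gen.intros)

lemma hopf_gen_add: "a \<in> hopf_gen q \<Longrightarrow> b \<in> hopf_gen q \<Longrightarrow> (\<lambda>x. a x + b x) \<in> hopf_gen q"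
  by (rule hopf_gen.intros)

lemma hopf_gen_zero: "(\<lambda>x. 0) \<in> hopf_gen q"
  using hopf_gen_scale[OF hopf_gen.intros(2)[of q], of 0] by simp

lemma hopf_gen_sum: "(\<And>i. i \<in> I \<Longrightarrow> f i \<in> hopf_gen q) \<Longrightarrow> (\<lambda>x. \<Sum>i\<in>I. f i x) \<in> hopf_gen q"
  by (induction I rule: infinite_finite_induct) (auto simp: hopf_gen_zero intro: hopf_gen_add)

lemma hopf_gen_act_words:
  assumes "lin_fun f" "\<And>w. act (Poly_Mapping.single (Word w) 1) f \<in> hopf_gen q"
  shows "act v f \<in> hopf_gen q"
proof (induction v rule: poly_mapping_single_induct)
  case (single w c)
  have "act (Poly_Mapping.single w c) f = (\<lambda>x. c * act (Poly_Mapping.single w 1) f x)"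
    using act_scal[OF assms(1), of c "Poly_Mapping.single w 1"] by simp
  then show ?case using assms(2) by (metis hopf_gen_scale word.exhaust)
next
  case (add x y)
  have "act (x + y) f = (\<lambda>z. act x f z + act y f z)"
    using assms(1) by (simp add: act_def distrib_left lin_fun_add)
  with add show ?case by (simp add: hopf_gen_add)
qed

lemma hopf_gen_ltrans_words:
  assumes "lin_fun f" "\<And>w. ltrans (Poly_Mapping.single (Word w) 1) f \<in> hopf_gen q"
  shows "ltrans v f \<in> hopf_gen q"
proof (induction v rule: poly_mapping_single_induct)
  case (single w c)
  have "ltrans (Poly_Mapping.single w c) f x = c * ltrans (Poly_Mapping.single w 1) f x" for x
    using lin_fun_scal[OF assms(1), of c "Poly_Mapping.single w 1 * x"]
    by (simp add: ltrans_def mult.assoc[symmetric])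
  then show ?case using assms(2) by (metis (no_types, lifting) ext hopf_gen_scale word.exhaust)
next
  case (add x y)
  have "ltrans (x + y) f = (\<lambda>z. ltrans x f z + ltrans y f z)"
    using assms(1) by (simp add: ltrans_def distrib_right lin_fun_add)
  with add show ?case by (simp add: hopf_gen_add)
qed

text \<open>Removing a letter of the translating word replaces a and b by translates, so the
  induction needs the hypothesis for all translates at once.\<close>

lemma hopf_gen_act_conv:
  assumes "\<And>v. act v a \<in> hopf_gen q" "\<And>v. act v b \<in> hopf_gen q"
  shows "act v (a \<star> b) \<in> hopf_gen q"
proof (rule hopf_gen_act_words[OF lin_fun_conv])
  fix w show "act (Poly_Mapping.single (Word w) 1) (a \<star> b) \<in> hopf_gen q"
    using assms
  proof (induction w arbitrary: a b rule: rev_induct)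
    case Nil
    then show ?case using Nil(1)[of 1] Nil(2)[of 1] by (simp add: word_single_Nil hopf_gen.intros(5))
  next
    case (snoc g w)
    have *: "act (Poly_Mapping.single (Word w) 1) (act u a \<star> act v b) \<in> hopf_gen q" for u v
      using snoc by (intro snoc.IH) (simp_all flip: act_mult)
    have **: "act (Poly_Mapping.single (Word w) 1) (a \<star> act v b) \<in> hopf_gen q"
      "act (Poly_Mapping.single (Word w) 1) (act v a \<star> b) \<in> hopf_gen q" for v
      using *[of 1 v] *[of v 1] by simp_all
    show ?case
      unfolding word_single_snoc act_mult
      by (cases g) (simp_all add: act_conv act_add_fun hopf_gen_add * **)
  qed
qed

lemma hopf_gen_ltrans_conv:
  assumes "\<And>v. ltrans v a \<in> hopf_gen q" "\<And>v. ltrans v b \<in> hopf_gen q"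
  shows "ltrans v (a \<star> b) \<in> hopf_gen q"
proof (rule hopf_gen_ltrans_words[OF lin_fun_conv])
  fix w show "ltrans (Poly_Mapping.single (Word w) 1) (a \<star> b) \<in> hopf_gen q"
    using assms
  proof (induction w arbitrary: a b)
    case Nil
    then show ?case using Nil(1)[of 1] Nil(2)[of 1] by (simp add: word_single_Nil hopf_gen.intros(5))
  next
    case (Cons g w)
    have *: "ltrans (Poly_Mapping.single (Word w) 1) (ltrans u a \<star> ltrans v b) \<in> hopf_gen q" for u v
      using Cons by (intro Cons.IH) (simp_all flip: ltrans_mult)
    have **: "ltrans (Poly_Mapping.single (Word w) 1) (a \<star> ltrans v b) \<in> hopf_gen q"
      "ltrans (Poly_Mapping.single (Word w) 1) (ltrans v a \<star> b) \<in> hopf_gen q" for v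
      using *[of 1 v] *[of v 1] by simp_all
    show ?case
      unfolding word_single_Cons ltrans_mult
      by (cases g) (simp_all add: ltrans_conv ltrans_add_fun hopf_gen_add * **)
  qed
qed

text \<open>The two kinds of translation are treated together because the antipode exchanges
  them.\<close>

lemma hopf_gen_translate:
  assumes "a \<in> hopf_gen q"
  shows "(\<forall>v. act v a \<in> hopf_gen q) \<and> (\<forall>v. ltrans v a \<in> hopf_gen q)"
  using assms
proof induction
  case (1 i j)
  have "(\<lambda>x. \<Sum>c\<in>UNIV. ucoef q c j v * ucoef q i c x) \<in> hopf_gen q"
    "(\<lambda>x. \<Sum>c\<in>UNIV. ucoef q i c v * ucoef q c j x) \<in> hopf_gen q" for v
    by (intro hopf_gen_sum hopf_gen_scale hopf_gen.intros)+
  then show ?case by (simp add: act_def ltrans_def ucoef_mult mult.commute)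
next
  case 2
  have "act v counit = (\<lambda>x. counit v * counit x)" "ltrans v counit = (\<lambda>x. counit v * counit x)" for v
    by (simp_all add: act_def ltrans_def counit_mult mult.commute)
  then show ?case by (simp add: hopf_gen_scale hopf_gen.intros(2))
next
  case (3 a b)
  then show ?case by (simp add: act_add_fun ltrans_add_fun hopf_gen_add)
next
  case (4 a c)
  then show ?case by (simp add: act_scale_fun ltrans_scale_fun hopf_gen_scale)
next
  case (5 a b)
  then show ?case by (simp add: hopf_gen_act_conv hopf_gen_ltrans_conv)
next
  case (6 a)
  have "act v (\<lambda>x. a (antipode x)) = (\<lambda>x. ltrans (antipode v) a (antipode x))"
    "ltrans v (\<lambda>x. a (antipode x)) = (\<lambda>x. act (antipode v) a (antipode x))" for v
    by (simp_all add: act_def ltrans_def antipode_mult)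
  with 6 show ?case by (simp add: hopf_gen.intros(6))
qed

lemma oq_su3_act: "a \<in> oq_su3 q \<Longrightarrow> act v a \<in> oq_su3 q"
  by (simp add: oq_su3_def uq_dual_act hopf_gen_translate)

lemma oq_su3_conv:
  "q \<notin> {-1, 0, 1} \<Longrightarrow> a \<in> oq_su3 q \<Longrightarrow> b \<in> oq_su3 q \<Longrightarrow> a \<star> b \<in> oq_su3 q"
  by (simp add: oq_su3_def uq_dual_conv hopf_gen.intros(5))

lemma oq_su3_add: "a \<in> oq_su3 q \<Longrightarrow> b \<in> oq_su3 q \<Longrightarrow> (\<lambda>x. a x + b x) \<in> oq_su3 q"
  by (simp add: oq_su3_def uq_dual_add hopf_gen_add)

lemma oq_su3_scale: "a \<in> oq_su3 q \<Longrightarrow> (\<lambda>x. c * a x) \<in> oq_su3 q"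
  by (simp add: oq_su3_def uq_dual_scale hopf_gen_scale)

lemma lin_fun_oq_su3: "a \<in> oq_su3 q \<Longrightarrow> lin_fun a"
  by (auto simp: oq_su3_def intro: uq_dual_lin)

text \<open>K_i^(-1) inverts K_i for functionals that vanish on the ideal, so invariance under K_i
  passes to its inverse.\<close>

lemma oq_f3_iff: "b \<in> oq_f3 q \<longleftrightarrow> b \<in> oq_su3 q \<and> (\<forall>i. act (KK i) b = b)"
proof -
  have "act (KKinv i) b = b" if "b \<in> oq_su3 q" "act (KK i) b = b" for i
  proof
    fix y
    have "act (KKinv i) b y = b (y * KKinv i * KK i)"
      using fun_cong[OF that(2), of "y * KKinv i"] by (simp add: act_def)
    also have "\<dots> = b y"
      using uq_dual_commute(2)[of b q y i 1] that(1) by (simp add: oq_su3_def)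
    finally show "act (KKinv i) b y = b y" .
  qed
  then show ?thesis by (auto simp: oq_f3_def)
qed

lemma oq_f3_add: "a \<in> oq_f3 q \<Longrightarrow> b \<in> oq_f3 q \<Longrightarrow> (\<lambda>x. a x + b x) \<in> oq_f3 q"
  by (simp add: oq_f3_iff oq_su3_add act_add_fun)

lemma oq_f3_scale: "a \<in> oq_f3 q \<Longrightarrow> (\<lambda>x. c * a x) \<in> oq_f3 q"
  by (simp add: oq_f3_iff oq_su3_scale act_scale_fun)

lemma oq_f3_conv: "q \<notin> {-1, 0, 1} \<Longrightarrow> a \<in> oq_f3 q \<Longrightarrow> b \<in> oq_f3 q \<Longrightarrow> a \<star> b \<in> oq_f3 q"
  by (simp add: oq_f3_iff oq_su3_conv act_conv)

lemma oq_f3_counit: "q \<notin> {-1, 0, 1} \<Longrightarrow> counit \<in> oq_f3 q"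
  by (simp add: oq_f3_iff oq_su3_def uq_dual_counit hopf_gen.intros(2) act_counit)

subsection \<open>The antipode identities for the matrix coefficients\<close>

text \<open>Invariance strips a word letter by letter down to 1. Contractions of matrix coefficients
  are identified with constants in this way: invariance is checked on generators and the constant is
  read off at 1.\<close>

lemma ltrans_invariant:
  assumes lin: "lin_fun f" and inv: "\<And>g. ltrans (gen_of g) f = (\<lambda>x. counit_gen g * f x)"
  shows "f = (\<lambda>x. f 1 * counit x)"
proof (rule lin_fun_word_eqI[OF lin])
  show "lin_fun (\<lambda>x. f 1 * counit x)"
    using lin_fun_counit by (simp add: lin_fun_def algebra_simps)
  fix w show "f (Poly_Mapping.single (Word w) 1) = f 1 * counit (Poly_Mapping.single (Word w) 1)"
  proof (induction w)
    case (Cons g w)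
    have "f (gen_of g * Poly_Mapping.single (Word w) 1) = counit_gen g * f (Poly_Mapping.single (Word w) 1)"
      using inv[of g] by (metis ltrans_def)
    with Cons show ?case by (simp add: word_single_Cons counit_mult counit_gen_of)
  qed (simp add: word_single_Nil)
qed

lemma ltrans_ucoef: "ltrans (gen_of g) (ucoef q i j)
    = (\<lambda>x. pair_gen q g $ i $ 1 * ucoef q 1 j x + pair_gen q g $ i $ 2 * ucoef q 2 j x
        + pair_gen q g $ i $ 3 * ucoef q 3 j x)"
  by (simp add: ltrans_def ucoef_mult ucoef_gen sum_3)

lemma act_ucoef: "act (gen_of g) (ucoef q i j)
    = (\<lambda>x. pair_gen q g $ 1 $ j * ucoef q i 1 x + pair_gen q g $ 2 $ j * ucoef q i 2 x
        + pair_gen q g $ 3 $ j * ucoef q i 3 x)"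
  by (simp add: act_def ucoef_mult ucoef_gen sum_3 mult.commute)

lemma ltrans_sucoef: "ltrans (gen_of g) (sucoef q i j)
    = (\<lambda>x. sucoef q 1 j (gen_of g) * sucoef q i 1 x + sucoef q 2 j (gen_of g) * sucoef q i 2 x
        + sucoef q 3 j (gen_of g) * sucoef q i 3 x)"
  by (simp add: ltrans_def sucoef_mult sum_3)

lemma act_sucoef: "act (gen_of g) (sucoef q i j)
    = (\<lambda>x. sucoef q i 1 (gen_of g) * sucoef q 1 j x + sucoef q i 2 (gen_of g) * sucoef q 2 j x
        + sucoef q i 3 (gen_of g) * sucoef q 3 j x)"
  by (simp add: act_def sucoef_mult sum_3 mult.commute)

lemma lin_fun_sum: "(\<And>i. i \<in> I \<Longrightarrow> lin_fun (f i)) \<Longrightarrow> lin_fun (\<lambda>x. \<Sum>i\<in>I. f i x)"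
  by (simp add: lin_fun_def sum.distrib sum_distrib_left)

lemma lin_fun_scale: "lin_fun f \<Longrightarrow> lin_fun (\<lambda>x. c * f x)"
  by (simp add: lin_fun_def algebra_simps)

text \<open>This half of the antipode axiom follows because the contraction over j is invariant
  under left translation.\<close>

lemma sucoef_conv_ucoef:
  assumes q0: "q \<noteq> 0"
  shows "(\<lambda>x. \<Sum>j\<in>UNIV. (sucoef q m j \<star> ucoef q j p) x) = (\<lambda>x. (if m = p then 1 else 0) * counit x)"
proof -
  let ?f = "\<lambda>x. \<Sum>j\<in>UNIV. (sucoef q m j \<star> ucoef q j p) x"
  have "ltrans (gen_of g) ?f = (\<lambda>x. counit_gen g * ?f x)" for g
  proof (cases g)
    case (gE k)
    show ?thesis unfolding gE using exhaust_2[of k] q0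
      by (safe; simp add: ltrans_add_fun sum_3 ltrans_conv ltrans_ucoef ltrans_sucoef sucoef_gen conv_linear_simps conv_divide)
  next
    case (gF k)
    show ?thesis unfolding gF using exhaust_2[of k] q0
      by (safe; simp add: ltrans_add_fun sum_3 ltrans_conv ltrans_ucoef ltrans_sucoef sucoef_gen conv_linear_simps conv_divide)
  next
    case (gK k)
    show ?thesis unfolding gK using exhaust_2[of k] q0
      by (safe; simp add: ltrans_add_fun sum_3 ltrans_conv ltrans_ucoef ltrans_sucoef sucoef_gen conv_linear_simps conv_divide)
  next
    case (gKinv k)
    show ?thesis unfolding gKinv using exhaust_2[of k] q0
      by (safe; simp add: ltrans_add_fun sum_3 ltrans_conv ltrans_ucoef ltrans_sucoef sucoef_gen conv_linear_simps conv_divide)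
  qed
  then have "?f = (\<lambda>x. ?f 1 * counit x)"
    by (intro ltrans_invariant lin_fun_sum lin_fun_conv)
  moreover have "?f 1 = (if m = p then 1 else 0)"
    by (simp add: conv_1 sucoef_1 ucoef_1 if_distrib[of "\<lambda>c. c * _"] cong: if_cong)
  ultimately show ?thesis by simp
qed

text \<open>
  With these weights c, the functional \<open>M \<mapsto> \<Sum>j. c j * M j j\<close> on matrices is invariant under the
  action \<open>X_(1) M S(X_(2))\<close> of X in the quantised enveloping algebra.
\<close>

definition qtr_weight :: "real \<Rightarrow> 3 \<Rightarrow> complex"
  where "qtr_weight q j = (if j = 1 then 1 else if j = 2 then of_real q ^ 2 else of_real q ^ 4)"

text \<open>The weights compensate for the order of the factors. The square of the antipode
  multiplies u_ij by c_i / c_j, c being the weights, so c_j u_ja = c_a S(S(u_ja)), and the sum is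
  c_a times S applied to the sum over j of u_bj S(u_ja). The calculation below instead verifies
  invariance on generators.\<close>

lemma quantum_trace:
  assumes q0: "q \<noteq> 0"
  shows "(\<lambda>x. \<Sum>j\<in>UNIV. qtr_weight q j * (ucoef q j a \<star> sucoef q b j) x)
    = (\<lambda>x. (if a = b then qtr_weight q a else 0) * counit x)"
proof -
  let ?f = "\<lambda>x. \<Sum>j\<in>UNIV. qtr_weight q j * (ucoef q j a \<star> sucoef q b j) x"
  have "ltrans (gen_of g) ?f = (\<lambda>x. counit_gen g * ?f x)" for g
  proof (cases g)
    case (gE k)
    show ?thesis unfolding gE using exhaust_2[of k] q0
      by (safe; simp add: qtr_weight_def ltrans_add_fun ltrans_scale_fun sum_3 ltrans_conv ltrans_ucoef ltrans_sucoef
          sucoef_gen conv_linear_simps conv_divide power2_eq_square power4_eq_xxxx)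
  next
    case (gF k)
    show ?thesis unfolding gF using exhaust_2[of k] q0
      by (safe; simp add: qtr_weight_def ltrans_add_fun ltrans_scale_fun sum_3 ltrans_conv ltrans_ucoef ltrans_sucoef
          sucoef_gen conv_linear_simps conv_divide power2_eq_square power4_eq_xxxx)
  next
    case (gK k)
    show ?thesis unfolding gK using exhaust_2[of k] q0
      by (safe; simp add: qtr_weight_def ltrans_add_fun ltrans_scale_fun sum_3 ltrans_conv ltrans_ucoef ltrans_sucoef
          sucoef_gen conv_linear_simps conv_divide)
  next
    case (gKinv k)
    show ?thesis unfolding gKinv using exhaust_2[of k] q0
      by (safe; simp add: qtr_weight_def ltrans_add_fun ltrans_scale_fun sum_3 ltrans_conv ltrans_ucoef ltrans_sucoef
          sucoef_gen conv_linear_simps conv_divide)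
  qed
  then have "?f = (\<lambda>x. ?f 1 * counit x)"
    by (intro ltrans_invariant lin_fun_sum lin_fun_scale lin_fun_conv)
  moreover have "?f 1 = (if a = b then qtr_weight q a else 0)"
    using exhaust_3[of a] exhaust_3[of b] by (auto simp: conv_1 sucoef_1 ucoef_1 sum_3)
  ultimately show ?thesis by simp
qed

subsection \<open>Weight vectors in the adjoint representation\<close>

text \<open>Entry (i, j) of u E_ab S(u), where E_ab is a matrix unit. Right translation acts on (a,
  b) as the adjoint representation acts on E_ab and leaves i and j alone.\<close>

definition wcoef :: "real \<Rightarrow> 3 \<Rightarrow> 3 \<Rightarrow> 3 \<Rightarrow> 3 \<Rightarrow> qfun"
  where "wcoef q a b i j = ucoef q i a \<star> sucoef q b j"

lemma lin_fun_wcoef: "lin_fun (wcoef q a b i j)"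
  by (simp add: wcoef_def lin_fun_conv)

lemma hopf_gen_sucoef: "sucoef q i j \<in> hopf_gen q"
  unfolding sucoef_def by (intro hopf_gen.intros)

lemma oq_su3_wcoef: "q \<notin> {-1, 0, 1} \<Longrightarrow> wcoef q a b i j \<in> oq_su3 q"
  unfolding wcoef_def
  by (intro oq_su3_conv)
    (simp_all add: oq_su3_def uq_dual_ucoef uq_dual_sucoef hopf_gen.intros(1) hopf_gen_sucoef del: insert_iff)

lemma act_wcoef_K: "act (KK k) (wcoef q a b i j)
    = (\<lambda>x. pair_gen q (gK k) $ a $ a * pair_gen q (gKinv k) $ b $ b * wcoef q a b i j x)"
  using exhaust_2[of k] exhaust_3[of a] exhaust_3[of b]
  by (safe; simp add: wcoef_def act_conv act_ucoef act_sucoef sucoef_gen conv_linear_simps conv_divide mult.assoc)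

text \<open>The factor with \<open>gKinv\<close> is K acting on the leg S(u) in E (x) K; the factor
  - q comes from S(E) = - E K^(-1).\<close>

lemma act_wcoef_E:
  "act (EE 1) (wcoef q a b i j) = (\<lambda>x. (if a = 1 then pair_gen q (gKinv 1) $ b $ b * wcoef q 2 b i j x else 0)
      - (if b = 2 then of_real q * wcoef q a 1 i j x else 0))"
  "act (EE 2) (wcoef q a b i j) = (\<lambda>x. (if a = 2 then pair_gen q (gKinv 2) $ b $ b * wcoef q 3 b i j x else 0)
      - (if b = 3 then of_real q * wcoef q a 2 i j x else 0))"
  using exhaust_3[of a] exhaust_3[of b]
  by (safe; simp add: wcoef_def act_conv act_ucoef act_sucoef sucoef_gen conv_linear_simps conv_divide)+

lemma act_wcoef_F:
  "act (FF 1) (wcoef q a b i j) = (\<lambda>x. (if a = 2 then wcoef q 1 b i j x else 0)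
      - (if b = 1 then pair_gen q (gKinv 1) $ a $ a / of_real q * wcoef q a 2 i j x else 0))"
  "act (FF 2) (wcoef q a b i j) = (\<lambda>x. (if a = 3 then wcoef q 2 b i j x else 0)
      - (if b = 2 then pair_gen q (gKinv 2) $ a $ a / of_real q * wcoef q a 3 i j x else 0))"
  using exhaust_3[of a] exhaust_3[of b]
  by (safe; simp add: wcoef_def act_conv act_ucoef act_sucoef sucoef_gen conv_linear_simps conv_divide)+

text \<open>The basis vector with index k has the weight of the matrix unit at (trow k, tcol k).\<close>

fun trow :: "tindex \<Rightarrow> 3" and tcol :: "tindex \<Rightarrow> 3"
  where
    "trow (Ei Alpha1) = 2" | "trow (Ei Alpha2) = 3" | "trow (Ei Alpha12) = 3"
  | "trow (Fi Alpha1) = 1" | "trow (Fi Alpha2) = 2" | "trow (Fi Alpha12) = 1"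
  | "tcol (Ei Alpha1) = 1" | "tcol (Ei Alpha2) = 2" | "tcol (Ei Alpha12) = 1"
  | "tcol (Fi Alpha1) = 2" | "tcol (Fi Alpha2) = 3" | "tcol (Fi Alpha12) = 3"

text \<open>The factor with which \<open>tvec q k\<close> sends the matrix unit (p, p) to
  (\<open>trow k\<close>, \<open>tcol k\<close>). For fixed k the values add up to 0, because the
  identity matrix is invariant. At p = 2 the value is 0 for \<open>Ei Alpha12\<close> but not for
  \<open>Fi Alpha12\<close>; this is the source of the extra term in eta 1 2.\<close>

fun tcoef :: "real \<Rightarrow> tindex \<Rightarrow> 3 \<Rightarrow> complex"
  where
    "tcoef q (Ei Alpha1) p = (if p = 1 then of_real q else if p = 2 then - of_real q else 0)"
  | "tcoef q (Ei Alpha2) p = (if p = 1 then 0 else if p = 2 then of_real q else - of_real q)"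
  | "tcoef q (Ei Alpha12) p = (if p = 1 then of_real q else if p = 2 then 0 else - of_real q)"
  | "tcoef q (Fi Alpha1) p = (if p = 1 then - 1 / of_real q ^ 2 else if p = 2 then 1 / of_real q ^ 2 else 0)"
  | "tcoef q (Fi Alpha2) p = (if p = 1 then 0 else if p = 2 then - 1 / of_real q ^ 2 else 1 / of_real q ^ 2)"
  | "tcoef q (Fi Alpha12) p = (if p = 1 then - 1 / of_real q ^ 5
      else if p = 2 then 1 / of_real q ^ 5 - 1 / of_real q ^ 3 else 1 / of_real q ^ 3)"

lemma tvec_simps:
  "tvec q (Fi Alpha1) = KK 1 * FF 1" "tvec q (Fi Alpha2) = KK 2 * FF 2"
  "tvec q (Fi Alpha12) = KK 1 * FF 1 * (KK 2 * FF 2)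
     - scal (of_real (1 / q)) * (KK 2 * FF 2 * (KK 1 * FF 1))"
  by (simp_all add: uq_star_diff uq_star_scal mult.assoc) (simp_all add: uq_star_mult uq_star_gen_of mult.assoc)

lemma act_tvec:
  assumes "lin_fun f"
  shows "act (tvec q (Ei Alpha1)) f = act (EE 1) f"
    "act (tvec q (Ei Alpha2)) f = act (EE 2) f"
    "act (tvec q (Ei Alpha12)) f
      = (\<lambda>x. act (EE 2) (act (EE 1) f) x - act (EE 1) (act (EE 2) f) x / of_real q)"
    "act (tvec q (Fi Alpha1)) f = act (KK 1) (act (FF 1) f)"
    "act (tvec q (Fi Alpha2)) f = act (KK 2) (act (FF 2) f)"
    "act (tvec q (Fi Alpha12)) f = (\<lambda>x. act (KK 1) (act (FF 1) (act (KK 2) (act (FF 2) f))) x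
      - act (KK 2) (act (FF 2) (act (KK 1) (act (FF 1) f))) x / of_real q)"
  using assms unfolding tvec_simps
  by (simp_all add: act_diff act_scal mult.assoc) (simp_all add: act_mult)

lemma act_tvec_wcoef:
  assumes "q \<noteq> 0"
  shows "act (tvec q k) (wcoef q p p i j) = (\<lambda>x. tcoef q k p * wcoef q (trow k) (tcol k) i j x)"
proof (cases k)
  case (Ei r)
  then show ?thesis
    using assms exhaust_3[of p]
    by (cases r) (safe; simp add: act_tvec[OF lin_fun_wcoef] act_wcoef_E act_wcoef_F act_wcoef_K act_linear_simps act_divide_fun
        del: tvec.simps)+
next
  case (Fi r)
  then show ?thesis
    using assms exhaust_3[of p]
    by (cases r) (safe; simp add: act_tvec[OF lin_fun_wcoef] act_wcoef_E act_wcoef_F act_wcoef_K act_linear_simps act_divide_fun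
        field_simps power_numeral_reduce del: tvec.simps)+
qed

text \<open>The inner factors S(u) u contract to the unit, so the matrices u E_ab S(u) multiply like
  matrix units.\<close>

lemma wcoef_conv_wcoef:
  assumes q0: "q \<noteq> 0"
  shows "(\<lambda>x. \<Sum>j\<in>UNIV. (wcoef q a m i j \<star> wcoef q c b j k) x)
    = (\<lambda>x. (if m = c then 1 else 0) * wcoef q a b i k x)"
proof -
  have "wcoef q a m i j \<star> wcoef q c b j k = ucoef q i a \<star> ((sucoef q m j \<star> ucoef q j c) \<star> sucoef q b k)" for j
    by (simp add: wcoef_def conv_assoc)
  then have "(\<lambda>x. \<Sum>j\<in>UNIV. (wcoef q a m i j \<star> wcoef q c b j k) x)
    = ucoef q i a \<star> ((\<lambda>x. \<Sum>j\<in>UNIV. (sucoef q m j \<star> ucoef q j c) x) \<star> sucoef q b k)"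
    by (simp add: conv_sum_left conv_sum_right)
  then show ?thesis
    by (simp add: sucoef_conv_ucoef[OF q0] conv_scale_left conv_scale_right
        conv_counit_left[OF lin_fun_sucoef] wcoef_def del: mult_cancel_right2 mult_cancel_left2)
qed

lemma wcoef_weight: "q \<noteq> 0 \<Longrightarrow> pair_gen q (gK k) $ a $ a * pair_gen q (gKinv k) $ a $ a = 1"
  using exhaust_2[of k] exhaust_3[of a] by (safe; simp)

definition proj_coef :: "real \<Rightarrow> 3 \<Rightarrow> 3 \<Rightarrow> 3 \<Rightarrow> qfun"
  where "proj_coef q m i j = wcoef q m m i j"

lemma oq_f3_proj_coef: "q \<notin> {-1, 0, 1} \<Longrightarrow> proj_coef q m i j \<in> oq_f3 q"
  unfolding proj_coef_def oq_f3_iff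
  by (simp add: oq_su3_wcoef act_wcoef_K wcoef_weight del: insert_iff) (simp add: wcoef_weight)

subsection \<open>A frame of the cotangent bundle\<close>

lemma oq_f3_zero: "q \<notin> {-1, 0, 1} \<Longrightarrow> (\<lambda>x. 0) \<in> oq_f3 q"
  using oq_f3_scale[OF oq_f3_counit, of q 0] by (simp del: insert_iff)

lemma omega1_zero: "q \<notin> {-1, 0, 1} \<Longrightarrow> (\<lambda>k x. 0) \<in> omega1 q"
  using omega1.intros(3)[OF oq_f3_zero omega1.intros(1)[OF oq_f3_zero], of q]
  by (simp add: lmul_def conv_zero_left del: insert_iff)

lemma omega1_sum:
  assumes "q \<notin> {-1, 0, 1}"
  shows "(\<And>i. i \<in> I \<Longrightarrow> w i \<in> omega1 q) \<Longrightarrow> (\<lambda>k x. \<Sum>i\<in>I. w i k x) \<in> omega1 q"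
proof (induction I rule: infinite_finite_induct)
  case (insert i I)
  then have "(\<lambda>k x. w i k x + (\<Sum>i\<in>I. w i k x)) \<in> omega1 q"
    by (intro omega1.intros(2)) auto
  then show ?case using insert by simp
qed (use omega1_zero[OF assms] in auto)

definition eta :: "real \<Rightarrow> 3 \<Rightarrow> 3 \<Rightarrow> 3 \<Rightarrow> 3 \<Rightarrow> form"
  where "eta q m p r j = (\<lambda>k x. \<Sum>i\<in>UNIV. lmul (proj_coef q m r i) (d1 q (proj_coef q p i j)) k x)"

lemma eta_in_omega1: "q \<notin> {-1, 0, 1} \<Longrightarrow> eta q m p r j \<in> omega1 q"
  unfolding eta_def by (intro omega1_sum omega1.intros oq_f3_proj_coef)

text \<open>Coordinate k of dP p is a multiple of u E S(u) with E the matrix unit of k, and P m on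
  the left keeps it only if m is its row.\<close>

lemma eta_coord:
  assumes "q \<noteq> 0"
  shows "eta q m p r j k
    = (\<lambda>x. (if m = trow k then tcoef q k p else 0) * wcoef q (trow k) (tcol k) r j x)"
proof
  fix x
  have "eta q m p r j k x
      = tcoef q k p * (\<Sum>i\<in>UNIV. (wcoef q m m r i \<star> wcoef q (trow k) (tcol k) i j) x)"
    by (simp add: eta_def lmul_def d1_def proj_coef_def act_tvec_wcoef[OF assms] conv_scale_right
        sum_distrib_left)
  then show "eta q m p r j k x
      = (if m = trow k then tcoef q k p else 0) * wcoef q (trow k) (tcol k) r j x"
    using fun_cong[OF wcoef_conv_wcoef[OF assms, of m m r "trow k" "tcol k" j], of x] by simp
qed

text \<open>Membership in the cotensor product of A with V^1, expressed by weights: coordinate k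
  has, under each K_i, the weight of its matrix unit. Multiplying it by the opposite matrix unit
  then gives elements of B.\<close>

definition weighted_form :: "real \<Rightarrow> form \<Rightarrow> bool"
  where "weighted_form q w \<longleftrightarrow> (\<forall>k. w k \<in> oq_su3 q \<and> (\<forall>i. act (KK i) (w k)
    = (\<lambda>x. pair_gen q (gK i) $ trow k $ trow k * pair_gen q (gKinv i) $ tcol k $ tcol k * w k x)))"

lemma act_K_commute:
  assumes "f \<in> uq_dual q"
  shows "act (KK i) (act (EE l) f)
      = (\<lambda>x. (if i = l then of_real q * of_real q else 1 / of_real q) * act (EE l) (act (KK i) f) x)"
    "act (KK i) (act (FF l) f)
      = (\<lambda>x. (if i = l then 1 / (of_real q * of_real q) else of_real q) * act (FF l) (act (KK i) f) x)"
    "act (KK i) (act (KK l) f) = act (KK l) (act (KK i) f)"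
  using uq_dual_commute(4)[OF assms, of _ i l 1] uq_dual_commute(5)[OF assms, of _ i l 1]
    uq_dual_commute(3)[OF assms, of _ i l 1]
  by (simp_all add: act_def fun_eq_iff powi_cartan)

text \<open>As b has weight 0, acting on it by a vector of T gives the weight of that
  vector.\<close>

lemma weighted_form_d1:
  assumes q0: "q \<noteq> 0" and b: "b \<in> oq_f3 q"
  shows "weighted_form q (d1 q b)"
  unfolding weighted_form_def
proof (intro allI conjI)
  fix k i
  have su3: "b \<in> oq_su3 q" and K: "act (KK l) b = b" for l using b by (simp_all add: oq_f3_iff)
  then have dual: "b \<in> uq_dual q" by (simp add: oq_su3_def)
  show "d1 q b k \<in> oq_su3 q" using su3 by (simp add: d1_def oq_su3_act)
  note simps = d1_def act_tvec[OF uq_dual_lin[OF dual]] act_K_commute[where q = q] dual uq_dual_act K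
    act_linear_simps act_divide_fun q0
  show "act (KK i) (d1 q b k)
      = (\<lambda>x. pair_gen q (gK i) $ trow k $ trow k * pair_gen q (gKinv i) $ tcol k $ tcol k * d1 q b k x)"
  proof (cases k)
    case (Ei r)
    then show ?thesis using exhaust_2[of i]
      by (cases r) (safe; simp add: simps field_simps del: tvec.simps)+
  next
    case (Fi r)
    then show ?thesis using exhaust_2[of i]
      by (cases r) (safe; simp add: simps field_simps del: tvec.simps)+
  qed
qed

lemma weighted_form_add:
  "weighted_form q v \<Longrightarrow> weighted_form q w \<Longrightarrow> weighted_form q (\<lambda>k x. v k x + w k x)"
  by (simp add: weighted_form_def oq_su3_add act_add_fun distrib_left)

lemma weighted_form_lmul:
  "q \<notin> {-1, 0, 1} \<Longrightarrow> b \<in> oq_f3 q \<Longrightarrow> weighted_form q w \<Longrightarrow> weighted_form q (lmul b w)"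
  by (simp add: weighted_form_def lmul_def oq_su3_conv oq_f3_iff act_conv conv_scale_right del: insert_iff)

lemma weighted_form_zero: "q \<notin> {-1, 0, 1} \<Longrightarrow> weighted_form q (\<lambda>k x. 0)"
  using oq_f3_zero[of q] by (simp add: weighted_form_def oq_f3_iff act_zero_fun del: insert_iff)

lemma weighted_form_sum:
  assumes "q \<notin> {-1, 0, 1}"
  shows "(\<And>i. i \<in> I \<Longrightarrow> weighted_form q (w i)) \<Longrightarrow> weighted_form q (\<lambda>k x. \<Sum>i\<in>I. w i k x)"
proof (induction I rule: infinite_finite_induct)
  case (insert i I)
  then have "weighted_form q (\<lambda>k x. w i k x + (\<Sum>i\<in>I. w i k x))"
    by (intro weighted_form_add) auto
  then show ?case using insert by simp
qed (use weighted_form_zero[OF assms] in auto)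

lemma weighted_form_eta: "q \<notin> {-1, 0, 1} \<Longrightarrow> weighted_form q (eta q m p r j)"
  unfolding eta_def
  by (intro weighted_form_sum weighted_form_lmul weighted_form_d1 oq_f3_proj_coef) auto

text \<open>The left B-module generated by the forms eta; right multiplication is dealt with later,
  inside the algebra of forms.\<close>

inductive_set eta_span :: "real \<Rightarrow> form set" for q :: real
  where
    eta: "m \<noteq> p \<Longrightarrow> eta q m p r j \<in> eta_span q"
  | add: "v \<in> eta_span q \<Longrightarrow> w \<in> eta_span q \<Longrightarrow> (\<lambda>k x. v k x + w k x) \<in> eta_span q"
  | lmul: "b \<in> oq_f3 q \<Longrightarrow> w \<in> eta_span q \<Longrightarrow> lmul b w \<in> eta_span q"

lemma eta_span_omega1: "q \<notin> {-1, 0, 1} \<Longrightarrow> w \<in> eta_span q \<Longrightarrow> w \<in> omega1 q"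
  by (rotate_tac, induction rule: eta_span.induct) (auto intro: omega1.intros eta_in_omega1 simp del: insert_iff)

lemma eta_span_weighted: "q \<notin> {-1, 0, 1} \<Longrightarrow> w \<in> eta_span q \<Longrightarrow> weighted_form q w"
  by (rotate_tac, induction rule: eta_span.induct)
    (auto intro: weighted_form_add weighted_form_lmul weighted_form_eta simp del: insert_iff)

lemma eta_span_zero: "q \<notin> {-1, 0, 1} \<Longrightarrow> (\<lambda>k x. 0) \<in> eta_span q"
  using eta_span.lmul[OF oq_f3_zero eta_span.eta[where m = 1 and p = 2], of q]
  by (simp add: lmul_def conv_zero_left del: insert_iff)

lemma eta_span_sum:
  assumes "q \<notin> {-1, 0, 1}"
  shows "(\<And>i. i \<in> I \<Longrightarrow> w i \<in> eta_span q) \<Longrightarrow> (\<lambda>k x. \<Sum>i\<in>I. w i k x) \<in> eta_span q"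
proof (induction I rule: infinite_finite_induct)
  case (insert i I)
  then have "(\<lambda>k x. w i k x + (\<Sum>i\<in>I. w i k x)) \<in> eta_span q"
    by (intro eta_span.add) auto
  then show ?case using insert by simp
qed (use eta_span_zero[OF assms] in auto)

text \<open>These numbers are the pivots of the elimination below.\<close>

lemma tcoef_diag: "q \<noteq> 0 \<Longrightarrow> tcoef q k (tcol k) \<noteq> 0"
  by (cases k rule: trow.cases) auto

lemma trow_neq_tcol: "trow k \<noteq> tcol k"
  by (cases k rule: trow.cases) auto

lemma qtr_weight_nonzero: "q \<noteq> 0 \<Longrightarrow> qtr_weight q j \<noteq> 0"
  by (simp add: qtr_weight_def)

text \<open>With W_ab = u E_ab S(u), the product W_pm W_mp is W_pp, whose quantum trace is the
  weight of p. If f has the weight of (m, p), each f \<open>\<star>\<close>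
  \<open>wcoef q p m j r\<close> has weight 0, so f is expanded in the entries of W_mp with
  coefficients in B.\<close>

lemma wcoef_resolution:
  assumes q0: "q \<noteq> 0" and lin: "lin_fun f"
  shows "(\<lambda>x. \<Sum>j\<in>UNIV. \<Sum>r\<in>UNIV.
      qtr_weight q j * ((f \<star> wcoef q p m j r) \<star> wcoef q m p r j) x) = (\<lambda>x. qtr_weight q p * f x)"
proof -
  have "(\<lambda>x. \<Sum>j\<in>UNIV. \<Sum>r\<in>UNIV. qtr_weight q j * ((f \<star> wcoef q p m j r) \<star> wcoef q m p r j) x)
    = f \<star> (\<lambda>x. \<Sum>j\<in>UNIV. qtr_weight q j * (\<Sum>r\<in>UNIV. (wcoef q p m j r \<star> wcoef q m p r j) x))"
    by (simp add: conv_assoc conv_sum_right conv_scale_right sum_distrib_left)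
  also have "(\<lambda>x. \<Sum>j\<in>UNIV. qtr_weight q j * (\<Sum>r\<in>UNIV. (wcoef q p m j r \<star> wcoef q m p r j) x))
    = (\<lambda>x. \<Sum>j\<in>UNIV. qtr_weight q j * wcoef q p p j j x)"
    using wcoef_conv_wcoef[OF q0, of p m _ m p, THEN fun_cong] by simp
  also have "\<dots> = (\<lambda>x. qtr_weight q p * counit x)"
    using quantum_trace[OF q0, of p p] by (simp add: wcoef_def)
  finally show ?thesis by (simp add: conv_scale_right conv_counit_right[OF lin])
qed

text \<open>One step of a triangular elimination. \<open>S\<close> holds the coordinates already
  cleared, the form eta at the matrix unit of \<open>k\<close> is the pivot, and the hypothesis on
  eta says that the pivot does not disturb \<open>S\<close>.\<close>

lemma eta_span_eliminate:
  assumes q: "q \<notin> {-1, 0, 1}" and w: "weighted_form q w"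
    and S: "\<And>k'. k' \<in> S \<Longrightarrow> w k' = (\<lambda>x. 0)"
    and eta: "\<And>k' r j. k' \<in> S \<Longrightarrow> eta q (trow k) (tcol k) r j k' = (\<lambda>x. 0)"
    and rest: "\<And>w'. weighted_form q w' \<Longrightarrow> (\<And>k'. k' \<in> insert k S \<Longrightarrow> w' k' = (\<lambda>x. 0)) \<Longrightarrow> w' \<in> eta_span q"
  shows "w \<in> eta_span q"
proof -
  have q0: "q \<noteq> 0" using q by simp
  define m p where "m = trow k" and "p = tcol k"
  \<comment> \<open>The weight of the quantum trace, divided by the trace of W_pp and by the pivot
    coefficient of eta m p at k.\<close>
  define z where "z j = qtr_weight q j / (qtr_weight q p * tcoef q k p)" for j
  define b where "b j r = (\<lambda>x. z j * (w k \<star> wcoef q p m j r) x)" for j r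
  have wk: "w k \<in> oq_su3 q" and wK: "act (KK i) (w k) = (\<lambda>x. pair_gen q (gK i) $ m $ m * pair_gen q (gKinv i) $ p $ p * w k x)" for i
    using w by (simp_all add: weighted_form_def m_def p_def)
  have "w k \<star> wcoef q p m j r \<in> oq_f3 q" for j r
  proof -
    \<comment> \<open>The weights (m, p) of \<open>w k\<close> and (p, m) of \<open>wcoef\<close>
      are regrouped into two factors that are both 1.\<close>
    have "act (KK i) (w k \<star> wcoef q p m j r) x =
        (pair_gen q (gK i) $ m $ m * pair_gen q (gKinv i) $ m $ m)
        * (pair_gen q (gK i) $ p $ p * pair_gen q (gKinv i) $ p $ p) * (w k \<star> wcoef q p m j r) x" for i x
      by (simp only: act_conv wK act_wcoef_K conv_scale_left conv_scale_right) (simp only: mult_ac)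
    then show ?thesis
      using q wk by (simp add: oq_f3_iff oq_su3_conv oq_su3_wcoef wcoef_weight[OF q0] fun_eq_iff del: pair_gen.simps)
  qed
  then have b: "b j r \<in> oq_f3 q" for j r by (simp add: b_def oq_f3_scale)
  define e where "e = (\<lambda>k' x. \<Sum>j\<in>UNIV. \<Sum>r\<in>UNIV. lmul (b j r) (eta q m p r j) k' x)"
  have e_span: "e \<in> eta_span q"
    unfolding e_def
    by (intro eta_span_sum[OF q] eta_span.lmul[OF b] eta_span.eta) (simp add: m_def p_def trow_neq_tcol)
  have neg: "(\<lambda>x. c * counit x) \<in> oq_f3 q" for c
    by (intro oq_f3_scale oq_f3_counit[OF q])
  have e_k: "e k = w k"
  proof
    fix x
    have "e k x = (\<Sum>j\<in>UNIV. \<Sum>r\<in>UNIV. qtr_weight q j * ((w k \<star> wcoef q p m j r) \<star> wcoef q m p r j) x) / qtr_weight q p"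
      using tcoef_diag[OF q0, of k]
      by (simp add: e_def lmul_def eta_coord[OF q0] m_def[symmetric] p_def[symmetric] b_def z_def
          conv_scale_left conv_scale_right conv_divide sum_divide_distrib)
    also have "\<dots> = w k x"
      using fun_cong[OF wcoef_resolution[OF q0 lin_fun_oq_su3[OF wk], of p m], of x] qtr_weight_nonzero[OF q0, of p]
      by simp
    finally show "e k x = w k x" .
  qed
  have e_S: "e k' = (\<lambda>x. 0)" if "k' \<in> S" for k'
    using eta[OF that] by (simp add: e_def lmul_def m_def p_def conv_zero_right)
  have e_wt: "weighted_form q e" using eta_span_weighted[OF q e_span] .
  \<comment> \<open>The difference w - e, with the sign written as left multiplication by the
    constant - 1 of B, an operation under which weighted forms are closed.\<close>
  define w' where "w' = (\<lambda>k' x. w k' x + lmul (\<lambda>x. - 1 * counit x) e k' x)"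
  have lm: "lmul (\<lambda>x. - 1 * counit x) e k' x = - e k' x" for k' x
    using e_wt conv_counit_left[OF lin_fun_oq_su3, of "e k'" q]
    unfolding lmul_def conv_scale_left by (simp add: weighted_form_def)
  have "w' \<in> eta_span q"
  proof (rule rest)
    show "weighted_form q w'"
      unfolding w'_def by (intro weighted_form_add w weighted_form_lmul[OF q neg e_wt])
    show "w' k' = (\<lambda>x. 0)" if "k' \<in> insert k S" for k'
      using that e_k e_S S unfolding w'_def lm by auto
  qed
  from eta_span.add[OF this e_span] show ?thesis
    unfolding w'_def lm by simp
qed

text \<open>The order of the pivots matters at one place: eta 1 2 has coordinates at
  \<open>Fi Alpha1\<close> and \<open>Fi Alpha12\<close>, whereas eta 1 3 has none at
  \<open>Fi Alpha1\<close>. So \<open>Fi Alpha1\<close> is cleared before \<open>Fi Alpha12\<close>.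
  Each of the other pivots has a single nonzero coordinate.\<close>

lemma weighted_form_eta_span:
  assumes q: "q \<notin> {-1, 0, 1}" and w: "weighted_form q w"
  shows "w \<in> eta_span q"
proof -
  have q0: "q \<noteq> 0" using q by simp
  note elim = eta_span_eliminate[OF q]
  \<comment> \<open>The label counts the coordinates already cleared, so the chain starts with the
    zero form and runs back to an arbitrary weighted form.\<close>
  have 6: "w \<in> eta_span q" if "\<And>k. k \<in> {Fi Alpha2, Ei Alpha12, Ei Alpha2, Ei Alpha1, Fi Alpha12, Fi Alpha1} \<Longrightarrow> w k = (\<lambda>x. 0)" for w
  proof -
    have "w k = (\<lambda>x. 0)" for k by (cases k rule: trow.cases) (auto intro: that)
    then have "w = (\<lambda>k x. 0)" by blast
    then show ?thesis using eta_span_zero[OF q] by simp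
  qed
  have 5: "w \<in> eta_span q" if "weighted_form q w"
    "\<And>k. k \<in> {Ei Alpha12, Ei Alpha2, Ei Alpha1, Fi Alpha12, Fi Alpha1} \<Longrightarrow> w k = (\<lambda>x. 0)" for w
  proof (rule elim[where k = "Fi Alpha2", OF that])
    show "w' \<in> eta_span q" if "weighted_form q w'"
      "\<And>k. k \<in> {Fi Alpha2, Ei Alpha12, Ei Alpha2, Ei Alpha1, Fi Alpha12, Fi Alpha1} \<Longrightarrow> w' k = (\<lambda>x. 0)" for w'
      by (rule 6[OF that(2)])
  qed (auto simp: eta_coord[OF q0])
  have 4: "w \<in> eta_span q" if "weighted_form q w"
    "\<And>k. k \<in> {Ei Alpha2, Ei Alpha1, Fi Alpha12, Fi Alpha1} \<Longrightarrow> w k = (\<lambda>x. 0)" for w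
  proof (rule elim[where k = "Ei Alpha12", OF that])
    show "w' \<in> eta_span q" if "weighted_form q w'"
      "\<And>k. k \<in> {Ei Alpha12, Ei Alpha2, Ei Alpha1, Fi Alpha12, Fi Alpha1} \<Longrightarrow> w' k = (\<lambda>x. 0)" for w'
      by (rule 5[OF that])
  qed (auto simp: eta_coord[OF q0])
  have 3: "w \<in> eta_span q" if "weighted_form q w"
    "\<And>k. k \<in> {Ei Alpha1, Fi Alpha12, Fi Alpha1} \<Longrightarrow> w k = (\<lambda>x. 0)" for w
  proof (rule elim[where k = "Ei Alpha2", OF that])
    show "w' \<in> eta_span q" if "weighted_form q w'"
      "\<And>k. k \<in> {Ei Alpha2, Ei Alpha1, Fi Alpha12, Fi Alpha1} \<Longrightarrow> w' k = (\<lambda>x. 0)" for w'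
      by (rule 4[OF that])
  qed (auto simp: eta_coord[OF q0])
  have 2: "w \<in> eta_span q" if "weighted_form q w"
    "\<And>k. k \<in> {Fi Alpha12, Fi Alpha1} \<Longrightarrow> w k = (\<lambda>x. 0)" for w
  proof (rule elim[where k = "Ei Alpha1", OF that])
    show "w' \<in> eta_span q" if "weighted_form q w'"
      "\<And>k. k \<in> {Ei Alpha1, Fi Alpha12, Fi Alpha1} \<Longrightarrow> w' k = (\<lambda>x. 0)" for w'
      by (rule 3[OF that])
  qed (auto simp: eta_coord[OF q0])
  have 1: "w \<in> eta_span q" if "weighted_form q w"
    "\<And>k. k \<in> {Fi Alpha1} \<Longrightarrow> w k = (\<lambda>x. 0)" for w
  proof (rule elim[where k = "Fi Alpha12", OF that])
    show "w' \<in> eta_span q" if "weighted_form q w'"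
      "\<And>k. k \<in> {Fi Alpha12, Fi Alpha1} \<Longrightarrow> w' k = (\<lambda>x. 0)" for w'
      by (rule 2[OF that])
  qed (auto simp: eta_coord[OF q0])
  show ?thesis
  proof (rule elim[where k = "Fi Alpha1" and S = "{}", OF w])
    show "w' \<in> eta_span q" if "weighted_form q w'" "\<And>k. k \<in> {Fi Alpha1} \<Longrightarrow> w' k = (\<lambda>x. 0)" for w'
      by (rule 1[OF that])
  qed auto
qed

subsection \<open>Direct sum decompositions\<close>

locale direct_sum_family = abelian_group R for R (structure) +
  fixes M :: "'i \<Rightarrow> 'a set"
  assumes subgroup_M: "\<And>i. additive_subgroup (M i) R"
    and direct: "is_direct_sum R UNIV M (carrier R)"
begin

text \<open>A family on the whole index type with finite support, so that decompositions can be
  added and compared without matching their index sets.\<close>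

definition decomp :: "'a \<Rightarrow> ('i \<Rightarrow> 'a) \<Rightarrow> bool"
  where "decomp x f \<longleftrightarrow> (\<forall>i. f i \<in> M i) \<and>
    (\<exists>J. finite J \<and> (\<forall>i. i \<notin> J \<longrightarrow> f i = \<zero>) \<and> x = finsum R f J)"

definition component :: "'i \<Rightarrow> 'a \<Rightarrow> 'a"
  where "component i x = (THE f. decomp x f) i"

lemma M_carrier: "x \<in> M i \<Longrightarrow> x \<in> carrier R"
  using additive_subgroup.a_Hcarr[OF subgroup_M] .

lemma M_zero: "\<zero> \<in> M i"
  using additive_subgroup.zero_closed[OF subgroup_M] .

lemma M_add: "x \<in> M i \<Longrightarrow> y \<in> M i \<Longrightarrow> x \<oplus> y \<in> M i"
  using additive_subgroup.a_closed[OF subgroup_M] .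

lemma M_minus: "x \<in> M i \<Longrightarrow> \<ominus> x \<in> M i"
  using additive_subgroup.a_inv_closed[OF subgroup_M] .

lemma finsum_superset:
  assumes "finite K" "J \<subseteq> K" "\<And>i. i \<notin> J \<Longrightarrow> f i = \<zero>" "\<And>i. f i \<in> carrier R"
  shows "finsum R f K = finsum R f J"
  by (rule add.finprod_mono_neutral_cong_right) (use assms in auto)

lemma decompI:
  assumes "\<And>i. f i \<in> M i" "finite J" "\<And>i. i \<notin> J \<Longrightarrow> f i = \<zero>" "x = finsum R f J"
  shows "decomp x f"
  using assms by (auto simp: decomp_def)

lemma decomp_superset:
  assumes "decomp x f"
  obtains J where "finite J" "\<And>i. i \<notin> J \<Longrightarrow> f i = \<zero>" "\<And>K. finite K \<Longrightarrow> J \<subseteq> K \<Longrightarrow> x = finsum R f K"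
proof -
  from assms obtain J where J: "finite J" "\<forall>i. i \<notin> J \<longrightarrow> f i = \<zero>" "x = finsum R f J"
    and M: "\<forall>i. f i \<in> M i" by (auto simp: decomp_def)
  have "x = finsum R f K" if "finite K" "J \<subseteq> K" for K
    using finsum_superset[of K J f] that J M M_carrier by metis
  then show ?thesis using J that by blast
qed

lemma decomp_M: "decomp x f \<Longrightarrow> f i \<in> M i"
  by (simp add: decomp_def)

lemma decomp_add:
  assumes "decomp x f" "decomp y g"
  shows "decomp (x \<oplus> y) (\<lambda>i. f i \<oplus> g i)"
proof -
  obtain J where J: "finite J" "\<And>i. i \<notin> J \<Longrightarrow> f i = \<zero>" "\<And>K. finite K \<Longrightarrow> J \<subseteq> K \<Longrightarrow> x = finsum R f K"
    using decomp_superset[OF assms(1)] by metis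
  obtain K where K: "finite K" "\<And>i. i \<notin> K \<Longrightarrow> g i = \<zero>" "\<And>L. finite L \<Longrightarrow> K \<subseteq> L \<Longrightarrow> y = finsum R g L"
    using decomp_superset[OF assms(2)] by metis
  have c: "f i \<in> carrier R" "g i \<in> carrier R" for i
    using assms decomp_M M_carrier by blast+
  show ?thesis
  proof (rule decompI[of _ "J \<union> K"])
    show "x \<oplus> y = (\<Oplus>i\<in>J \<union> K. f i \<oplus> g i)"
      using J(1) J(3)[of "J \<union> K"] K(1) K(3)[of "J \<union> K"] c by (simp add: finsum_addf Pi_def)
  qed (use J K assms decomp_M in \<open>auto intro: M_add\<close>)
qed

text \<open>Needed for negation, which gives uniqueness of decompositions, and for scalar
  multiplication, which thereby commutes with components.\<close>

lemma decomp_additive_map: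
  assumes "decomp x f" and h: "\<And>i y. y \<in> M i \<Longrightarrow> h y \<in> M i" "h \<zero> = \<zero>"
    "\<And>y z. y \<in> carrier R \<Longrightarrow> z \<in> carrier R \<Longrightarrow> h (y \<oplus> z) = h y \<oplus> h z"
  shows "decomp (h x) (\<lambda>i. h (f i))"
proof -
  from assms(1) obtain J where J: "finite J" "\<And>i. i \<notin> J \<Longrightarrow> f i = \<zero>" "x = finsum R f J"
    by (auto simp: decomp_def)
  have c: "f i \<in> carrier R" "h (f i) \<in> carrier R" for i
    using assms decomp_M M_carrier by blast+
  have "h (finsum R f J) = (\<Oplus>i\<in>J. h (f i))"
    using J(1) by (induction J) (simp_all add: c h Pi_def)
  then show ?thesis
    using J h decomp_M[OF assms(1)] by (intro decompI[of _ J]) auto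
qed

lemma decomp_zero_iff:
  assumes "decomp \<zero> f" shows "f i = \<zero>"
proof -
  from assms obtain J where J: "finite J" "\<And>i. i \<notin> J \<Longrightarrow> f i = \<zero>" "finsum R f J = \<zero>"
    by (auto simp: decomp_def)
  have "\<forall>i\<in>J. f i = \<zero>"
    using direct J decomp_M[OF assms] unfolding is_direct_sum_def by blast
  then show ?thesis using J(2) by blast
qed

lemma decomp_unique:
  assumes "decomp x f" "decomp x g" "x \<in> carrier R" shows "f = g"
proof
  fix i
  have "decomp (\<ominus> x) (\<lambda>i. \<ominus> g i)"
    using assms(2) by (rule decomp_additive_map) (auto intro: M_minus simp: minus_add)
  from decomp_add[OF assms(1) this] have "decomp \<zero> (\<lambda>i. f i \<oplus> \<ominus> g i)"
    using assms(3) by (simp add: r_neg)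
  then have "f i \<oplus> \<ominus> g i = \<zero>" by (rule decomp_zero_iff)
  then show "f i = g i"
    using assms(1,2) decomp_M M_carrier by (metis minus_equality minus_minus a_inv_closed)
qed

lemma decomp_exists:
  assumes "x \<in> carrier R" shows "\<exists>f. decomp x f"
proof -
  from direct assms obtain f J where J: "finite J" "f \<in> Pi J M" "x = finsum R f J"
    unfolding is_direct_sum_def by blast
  let ?f = "\<lambda>i. if i \<in> J then f i else \<zero>"
  have "decomp x ?f"
  proof (rule decompI[of _ J])
    show "x = finsum R ?f J"
      unfolding J(3) by (intro finsum_cong') (auto dest: M_carrier[OF Pi_mem[OF J(2)]])
  qed (use J M_zero in auto)
  then show ?thesis by blast
qed

lemma decomp_component: "x \<in> carrier R \<Longrightarrow> decomp x (\<lambda>i. component i x)"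
  unfolding component_def using decomp_exists decomp_unique by (metis (mono_tags, lifting) theI)

lemma component_eq: "x \<in> carrier R \<Longrightarrow> decomp x f \<Longrightarrow> component i x = f i"
  using decomp_unique[OF decomp_component] by metis

lemma component_M: "x \<in> carrier R \<Longrightarrow> component i x \<in> M i"
  using decomp_M[OF decomp_component] .

lemma component_carrier: "x \<in> carrier R \<Longrightarrow> component i x \<in> carrier R"
  using component_M M_carrier by blast

lemma component_add:
  assumes "x \<in> carrier R" "y \<in> carrier R"
  shows "component i (x \<oplus> y) = component i x \<oplus> component i y"
  using component_eq[OF _ decomp_add[OF decomp_component decomp_component]] assms by simp

lemma decomp_homogeneous: "x \<in> M i \<Longrightarrow> decomp x (\<lambda>j. if j = i then x else \<zero>)"
  by (rule decompI[of _ "{i}"]) (auto simp: M_zero M_carrier)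

lemma component_homogeneous: "x \<in> M i \<Longrightarrow> component j x = (if j = i then x else \<zero>)"
  using component_eq[OF _ decomp_homogeneous] M_carrier by blast

lemma component_zero: "component j \<zero> = \<zero>"
  using component_homogeneous[OF M_zero, of j j] by simp

lemma component_additive_map:
  assumes "x \<in> carrier R" "h x \<in> carrier R" "\<And>i y. y \<in> M i \<Longrightarrow> h y \<in> M i" "h \<zero> = \<zero>"
    "\<And>y z. y \<in> carrier R \<Longrightarrow> z \<in> carrier R \<Longrightarrow> h (y \<oplus> z) = h y \<oplus> h z"
  shows "component i (h x) = h (component i x)"
  using component_eq[OF _ decomp_additive_map[OF decomp_component]] assms by simp

text \<open>Extends maps given on the summands to all of R. The parts of d are defined bidegree by
  bidegree and have to be assembled like this.\<close>

definition glue :: "('i \<Rightarrow> 'a \<Rightarrow> 'a) \<Rightarrow> 'a \<Rightarrow> 'a"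
  where "glue E x = finsum R (\<lambda>i. E i (component i x)) {i. component i x \<noteq> \<zero>}"

lemma finite_support: "x \<in> carrier R \<Longrightarrow> finite {i. component i x \<noteq> \<zero>}"
proof -
  assume "x \<in> carrier R"
  from decomp_component[OF this] obtain J where "finite J" "\<And>i. i \<notin> J \<Longrightarrow> component i x = \<zero>"
    by (auto simp: decomp_def)
  then show ?thesis by (auto intro: finite_subset[of _ J])
qed

context
  fixes E :: "'i \<Rightarrow> 'a \<Rightarrow> 'a"
  assumes E_closed: "\<And>i x. x \<in> M i \<Longrightarrow> E i x \<in> carrier R"
    and E_zero: "\<And>i. E i \<zero> = \<zero>"
    and E_add: "\<And>i x y. x \<in> M i \<Longrightarrow> y \<in> M i \<Longrightarrow> E i (x \<oplus> y) = E i x \<oplus> E i y"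
begin

lemma glue_superset:
  assumes "x \<in> carrier R" "finite K" "{i. component i x \<noteq> \<zero>} \<subseteq> K"
  shows "glue E x = finsum R (\<lambda>i. E i (component i x)) K"
  unfolding glue_def
  by (rule finsum_superset[symmetric]) (use assms E_zero E_closed component_M in auto)

lemma glue_closed: "x \<in> carrier R \<Longrightarrow> glue E x \<in> carrier R"
  unfolding glue_def using E_closed component_M by (intro finsum_closed) auto

lemma glue_add:
  assumes "x \<in> carrier R" "y \<in> carrier R"
  shows "glue E (x \<oplus> y) = glue E x \<oplus> glue E y"
proof -
  let ?K = "{i. component i x \<noteq> \<zero>} \<union> {i. component i y \<noteq> \<zero>}"
  have fin: "finite ?K" using assms finite_support by simp
  have "{i. component i (x \<oplus> y) \<noteq> \<zero>} \<subseteq> ?K" using assms by (auto simp: component_add)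
  then have "glue E (x \<oplus> y) = finsum R (\<lambda>i. E i (component i (x \<oplus> y))) ?K"
    using assms fin by (intro glue_superset) auto
  also have "\<dots> = finsum R (\<lambda>i. E i (component i x) \<oplus> E i (component i y)) ?K"
    using assms by (simp add: component_add component_M E_add)
  also have "\<dots> = finsum R (\<lambda>i. E i (component i x)) ?K \<oplus> finsum R (\<lambda>i. E i (component i y)) ?K"
    using assms E_closed component_M by (intro finsum_addf) auto
  also have "\<dots> = glue E x \<oplus> glue E y"
    using assms fin glue_superset[of x ?K] glue_superset[of y ?K] by auto
  finally show ?thesis .
qed

lemma glue_homogeneous:
  assumes "x \<in> M i" shows "glue E x = E i x"
proof -
  have "glue E x = finsum R (\<lambda>j. E j (component j x)) {i}"
    using assms M_carrier by (intro glue_superset) (auto simp: component_homogeneous[OF assms])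
  also have "\<dots> = E i x"
    using assms E_closed component_M[OF M_carrier] by (simp add: component_homogeneous[OF assms])
  finally show ?thesis .
qed

end

lemma additive_eqI:
  assumes "\<And>x. x \<in> carrier R \<Longrightarrow> f x \<in> carrier R" "\<And>x. x \<in> carrier R \<Longrightarrow> g x \<in> carrier R"
    "\<And>x y. x \<in> carrier R \<Longrightarrow> y \<in> carrier R \<Longrightarrow> f (x \<oplus> y) = f x \<oplus> f y"
    "\<And>x y. x \<in> carrier R \<Longrightarrow> y \<in> carrier R \<Longrightarrow> g (x \<oplus> y) = g x \<oplus> g y"
    "\<And>i x. x \<in> M i \<Longrightarrow> f x = g x" and x: "x \<in> carrier R"
  shows "f x = g x"
proof -
  from decomp_exists[OF x] obtain h J where J: "finite J" "x = finsum R h J" and h: "\<And>i. h i \<in> M i"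
    by (auto simp: decomp_def)
  have hc: "h i \<in> carrier R" for i using h M_carrier by blast
  from J(1) have "f (finsum R h J) = g (finsum R h J)"
  proof (induction J)
    case empty
    show ?case using assms(5)[OF M_zero] by simp
  next
    case (insert i J)
    then show ?case using assms(3,4) assms(5)[OF h] by (simp add: hc Pi_def)
  qed
  then show ?thesis using J by simp
qed

end

subsection \<open>The algebra of differential forms\<close>

lemma free_alg_sel [simp]:
  "mult (free_alg X) = (*)" "one (free_alg X) = 1" "zero (free_alg X) = 0" "add (free_alg X) = (+)"
  by (simp_all add: free_alg_def)

lemma gen_of_carrier: "a \<in> X \<Longrightarrow> gen_of a \<in> carrier (free_alg X)"
  by (simp add: free_alg_def gen_of_def)

lemma scal_carrier: "scal z \<in> carrier (free_alg X)"
  by (simp add: free_alg_def scal_def zero_word_def)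

lemma free_alg_closed:
  assumes "x \<in> carrier (free_alg X)" "y \<in> carrier (free_alg X)"
  shows "x + y \<in> carrier (free_alg X)" "x * y \<in> carrier (free_alg X)" "x - y \<in> carrier (free_alg X)"
proof -
  interpret ring "free_alg X" by (rule free_alg_ring)
  show "x + y \<in> carrier (free_alg X)" using a_closed[OF assms] by simp
  show "x * y \<in> carrier (free_alg X)" using m_closed[OF assms] by simp
  have "- y \<in> carrier (free_alg X)" using assms(2) by (simp add: free_alg_def)
  then show "x - y \<in> carrier (free_alg X)" using a_closed[OF assms(1), of "- y"] by simp
qed

lemma fun_letter: "b \<in> oq_f3 q \<Longrightarrow> gen_of (Fun b) \<in> carrier (free_alg (tletters q))"
  and form_letter: "w \<in> omega1 q \<Longrightarrow> gen_of (Form w) \<in> carrier (free_alg (tletters q))"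
  by (auto simp: tletters_def intro: gen_of_carrier)

lemma one_carrier: "1 \<in> carrier (free_alg X)"
  using scal_carrier[of 1 X] by simp

lemma zero_carrier: "0 \<in> carrier (free_alg X)"
  using scal_carrier[of 0 X] by simp

text \<open>The generated ideal is only meaningful inside the algebra on \<open>tletters q\<close>.
  That the relations lie there rests on the closure properties of B and Omega^1.\<close>

lemma omega_relations_carrier:
  assumes q: "q \<notin> {-1, 0, 1}"
  shows "tensor_relations q \<union> prolongation_relations q \<subseteq> carrier (free_alg (tletters q))"
proof (rule Un_least)
  show "tensor_relations q \<subseteq> carrier (free_alg (tletters q))"
    unfolding tensor_relations_def
    by (intro Un_least; safe;
        intro free_alg_closed fun_letter form_letter one_carrier scal_carrier oq_f3_counit[OF q] oq_f3_add
          oq_f3_scale oq_f3_conv[OF q] omega1.intros; assumption)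
  have "(\<Sum>(b, c) \<leftarrow> bcs. gen_of (Form (d1 q b)) * gen_of (Form (d1 q c))) \<in> carrier (free_alg (tletters q))"
    if "set bcs \<subseteq> oq_f3 q \<times> oq_f3 q" for bcs
    using that
    by (induction bcs)
      (auto intro!: zero_carrier free_alg_closed form_letter omega1.intros(1))
  then show "prolongation_relations q \<subseteq> carrier (free_alg (tletters q))"
    unfolding prolongation_relations_def by blast
qed

lemma omega_ideal_ideal:
  assumes "q \<notin> {-1, 0, 1}"
  shows "ideal (omega_ideal q) (free_alg (tletters q))"
  unfolding omega_ideal_def
  using ring.genideal_ideal[OF free_alg_ring omega_relations_carrier[OF assms]] .

lemma Omega_ring: "q \<notin> {-1, 0, 1} \<Longrightarrow> ring (Omega q)"
  unfolding Omega_def by (rule ideal.quotient_is_ring[OF omega_ideal_ideal])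

lemma omega_class_hom:
  "q \<notin> {-1, 0, 1} \<Longrightarrow> omega_class q \<in> ring_hom (free_alg (tletters q)) (Omega q)"
  using ideal.rcos_ring_hom[OF omega_ideal_ideal[of q]]
  unfolding Omega_def omega_class_def[abs_def] by simp

lemma omega_class_simps:
  assumes q: "q \<notin> {-1, 0, 1}"
  shows "x \<in> carrier (free_alg (tletters q)) \<Longrightarrow> omega_class q x \<in> carrier (Omega q)"
    "x \<in> carrier (free_alg (tletters q)) \<Longrightarrow> y \<in> carrier (free_alg (tletters q)) \<Longrightarrow>
      omega_class q (x + y) = omega_class q x \<oplus>\<^bsub>Omega q\<^esub> omega_class q y"
    "x \<in> carrier (free_alg (tletters q)) \<Longrightarrow> y \<in> carrier (free_alg (tletters q)) \<Longrightarrow>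
      omega_class q (x * y) = omega_class q x \<otimes>\<^bsub>Omega q\<^esub> omega_class q y"
    "omega_class q 1 = \<one>\<^bsub>Omega q\<^esub>"
  using ring_hom_closed[OF omega_class_hom[OF q]] ring_hom_add[OF omega_class_hom[OF q]]
    ring_hom_mult[OF omega_class_hom[OF q]] ring_hom_one[OF omega_class_hom[OF q]] by simp_all

lemma omega_class_eqI:
  assumes q: "q \<notin> {-1, 0, 1}" and x: "x \<in> carrier (free_alg (tletters q))"
    and y: "y \<in> carrier (free_alg (tletters q))"
    and r: "x - y \<in> tensor_relations q \<union> prolongation_relations q"
  shows "omega_class q x = omega_class q y"
proof -
  interpret R: ring "Omega q" using q by (rule Omega_ring)
  interpret F: ring "free_alg (tletters q)" by (rule free_alg_ring)
  interpret I: ideal "omega_ideal q" "free_alg (tletters q)" using q by (rule omega_ideal_ideal)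
  have "x - y \<in> omega_ideal q"
    unfolding omega_ideal_def using F.genideal_self[OF omega_relations_carrier[OF q]] r by blast
  then have "omega_class q (x - y) = omega_ideal q"
    unfolding omega_class_def by (rule I.a_rcos_const)
  also have "\<dots> = \<zero>\<^bsub>Omega q\<^esub>" by (simp add: Omega_def FactRing_def)
  finally have "omega_class q (x - y + y) = \<zero>\<^bsub>Omega q\<^esub> \<oplus>\<^bsub>Omega q\<^esub> omega_class q y"
    using omega_class_simps(2)[OF q free_alg_closed(3)[OF x y] y] by simp
  then show ?thesis using omega_class_simps(1)[OF q y] by simp
qed

lemma of_fun_carrier: "q \<notin> {-1, 0, 1} \<Longrightarrow> b \<in> oq_f3 q \<Longrightarrow> of_fun q b \<in> carrier (Omega q)"
  unfolding of_fun_def by (intro omega_class_simps(1) fun_letter)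

lemma of_form_carrier: "q \<notin> {-1, 0, 1} \<Longrightarrow> w \<in> omega1 q \<Longrightarrow> of_form q w \<in> carrier (Omega q)"
  unfolding of_form_def by (intro omega_class_simps(1) form_letter)

lemma of_fun_counit:
  assumes q: "q \<notin> {-1, 0, 1}" shows "of_fun q counit = \<one>\<^bsub>Omega q\<^esub>"
  unfolding of_fun_def omega_class_simps(4)[OF q, symmetric]
  by (rule omega_class_eqI[OF q])
    (auto simp: tensor_relations_def intro!: fun_letter one_carrier oq_f3_counit q)

lemma of_fun_add:
  assumes q: "q \<notin> {-1, 0, 1}" and bc: "b \<in> oq_f3 q" "c \<in> oq_f3 q"
  shows "of_fun q (\<lambda>x. b x + c x) = of_fun q b \<oplus>\<^bsub>Omega q\<^esub> of_fun q c"
proof -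
  have "of_fun q (\<lambda>x. b x + c x) = omega_class q (gen_of (Fun b) + gen_of (Fun c))"
    unfolding of_fun_def
  proof (rule omega_class_eqI[OF q])
    show "gen_of (Fun (\<lambda>x. b x + c x)) - (gen_of (Fun b) + gen_of (Fun c))
        \<in> tensor_relations q \<union> prolongation_relations q"
      using bc unfolding tensor_relations_def diff_diff_eq[symmetric] by blast
  qed (intro free_alg_closed fun_letter oq_f3_add bc)+
  then show ?thesis using omega_class_simps(2)[OF q fun_letter fun_letter] bc by (simp add: of_fun_def)
qed

lemma of_fun_conv:
  assumes q: "q \<notin> {-1, 0, 1}" and bc: "b \<in> oq_f3 q" "c \<in> oq_f3 q"
  shows "of_fun q (b \<star> c) = of_fun q b \<otimes>\<^bsub>Omega q\<^esub> of_fun q c"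
proof -
  have "of_fun q (b \<star> c) = omega_class q (gen_of (Fun b) * gen_of (Fun c))"
    unfolding of_fun_def
  proof (rule omega_class_eqI[OF q])
    show "gen_of (Fun (b \<star> c)) - gen_of (Fun b) * gen_of (Fun c)
        \<in> tensor_relations q \<union> prolongation_relations q"
      using bc unfolding tensor_relations_def by blast
  qed (intro free_alg_closed fun_letter oq_f3_conv[OF q] bc)+
  then show ?thesis using omega_class_simps(3)[OF q fun_letter fun_letter] bc by (simp add: of_fun_def)
qed

lemma of_form_add:
  assumes q: "q \<notin> {-1, 0, 1}" and vw: "v \<in> omega1 q" "w \<in> omega1 q"
  shows "of_form q (\<lambda>k x. v k x + w k x) = of_form q v \<oplus>\<^bsub>Omega q\<^esub> of_form q w"
proof -
  have "of_form q (\<lambda>k x. v k x + w k x) = omega_class q (gen_of (Form v) + gen_of (Form w))"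
    unfolding of_form_def
  proof (rule omega_class_eqI[OF q])
    show "gen_of (Form (\<lambda>k x. v k x + w k x)) - (gen_of (Form v) + gen_of (Form w))
        \<in> tensor_relations q \<union> prolongation_relations q"
      using vw unfolding tensor_relations_def diff_diff_eq[symmetric] by blast
  qed (intro free_alg_closed form_letter omega1.intros(2) vw)+
  then show ?thesis using omega_class_simps(2)[OF q form_letter form_letter] vw by (simp add: of_form_def)
qed

lemma of_form_lmul:
  assumes q: "q \<notin> {-1, 0, 1}" and bw: "b \<in> oq_f3 q" "w \<in> omega1 q"
  shows "of_form q (lmul b w) = of_fun q b \<otimes>\<^bsub>Omega q\<^esub> of_form q w"
proof -
  have "of_form q (lmul b w) = omega_class q (gen_of (Fun b) * gen_of (Form w))"
    unfolding of_form_def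
  proof (rule omega_class_eqI[OF q])
    show "gen_of (Form (lmul b w)) - gen_of (Fun b) * gen_of (Form w)
        \<in> tensor_relations q \<union> prolongation_relations q"
      using bw unfolding tensor_relations_def by blast
  qed (intro free_alg_closed fun_letter form_letter omega1.intros(3) bw)+
  then show ?thesis using omega_class_simps(3)[OF q fun_letter form_letter] bw by (simp add: of_form_def of_fun_def)
qed

lemma of_form_rmul:
  assumes q: "q \<notin> {-1, 0, 1}" and bw: "b \<in> oq_f3 q" "w \<in> omega1 q"
  shows "of_form q (rmul q w b) = of_form q w \<otimes>\<^bsub>Omega q\<^esub> of_fun q b"
proof -
  have "of_form q (rmul q w b) = omega_class q (gen_of (Form w) * gen_of (Fun b))"
    unfolding of_form_def
  proof (rule omega_class_eqI[OF q])
    show "gen_of (Form (rmul q w b)) - gen_of (Form w) * gen_of (Fun b)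
        \<in> tensor_relations q \<union> prolongation_relations q"
      using bw unfolding tensor_relations_def by blast
  qed (intro free_alg_closed fun_letter form_letter omega1.intros(4) bw)+
  then show ?thesis using omega_class_simps(3)[OF q form_letter fun_letter] bw by (simp add: of_form_def of_fun_def)
qed

subsection \<open>Integrability\<close>

locale bigraded_calculus =
  fixes q :: real and d :: "dform \<Rightarrow> dform" and Om :: "nat \<Rightarrow> nat \<Rightarrow> dform set"
  assumes q: "q \<notin> {-1, 0, 1}"
    and differential: "is_differential q d"
    and Om_subgroup: "additive_subgroup (Om a b) (Omega q)"
    and Om_cscale: "w \<in> Om a b \<Longrightarrow> cscale q z w \<in> Om a b"
    and Om_direct: "is_direct_sum (Omega q) UNIV (\<lambda>(a, b). Om a b) (carrier (Omega q))"
    and Om_mult: "v \<in> Om a b \<Longrightarrow> w \<in> Om a' b' \<Longrightarrow> v \<otimes>\<^bsub>Omega q\<^esub> w \<in> Om (a + a') (b + b')"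
    and Om_degree: "is_direct_sum (Omega q) {(a, b). a + b = k} (\<lambda>(a, b). Om a b) (omega_deg q k)"
begin

abbreviation R where "R \<equiv> Omega q"
abbreviation M where "M \<equiv> \<lambda>(a, b). Om a b"

sublocale ring R using q by (rule Omega_ring)

sublocale direct_sum_family R M
proof (intro direct_sum_family.intro direct_sum_family_axioms.intro)
  show "additive_subgroup (M i) R" for i using Om_subgroup by (cases i) simp
qed (unfold_locales, rule Om_direct)

lemma q0: "q \<noteq> 0" using q by simp

lemma Om_carrier: "x \<in> Om a b \<Longrightarrow> x \<in> carrier R"
  using M_carrier[of x "(a, b)"] by simp

lemma Om_add: "x \<in> Om a b \<Longrightarrow> y \<in> Om a b \<Longrightarrow> x \<oplus>\<^bsub>R\<^esub> y \<in> Om a b"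
  using M_add[of x "(a, b)" y] by simp

lemma Om_minus: "x \<in> Om a b \<Longrightarrow> \<ominus>\<^bsub>R\<^esub> x \<in> Om a b"
  using M_minus[of x "(a, b)"] by simp

lemma Om_zero: "\<zero>\<^bsub>R\<^esub> \<in> Om a b"
  using M_zero[of "(a, b)"] by simp

lemma d_closed: "x \<in> carrier R \<Longrightarrow> d x \<in> carrier R"
  and d_add: "x \<in> carrier R \<Longrightarrow> y \<in> carrier R \<Longrightarrow> d (x \<oplus>\<^bsub>R\<^esub> y) = d x \<oplus>\<^bsub>R\<^esub> d y"
  and d_cscale: "x \<in> carrier R \<Longrightarrow> d (cscale q z x) = cscale q z (d x)"
  and d_of_fun: "b \<in> oq_f3 q \<Longrightarrow> d (of_fun q b) = of_form q (d1 q b)"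
  and d_d: "x \<in> carrier R \<Longrightarrow> d (d x) = \<zero>\<^bsub>R\<^esub>"
  and d_mult: "v \<in> omega_deg q k \<Longrightarrow> x \<in> carrier R \<Longrightarrow>
    d (v \<otimes>\<^bsub>R\<^esub> x) = d v \<otimes>\<^bsub>R\<^esub> x \<oplus>\<^bsub>R\<^esub> sgn_pow q k \<otimes>\<^bsub>R\<^esub> (v \<otimes>\<^bsub>R\<^esub> d x)"
  using differential unfolding is_differential_def omega_linear_def omega_additive_def
  by (simp_all only: Pi_iff Ball_def simp_thms)

lemma d_zero: "d \<zero>\<^bsub>R\<^esub> = \<zero>\<^bsub>R\<^esub>"
  using d_add[of "\<zero>\<^bsub>R\<^esub>" "\<zero>\<^bsub>R\<^esub>"] d_closed[of "\<zero>\<^bsub>R\<^esub>"] by (simp add: add.r_cancel_one)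

lemma d_minus: "x \<in> carrier R \<Longrightarrow> d (\<ominus>\<^bsub>R\<^esub> x) = \<ominus>\<^bsub>R\<^esub> d x"
  using d_add[of "\<ominus>\<^bsub>R\<^esub> x" x] by (intro minus_equality[symmetric]) (simp_all add: d_closed l_neg d_zero)

lemma omega_deg_eq:
  "omega_deg q k = {finsum R f J | f J. finite J \<and> J \<subseteq> {(a, b). a + b = k} \<and> f \<in> Pi J M}"
  using Om_degree[of k] unfolding is_direct_sum_def by (rule conjunct1)

lemma Om_omega_deg:
  assumes x: "x \<in> Om a b" shows "x \<in> omega_deg q (a + b)"
proof -
  have "finsum R (\<lambda>_. x) {(a, b)} \<in> omega_deg q (a + b)"
    unfolding omega_deg_eq using x
    by (intro CollectI exI[of _ "\<lambda>_. x"] exI[of _ "{(a, b)}"]) simp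
  then show ?thesis using Om_carrier[OF x] by simp
qed

lemma omega_deg_0: "x \<in> omega_deg q 0 \<Longrightarrow> x \<in> Om 0 0"
proof -
  assume "x \<in> omega_deg q 0"
  then obtain f J where fJ: "x = finsum R f J" "J \<subseteq> {(a, b). a + b = 0}" "f \<in> Pi J M"
    unfolding omega_deg_eq by blast
  then have "J = {} \<or> J = {(0, 0)}" by auto
  then show ?thesis
    using fJ(1) Om_zero Pi_mem[OF fJ(3), of "(0, 0)"] Om_carrier[of "f (0, 0)"] by auto
qed

lemma omega_deg_1:
  assumes "x \<in> omega_deg q 1"
  obtains y z where "x = y \<oplus>\<^bsub>R\<^esub> z" "y \<in> Om 1 0" "z \<in> Om 0 1"
proof -
  obtain f J where fJ: "x = finsum R f J" "J \<subseteq> {(a, b). a + b = 1}" "f \<in> Pi J M"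
    using assms unfolding omega_deg_eq by blast
  define g where "g i = (if i \<in> J then f i else \<zero>\<^bsub>R\<^esub>)" for i
  have g: "g i \<in> M i" for i using Pi_mem[OF fJ(3)] M_zero by (simp add: g_def)
  have J: "J \<subseteq> {(1, 0), (0, 1)}"
    using fJ(2) by (auto simp: add_is_1)
  have "x = finsum R g J"
    unfolding fJ(1) by (intro finsum_cong') (auto simp: g_def M_carrier[OF Pi_mem[OF fJ(3)]])
  also have "\<dots> = finsum R g {(1, 0), (0, 1)}"
    by (rule finsum_superset[symmetric]) (use J M_carrier[OF g] in \<open>auto simp: g_def\<close>)
  also have "\<dots> = g (1, 0) \<oplus>\<^bsub>R\<^esub> g (0, 1)"
    using M_carrier[OF g] by simp
  finally show ?thesis using that g[of "(1, 0)"] g[of "(0, 1)"] by simp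
qed

lemma of_fun_Om: "b \<in> oq_f3 q \<Longrightarrow> of_fun q b \<in> Om 0 0"
  by (rule omega_deg_0) simp

lemma of_fun_zero: "of_fun q (\<lambda>x. 0) = \<zero>\<^bsub>R\<^esub>"
  using of_fun_add[OF q oq_f3_zero[OF q] oq_f3_zero[OF q]] of_fun_carrier[OF q oq_f3_zero[OF q]]
  by (simp add: add.r_cancel_one)

lemma of_form_deg: "w \<in> omega1 q \<Longrightarrow> of_form q w \<in> omega_deg q 1"
proof -
  assume w: "w \<in> omega1 q"
  \<comment> \<open>Degree 1 is generated by products of a function and a form, so the unit has to
    be put in front of w.\<close>
  have "of_fun q counit \<otimes>\<^bsub>R\<^esub> of_form q w \<in> omega_deg q (Suc 0)"
    unfolding omega_deg.simps using w oq_f3_counit[OF q] by (intro generate.incl) blast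
  then show ?thesis using of_form_carrier[OF q w] by (simp add: of_fun_counit[OF q])
qed

lemma sgn_pow_Om: "w \<in> Om a b \<Longrightarrow> sgn_pow q k \<otimes>\<^bsub>R\<^esub> w \<in> Om a b"
proof (induction k arbitrary: w)
  case 0
  then show ?case using Om_carrier by (simp add: sgn_pow_def)
next
  case (Suc k)
  have w: "w \<in> carrier R" using Suc.prems Om_carrier by blast
  have "sgn_pow q (Suc k) \<otimes>\<^bsub>R\<^esub> w = sgn_pow q k \<otimes>\<^bsub>R\<^esub> (\<ominus>\<^bsub>R\<^esub> w)"
    using w by (simp add: sgn_pow_def m_assoc l_minus)
  then show ?case using Suc.IH[OF Om_minus[OF Suc.prems]] by simp
qed

section \<open>Forms whose differential has only the two admissible bidegrees\<close>

definition d_target :: "nat \<Rightarrow> nat \<Rightarrow> dform set"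
  where "d_target a b = {y \<oplus>\<^bsub>R\<^esub> z | y z. y \<in> Om (a + 1) b \<and> z \<in> Om a (b + 1)}"

lemma d_target_I: "y \<in> Om (a + 1) b \<Longrightarrow> z \<in> Om a (b + 1) \<Longrightarrow> y \<oplus>\<^bsub>R\<^esub> z \<in> d_target a b"
  by (auto simp: d_target_def)

lemma d_target_add:
  assumes "x \<in> d_target a b" "y \<in> d_target a b" shows "x \<oplus>\<^bsub>R\<^esub> y \<in> d_target a b"
proof -
  from assms obtain x1 x2 y1 y2 where *: "x = x1 \<oplus>\<^bsub>R\<^esub> x2" "y = y1 \<oplus>\<^bsub>R\<^esub> y2"
    "x1 \<in> Om (a + 1) b" "y1 \<in> Om (a + 1) b" "x2 \<in> Om a (b + 1)" "y2 \<in> Om a (b + 1)"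
    by (auto simp: d_target_def)
  then have "x \<oplus>\<^bsub>R\<^esub> y = (x1 \<oplus>\<^bsub>R\<^esub> y1) \<oplus>\<^bsub>R\<^esub> (x2 \<oplus>\<^bsub>R\<^esub> y2)"
    using Om_carrier by (simp add: a_ac)
  then show ?thesis using * by (simp add: d_target_I Om_add)
qed

text \<open>A priori d x has components in every bidegree of total degree a + b + 1; here only the
  two neighbours of (a, b) may occur.\<close>

definition integrable_part :: "nat \<Rightarrow> nat \<Rightarrow> dform set"
  where "integrable_part a b = {x \<in> Om a b. d x \<in> d_target a b}"

lemma integrable_part_zero: "\<zero>\<^bsub>R\<^esub> \<in> integrable_part a b"
  using d_target_I[OF Om_zero Om_zero] by (simp add: integrable_part_def Om_zero d_zero)

lemma integrable_part_add: "x \<in> integrable_part a b \<Longrightarrow> y \<in> integrable_part a b \<Longrightarrow> x \<oplus>\<^bsub>R\<^esub> y \<in> integrable_part a b"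
  unfolding integrable_part_def using Om_add[of x a b y] d_add[of x y] Om_carrier[of _ a b] d_target_add[of "d x" a b "d y"] by simp

lemma integrable_part_minus:
  assumes "x \<in> integrable_part a b" shows "\<ominus>\<^bsub>R\<^esub> x \<in> integrable_part a b"
proof -
  from assms obtain y z where *: "d x = y \<oplus>\<^bsub>R\<^esub> z" "y \<in> Om (a + 1) b" "z \<in> Om a (b + 1)" "x \<in> Om a b"
    by (auto simp: integrable_part_def d_target_def)
  then have "d (\<ominus>\<^bsub>R\<^esub> x) = \<ominus>\<^bsub>R\<^esub> y \<oplus>\<^bsub>R\<^esub> \<ominus>\<^bsub>R\<^esub> z"
    using Om_carrier by (simp add: d_minus minus_add)
  then show ?thesis using * by (simp add: integrable_part_def Om_minus d_target_I)
qed

text \<open>By the Leibniz rule d (x y) has four terms, each in one of the two neighbours of the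
  bidegree of x y. This is what lifts integrability from generators to the whole algebra.\<close>

lemma integrable_part_mult:
  assumes x: "x \<in> integrable_part a b" and y: "y \<in> integrable_part a' b'"
  shows "x \<otimes>\<^bsub>R\<^esub> y \<in> integrable_part (a + a') (b + b')"
proof -
  from x obtain x1 x2 where X: "d x = x1 \<oplus>\<^bsub>R\<^esub> x2" "x1 \<in> Om (a + 1) b" "x2 \<in> Om a (b + 1)" "x \<in> Om a b"
    by (auto simp: integrable_part_def d_target_def)
  from y obtain y1 y2 where Y: "d y = y1 \<oplus>\<^bsub>R\<^esub> y2" "y1 \<in> Om (a' + 1) b'" "y2 \<in> Om a' (b' + 1)" "y \<in> Om a' b'"
    by (auto simp: integrable_part_def d_target_def)
  let ?s = "sgn_pow q (a + b)"
  have s: "?s \<in> carrier R" by (simp add: sgn_pow_def)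
  have "d (x \<otimes>\<^bsub>R\<^esub> y) = d x \<otimes>\<^bsub>R\<^esub> y \<oplus>\<^bsub>R\<^esub> ?s \<otimes>\<^bsub>R\<^esub> (x \<otimes>\<^bsub>R\<^esub> d y)"
    using X(4) Y(4) by (intro d_mult Om_omega_deg Om_carrier)
  also have "d x \<otimes>\<^bsub>R\<^esub> y = x1 \<otimes>\<^bsub>R\<^esub> y \<oplus>\<^bsub>R\<^esub> x2 \<otimes>\<^bsub>R\<^esub> y"
    using X Y Om_carrier by (simp add: l_distr)
  also have "?s \<otimes>\<^bsub>R\<^esub> (x \<otimes>\<^bsub>R\<^esub> d y) = ?s \<otimes>\<^bsub>R\<^esub> (x \<otimes>\<^bsub>R\<^esub> y1) \<oplus>\<^bsub>R\<^esub> ?s \<otimes>\<^bsub>R\<^esub> (x \<otimes>\<^bsub>R\<^esub> y2)"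
    using X Y Om_carrier s by (simp add: r_distr)
  finally have eq: "d (x \<otimes>\<^bsub>R\<^esub> y) = (x1 \<otimes>\<^bsub>R\<^esub> y \<oplus>\<^bsub>R\<^esub> x2 \<otimes>\<^bsub>R\<^esub> y)
      \<oplus>\<^bsub>R\<^esub> (?s \<otimes>\<^bsub>R\<^esub> (x \<otimes>\<^bsub>R\<^esub> y1) \<oplus>\<^bsub>R\<^esub> ?s \<otimes>\<^bsub>R\<^esub> (x \<otimes>\<^bsub>R\<^esub> y2))" .
  have "x1 \<otimes>\<^bsub>R\<^esub> y \<in> Om (a + a' + 1) (b + b')" "x2 \<otimes>\<^bsub>R\<^esub> y \<in> Om (a + a') (b + b' + 1)"
    "?s \<otimes>\<^bsub>R\<^esub> (x \<otimes>\<^bsub>R\<^esub> y1) \<in> Om (a + a' + 1) (b + b')" "?s \<otimes>\<^bsub>R\<^esub> (x \<otimes>\<^bsub>R\<^esub> y2) \<in> Om (a + a') (b + b' + 1)"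
    using Om_mult[OF X(2) Y(4)] Om_mult[OF X(3) Y(4)] sgn_pow_Om[OF Om_mult[OF X(4) Y(2)], of "a + b"]
      sgn_pow_Om[OF Om_mult[OF X(4) Y(3)], of "a + b"] by (simp_all add: add_ac)
  then have "d (x \<otimes>\<^bsub>R\<^esub> y) \<in> d_target (a + a') (b + b')"
    unfolding eq by (intro d_target_add d_target_I)
  then show ?thesis using Om_mult[OF X(4) Y(4)] by (simp add: integrable_part_def)
qed

inductive_set integrable_span :: "dform set"
  where
    hom: "x \<in> integrable_part a b \<Longrightarrow> x \<in> integrable_span"
  | add: "x \<in> integrable_span \<Longrightarrow> y \<in> integrable_span \<Longrightarrow> x \<oplus>\<^bsub>R\<^esub> y \<in> integrable_span"

lemma integrable_part_carrier: "x \<in> integrable_part a b \<Longrightarrow> x \<in> carrier R"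
  by (auto simp: integrable_part_def intro: Om_carrier)

lemma integrable_span_carrier: "x \<in> integrable_span \<Longrightarrow> x \<in> carrier R"
  by (induction rule: integrable_span.induct) (auto intro: integrable_part_carrier)

lemma integrable_span_minus: "x \<in> integrable_span \<Longrightarrow> \<ominus>\<^bsub>R\<^esub> x \<in> integrable_span"
  by (induction rule: integrable_span.induct) (auto intro: integrable_span.intros integrable_part_minus simp: minus_add integrable_span_carrier)

lemma integrable_span_mult: "x \<in> integrable_span \<Longrightarrow> y \<in> integrable_span \<Longrightarrow> x \<otimes>\<^bsub>R\<^esub> y \<in> integrable_span"
proof (induction rule: integrable_span.induct)
  case (hom x a b)
  from hom(2,1) show ?case
  proof (induction rule: integrable_span.induct)
    case (hom y a' b')
    then show ?case using integrable_part_mult integrable_span.hom by blast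
  next
    case (add y z)
    then show ?case using integrable_part_carrier integrable_span_carrier by (simp add: r_distr integrable_span.add)
  qed
next
  case (add x z)
  then show ?case using integrable_span_carrier by (simp add: l_distr integrable_span.add)
qed

text \<open>Collecting terms of equal bidegree keeps the condition on d. This is the way back from
  sums to homogeneous elements.\<close>

lemma integrable_span_decomp: "x \<in> integrable_span \<Longrightarrow> \<exists>f. decomp x f \<and> (\<forall>a b. f (a, b) \<in> integrable_part a b)"
proof (induction rule: integrable_span.induct)
  case (hom x a b)
  then have "x \<in> M (a, b)" by (simp add: integrable_part_def)
  from decomp_homogeneous[OF this] hom integrable_part_zero show ?case by force
next
  case (add x y)
  then obtain f g where fg: "decomp x f" "decomp y g" "\<forall>a b. f (a, b) \<in> integrable_part a b" "\<forall>a b. g (a, b) \<in> integrable_part a b"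
    by blast
  then show ?case using decomp_add[OF fg(1,2)] integrable_part_add by blast
qed

text \<open>The only bidegrees of total degree 1 are (1, 0) and (0, 1), which are the neighbours of
  (0, 0).\<close>

lemma of_fun_integrable_span: "b \<in> oq_f3 q \<Longrightarrow> of_fun q b \<in> integrable_span"
proof -
  assume b: "b \<in> oq_f3 q"
  from omega_deg_1[OF of_form_deg[OF omega1.intros(1)[OF b]]] have "d (of_fun q b) \<in> d_target 0 0"
    unfolding d_of_fun[OF b] by (metis d_target_I add_0)
  then show ?thesis using of_fun_Om[OF b] by (intro integrable_span.hom[of _ 0 0]) (simp add: integrable_part_def)
qed

text \<open>B and the forms eta generate the algebra, so \<open>integrable_span\<close> exhausts it,
  and the two components of d serve as the two differentials.\<close>

lemma integrable:
  assumes eta: "\<And>m p r j. m \<noteq> p \<Longrightarrow> of_form q (eta q m p r j) \<in> integrable_span"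
  shows "integrable_structure q d Om"
proof -
  have span: "of_form q w \<in> integrable_span" if "w \<in> eta_span q" for w
    using that
  proof induction
    case (add v w)
    then show ?case using eta_span_omega1[OF q] by (simp add: of_form_add[OF q] integrable_span.add)
  next
    case (lmul b w)
    then show ?case using eta_span_omega1[OF q] by (simp add: of_form_lmul[OF q] integrable_span_mult of_fun_integrable_span)
  qed (rule eta)
  have form: "of_form q w \<in> integrable_span" if "w \<in> omega1 q" for w
    using that
  proof induction
    case (1 b)
    then show ?case by (intro span weighted_form_eta_span[OF q] weighted_form_d1[OF q0])
  next
    case (2 v w)
    then show ?case by (simp add: of_form_add[OF q] integrable_span.add)
  next
    case (3 b w)
    then show ?case by (simp add: of_form_lmul[OF q] integrable_span_mult of_fun_integrable_span)
  next
    \<comment> \<open>The right action turns into multiplication in the algebra, so its formula need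
      not be evaluated.\<close>
    case (4 b w)
    then show ?case by (simp add: of_form_rmul[OF q] integrable_span_mult of_fun_integrable_span)
  qed
  have deg: "omega_deg q k \<subseteq> integrable_span" for k
  proof (induction k)
    case 0
    then show ?case using of_fun_integrable_span by auto
  next
    case (Suc k)
    show ?case
    proof
      fix x assume "x \<in> omega_deg q (Suc k)"
      then show "x \<in> integrable_span"
        unfolding omega_deg.simps
      proof induction
        case one
        then show ?case using integrable_span.hom[OF integrable_part_zero] by simp
      next
        case (incl h)
        then show ?case using Suc form integrable_span_mult by blast
      next
        case (inv h)
        then have "h \<in> integrable_span" using Suc form integrable_span_mult by blast
        then show ?case using integrable_span_minus by (metis a_inv_def)
      next
        case (eng h1 h2)
        then show ?case using integrable_span.add by simp
      qed
    qed
  qed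
  have bideg: "\<exists>y z. d x = y \<oplus>\<^bsub>R\<^esub> z \<and> y \<in> Om (a + 1) b \<and> z \<in> Om a (b + 1)" if x: "x \<in> Om a b" for x a b
  proof -
    from x deg Om_omega_deg have "x \<in> integrable_span" by blast
    then obtain f where f: "decomp x f" "\<forall>a b. f (a, b) \<in> integrable_part a b" using integrable_span_decomp by blast
    have xM: "x \<in> M (a, b)" using x by simp
    \<comment> \<open>By uniqueness a homogeneous element of the span is its own only component, and
      that component satisfies the condition on d.\<close>
    have "f = (\<lambda>j. if j = (a, b) then x else \<zero>\<^bsub>R\<^esub>)"
      by (rule decomp_unique[OF f(1) decomp_homogeneous[OF xM] Om_carrier[OF x]])
    then have "f (a, b) = x" by simp
    then have "x \<in> integrable_part a b" using f(2) by metis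
    then show ?thesis by (auto simp: integrable_part_def d_target_def)
  qed
  \<comment> \<open>Which component of d to take depends on the bidegree of the argument; hence the
    maps are defined on each summand and then glued.\<close>
  define E1 where "E1 = (\<lambda>(a, b) x. component (a + 1, b) (d x))"
  define E2 where "E2 = (\<lambda>(a, b) x. component (a, b + 1) (d x))"
  have E_closed: "E1 i x \<in> carrier R" "E2 i x \<in> carrier R" if "x \<in> M i" for i x
    using d_closed[OF M_carrier[OF that]] component_carrier by (auto simp: E1_def E2_def split: prod.splits)
  have E_zero: "E1 i \<zero>\<^bsub>R\<^esub> = \<zero>\<^bsub>R\<^esub>" "E2 i \<zero>\<^bsub>R\<^esub> = \<zero>\<^bsub>R\<^esub>" for i
    by (auto simp: E1_def E2_def d_zero component_zero split: prod.splits)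
  have E_add: "E1 i (x \<oplus>\<^bsub>R\<^esub> y) = E1 i x \<oplus>\<^bsub>R\<^esub> E1 i y" "E2 i (x \<oplus>\<^bsub>R\<^esub> y) = E2 i x \<oplus>\<^bsub>R\<^esub> E2 i y"
    if "x \<in> M i" "y \<in> M i" for i x y
    using M_carrier[OF that(1)] M_carrier[OF that(2)]
    by (auto simp: E1_def E2_def d_add d_closed component_add split: prod.splits)
  note E1 = E_closed(1) E_zero(1) E_add(1) and E2 = E_closed(2) E_zero(2) E_add(2)
  have cs_closed: "cscale q z x \<in> carrier R" if "x \<in> carrier R" for z x
    using that omega_class_simps(1)[OF q scal_carrier] by (simp add: cscale_def)
  have cs_add: "cscale q z (x \<oplus>\<^bsub>R\<^esub> y) = cscale q z x \<oplus>\<^bsub>R\<^esub> cscale q z y"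
    if "x \<in> carrier R" "y \<in> carrier R" for z x y
    using that omega_class_simps(1)[OF q scal_carrier] by (simp add: cscale_def r_distr)
  have cs_zero: "cscale q z \<zero>\<^bsub>R\<^esub> = \<zero>\<^bsub>R\<^esub>" for z
    using omega_class_simps(1)[OF q scal_carrier] by (simp add: cscale_def)
  have cs_M: "cscale q z x \<in> M i" if "x \<in> M i" for z x i
    using that Om_cscale by (cases i) simp
  have cs_comp: "component i (cscale q z x) = cscale q z (component i x)" if "x \<in> carrier R" for z x i
    by (rule component_additive_map) (use that cs_closed cs_add cs_zero cs_M in auto)
  have cs_E: "E1 i (cscale q z x) = cscale q z (E1 i x)" "E2 i (cscale q z x) = cscale q z (E2 i x)"
    if "x \<in> M i" for i z x
    using d_cscale[OF M_carrier[OF that]] cs_comp[OF d_closed[OF M_carrier[OF that]]]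
    by (auto simp: E1_def E2_def split: prod.splits)
  have lin: "omega_linear q (glue E)"
    if E: "\<And>i x. x \<in> M i \<Longrightarrow> E i x \<in> carrier R" "\<And>i. E i \<zero>\<^bsub>R\<^esub> = \<zero>\<^bsub>R\<^esub>"
      "\<And>i x y. x \<in> M i \<Longrightarrow> y \<in> M i \<Longrightarrow> E i (x \<oplus>\<^bsub>R\<^esub> y) = E i x \<oplus>\<^bsub>R\<^esub> E i y"
      "\<And>i z x. x \<in> M i \<Longrightarrow> E i (cscale q z x) = cscale q z (E i x)" for E
    unfolding omega_linear_def omega_additive_def
  proof (intro conjI ballI allI)
    show "glue E \<in> carrier R \<rightarrow> carrier R" using glue_closed[of E, OF E(1-3)] by simp
    show "glue E (v \<oplus>\<^bsub>R\<^esub> w) = glue E v \<oplus>\<^bsub>R\<^esub> glue E w" if "v \<in> carrier R" "w \<in> carrier R" for v w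
      using glue_add[of E, OF E(1-3) that] by simp
    show "glue E (cscale q z w) = cscale q z (glue E w)" if "w \<in> carrier R" for z w
    proof (rule additive_eqI[of "\<lambda>w. glue E (cscale q z w)" "\<lambda>w. cscale q z (glue E w)"])
      show "glue E (cscale q z x) = cscale q z (glue E x)" if "x \<in> M i" for i x
        using glue_homogeneous[of E, OF E(1-3)] cs_M that E(4) by metis
    qed (use that glue_closed[of E, OF E(1-3)] glue_add[of E, OF E(1-3)] cs_closed cs_add in auto)
  qed
  have hom1: "glue E1 x = E1 i x" and hom2: "glue E2 x = E2 i x" if "x \<in> M i" for i x
    using glue_homogeneous[of E1, OF E1 that] glue_homogeneous[of E2, OF E2 that] by simp_all
  have vals: "E1 (a, b) x \<in> Om (a + 1) b" "E2 (a, b) x \<in> Om a (b + 1)" if "x \<in> Om a b" for a b x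
    using component_M[OF d_closed[OF Om_carrier[OF that]], of "(a + 1, b)"]
      component_M[OF d_closed[OF Om_carrier[OF that]], of "(a, b + 1)"] by (simp_all add: E1_def E2_def)
  have sum: "d x = E1 (a, b) x \<oplus>\<^bsub>R\<^esub> E2 (a, b) x" if x: "x \<in> Om a b" for a b x
  proof -
    obtain y z where yz: "d x = y \<oplus>\<^bsub>R\<^esub> z" "y \<in> Om (a + 1) b" "z \<in> Om a (b + 1)"
      using bideg[OF x] by blast
    have y: "y \<in> M (a + 1, b)" and z: "z \<in> M (a, b + 1)" using yz by simp_all
    have "E1 (a, b) x = y" "E2 (a, b) x = z"
      using Om_carrier[OF yz(2)] Om_carrier[OF yz(3)]
      by (simp_all add: E1_def E2_def yz(1) component_add component_homogeneous[OF y] component_homogeneous[OF z])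
    then show ?thesis using yz by simp
  qed
  show ?thesis
    unfolding integrable_structure_def
  proof (intro exI conjI allI ballI)
    show "omega_linear q (glue E1)" "omega_linear q (glue E2)"
      using lin[of E1, OF E1 cs_E(1)] lin[of E2, OF E2 cs_E(2)] by simp_all
    show "glue E1 ` Om a b \<subseteq> Om (a + 1) b" "glue E2 ` Om a b \<subseteq> Om a (b + 1)" for a b
      using vals hom1[of _ "(a, b)"] hom2[of _ "(a, b)"] by auto
    show "d w = glue E1 w \<oplus>\<^bsub>R\<^esub> glue E2 w" if w: "w \<in> carrier R" for w
    proof (rule additive_eqI[of d "\<lambda>w. glue E1 w \<oplus>\<^bsub>R\<^esub> glue E2 w", OF _ _ _ _ _ w])
      show "d x = glue E1 x \<oplus>\<^bsub>R\<^esub> glue E2 x" if "x \<in> M i" for i x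
        using sum[of x "fst i" "snd i"] hom1[OF that] hom2[OF that] that by (cases i) simp
    qed (use glue_closed[of E1, OF E1] glue_closed[of E2, OF E2] glue_add[of E1, OF E1] glue_add[of E2, OF E2] in
        \<open>auto simp: d_closed d_add a_ac\<close>)
  qed
qed

section \<open>Matrix identities for the projections and their differentials\<close>

abbreviation sum3 :: "(3 \<Rightarrow> dform) \<Rightarrow> dform"
  where "sum3 f \<equiv> f 1 \<oplus>\<^bsub>R\<^esub> f 2 \<oplus>\<^bsub>R\<^esub> f 3"

abbreviation P :: "3 \<Rightarrow> 3 \<Rightarrow> 3 \<Rightarrow> dform"
  where "P m i j \<equiv> of_fun q (proj_coef q m i j)"

abbreviation dP :: "3 \<Rightarrow> 3 \<Rightarrow> 3 \<Rightarrow> dform"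
  where "dP m i j \<equiv> of_form q (d1 q (proj_coef q m i j))"

abbreviation eta_class :: "3 \<Rightarrow> 3 \<Rightarrow> 3 \<Rightarrow> 3 \<Rightarrow> dform"
  where "eta_class m p i j \<equiv> of_form q (eta q m p i j)"

lemma P_carrier: "P m i j \<in> carrier R"
  by (intro of_fun_carrier q oq_f3_proj_coef)

lemma d1_proj_omega1: "d1 q (proj_coef q m i j) \<in> omega1 q"
  by (intro omega1.intros oq_f3_proj_coef q)

lemma dP_carrier: "dP m i j \<in> carrier R"
  by (intro of_form_carrier q d1_proj_omega1)

lemma eta_class_carrier: "eta_class m p i j \<in> carrier R"
  by (intro of_form_carrier q eta_in_omega1)

lemma d_P: "d (P m i j) = dP m i j"
  by (intro d_of_fun oq_f3_proj_coef q)

lemma d_dP: "d (dP m i j) = \<zero>\<^bsub>R\<^esub>"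
  using d_d[OF P_carrier] by (simp add: d_P)

lemma d_P_mult: "x \<in> carrier R \<Longrightarrow> d (P m i j \<otimes>\<^bsub>R\<^esub> x) = dP m i j \<otimes>\<^bsub>R\<^esub> x \<oplus>\<^bsub>R\<^esub> P m i j \<otimes>\<^bsub>R\<^esub> d x"
  using d_mult[of "P m i j" 0 x] oq_f3_proj_coef[OF q] P_carrier d_closed
  by (simp add: d_P sgn_pow_def)

lemma eta_class_eq: "eta_class m p r j = sum3 (\<lambda>i. P m r i \<otimes>\<^bsub>R\<^esub> dP p i j)"
proof -
  have l: "lmul (proj_coef q m r i) (d1 q (proj_coef q p i j)) \<in> omega1 q" for i
    by (intro omega1.intros oq_f3_proj_coef q)
  have "eta_class m p r j = sum3 (\<lambda>i. of_form q (lmul (proj_coef q m r i) (d1 q (proj_coef q p i j))))"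
    unfolding eta_def sum_3
    by (subst of_form_add[OF q], intro omega1.intros(2) l, rule l,
        subst of_form_add[OF q], rule l, rule l, rule refl)
  then show ?thesis by (simp add: of_form_lmul[OF q oq_f3_proj_coef[OF q] d1_proj_omega1])
qed

lemma P_orthogonal:
  assumes "m \<noteq> p" shows "sum3 (\<lambda>j. P m i j \<otimes>\<^bsub>R\<^esub> P p j k) = \<zero>\<^bsub>R\<^esub>"
proof -
  have c: "proj_coef q m i j \<star> proj_coef q p j k \<in> oq_f3 q" for j
    by (intro oq_f3_conv oq_f3_proj_coef q)
  have "(\<lambda>x. \<Sum>j\<in>UNIV. (proj_coef q m i j \<star> proj_coef q p j k) x) = (\<lambda>x. 0)"
    using wcoef_conv_wcoef[OF q0, of m m i p p k] assms by (simp add: proj_coef_def)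
  then have "of_fun q (\<lambda>x. (proj_coef q m i 1 \<star> proj_coef q p 1 k) x
      + (proj_coef q m i 2 \<star> proj_coef q p 2 k) x + (proj_coef q m i 3 \<star> proj_coef q p 3 k) x) = \<zero>\<^bsub>R\<^esub>"
    by (simp add: sum_3 of_fun_zero)
  then have "sum3 (\<lambda>j. of_fun q (proj_coef q m i j \<star> proj_coef q p j k)) = \<zero>\<^bsub>R\<^esub>"
    using c by (simp add: of_fun_add[OF q] oq_f3_add)
  then show ?thesis by (simp add: of_fun_conv[OF q oq_f3_proj_coef[OF q] oq_f3_proj_coef[OF q]])
qed

text \<open>The Leibniz rule applied to P m P p = 0.\<close>

lemma dP_P:
  assumes "m \<noteq> p" shows "sum3 (\<lambda>j. dP m i j \<otimes>\<^bsub>R\<^esub> P p j k) = \<ominus>\<^bsub>R\<^esub> eta_class m p i k"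
proof -
  note c = P_carrier dP_carrier
  have "\<zero>\<^bsub>R\<^esub> = d (sum3 (\<lambda>j. P m i j \<otimes>\<^bsub>R\<^esub> P p j k))"
    by (simp add: P_orthogonal[OF assms] d_zero)
  also have "\<dots> = sum3 (\<lambda>j. dP m i j \<otimes>\<^bsub>R\<^esub> P p j k \<oplus>\<^bsub>R\<^esub> P m i j \<otimes>\<^bsub>R\<^esub> dP p j k)"
    by (simp add: c d_add d_P_mult d_P)
  also have "\<dots> = sum3 (\<lambda>j. dP m i j \<otimes>\<^bsub>R\<^esub> P p j k) \<oplus>\<^bsub>R\<^esub> eta_class m p i k"
    unfolding eta_class_eq by (simp add: c a_ac)
  finally show ?thesis
    using eta_class_carrier by (intro minus_equality[symmetric]) (simp_all add: c)
qed

text \<open>The matrix identity dP p = (sum of all P s) dP p. In coordinate k only the summand with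
  s = \<open>trow k\<close> survives.\<close>

lemma dP_resolution: "dP p i j = sum3 (\<lambda>s. eta_class s p i j)"
proof -
  have "d1 q (proj_coef q p i j) = (\<lambda>k x. \<Sum>s\<in>UNIV. eta q s p i j k x)"
  proof (intro ext)
    fix k x
    have "(\<Sum>s\<in>UNIV. eta q s p i j k x) = tcoef q k p * wcoef q (trow k) (tcol k) i j x"
      by (simp add: eta_coord[OF q0] if_distrib[of "\<lambda>c. c * _"] cong: if_cong)
    then show "d1 q (proj_coef q p i j) k x = (\<Sum>s\<in>UNIV. eta q s p i j k x)"
      by (simp add: d1_def proj_coef_def act_tvec_wcoef[OF q0])
  qed
  then have "dP p i j = of_form q (\<lambda>k x. eta q 1 p i j k x + eta q 2 p i j k x + eta q 3 p i j k x)"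
    by (simp add: sum_3)
  also have "\<dots> = sum3 (\<lambda>s. eta_class s p i j)"
    using eta_in_omega1[OF q] by (simp add: of_form_add[OF q] omega1.intros(2))
  finally show ?thesis .
qed

text \<open>As d d P p = 0, differentiating P m dP p leaves only the product of the two
  differentials.\<close>

lemma d_eta_class: "d (eta_class m p r j) = sum3 (\<lambda>i. dP m r i \<otimes>\<^bsub>R\<^esub> dP p i j)"
  unfolding eta_class_eq using P_carrier dP_carrier by (simp add: d_add d_P_mult d_dP)

text \<open>
  With D2 the degree Y part of dP, the obstruction is the matrix product of D2 m and D2 p. It
  vanishes after inserting the sum of all P s, which is the identity: for each s either
  P s D2 p = 0, or D2 m P s = - P m D2 s = 0.
\<close>

lemma eta_flat:
  fixes X Y :: "nat \<times> nat"
  assumes XY: "X = (1, 0) \<and> Y = (0, 1) \<or> X = (0, 1) \<and> Y = (1, 0)"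
    and mp: "m \<noteq> p" "\<And>r j. eta_class m p r j \<in> M X"
    and s: "\<And>s. (\<forall>r j. eta_class s p r j \<in> M X) \<or> s \<noteq> m \<and> (\<forall>r j. eta_class m s r j \<in> M X)"
  shows "eta_class m p r j \<in> integrable_span"
proof -
  have XneY: "X \<noteq> Y" using XY by auto
  define D1 D2 where "D1 m i j = component X (dP m i j)" and "D2 m i j = component Y (dP m i j)" for m i j
  have D1: "D1 m i j \<in> M X" and D2: "D2 m i j \<in> M Y" for m i j
    by (simp_all only: D1_def D2_def component_M[OF dP_carrier])
  note c = P_carrier dP_carrier M_carrier[OF D1] M_carrier[OF D2] eta_class_carrier
  have dP_split: "dP m i j = D1 m i j \<oplus>\<^bsub>R\<^esub> D2 m i j" for m i j
  proof -
    obtain y z where yz: "dP m i j = y \<oplus>\<^bsub>R\<^esub> z" "y \<in> Om 1 0" "z \<in> Om 0 1"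
      using omega_deg_1[OF of_form_deg[OF d1_proj_omega1]] by metis
    have yM: "y \<in> M (1, 0)" and zM: "z \<in> M (0, 1)" using yz by simp_all
    have "component (1, 0) (dP m i j) = y" "component (0, 1) (dP m i j) = z"
      unfolding yz(1) using M_carrier[OF yM] M_carrier[OF zM]
      by (simp_all add: component_add component_homogeneous[OF yM] component_homogeneous[OF zM])
    then show ?thesis
      using XY yz(1) M_carrier[OF yM] M_carrier[OF zM] by (auto simp: D1_def D2_def a_comm)
  qed
  have P_M: "P m i j \<in> M (0, 0)" for m i j using of_fun_Om[OF oq_f3_proj_coef[OF q]] by simp
  have mult_M: "x \<otimes>\<^bsub>R\<^esub> y \<in> M (fst u + fst v, snd u + snd v)" if "x \<in> M u" "y \<in> M v" for x y u v
    using Om_mult that by (cases u, cases v) simp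
  \<comment> \<open>Entries of P have bidegree (0, 0), so multiplying by them commutes with taking
    the Y part.\<close>
  have right: "component Y (dP m i j \<otimes>\<^bsub>R\<^esub> P s k l) = D2 m i j \<otimes>\<^bsub>R\<^esub> P s k l" for m i j s k l
  proof -
    have "D1 m i j \<otimes>\<^bsub>R\<^esub> P s k l \<in> M X" "D2 m i j \<otimes>\<^bsub>R\<^esub> P s k l \<in> M Y"
      using mult_M[OF D1 P_M, of m i j s k l] mult_M[OF D2 P_M, of m i j s k l] by simp_all
    then show ?thesis
      using XneY c by (simp add: dP_split l_distr component_add component_homogeneous)
  qed
  have left: "component Y (P s k l \<otimes>\<^bsub>R\<^esub> dP m i j) = P s k l \<otimes>\<^bsub>R\<^esub> D2 m i j" for m i j s k l
  proof -
    have "P s k l \<otimes>\<^bsub>R\<^esub> D1 m i j \<in> M X" "P s k l \<otimes>\<^bsub>R\<^esub> D2 m i j \<in> M Y"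
      using mult_M[OF P_M D1, of s k l m i j] mult_M[OF P_M D2, of s k l m i j] by simp_all
    then show ?thesis
      using XneY c by (simp add: dP_split r_distr component_add component_homogeneous)
  qed
  have comp3: "component Y (sum3 f) = sum3 (\<lambda>i. component Y (f i))" if "\<And>i. f i \<in> carrier R" for f
    using that by (simp add: component_add)
  have eta_class_Y: "component Y (eta_class s p i j) = sum3 (\<lambda>k. P s i k \<otimes>\<^bsub>R\<^esub> D2 p k j)" for s i j
    unfolding eta_class_eq by (subst comp3) (simp_all add: c left)
  have D2_res: "D2 p i j = sum3 (\<lambda>s. sum3 (\<lambda>k. P s i k \<otimes>\<^bsub>R\<^esub> D2 p k j))" for i j
    unfolding D2_def[of p i j] dP_resolution[of p i j]
    by (subst comp3) (simp_all only: c eta_class_Y)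
  have vanish: "sum3 (\<lambda>i. D2 m r i \<otimes>\<^bsub>R\<^esub> sum3 (\<lambda>k. P s i k \<otimes>\<^bsub>R\<^esub> D2 p k j)) = \<zero>\<^bsub>R\<^esub>" for s r j
  proof (cases "\<forall>r j. eta_class s p r j \<in> M X")
    case True
    then have "sum3 (\<lambda>k. P s i k \<otimes>\<^bsub>R\<^esub> D2 p k j) = \<zero>\<^bsub>R\<^esub>" for i
      unfolding eta_class_Y[symmetric] using XneY component_homogeneous by metis
    then show ?thesis by (simp add: c)
  next
    case False
    \<comment> \<open>The condition s \<noteq> m is what makes the identity from P m P s = 0
      available.\<close>
    with s have sm: "s \<noteq> m" and Nms: "\<And>r j. eta_class m s r j \<in> M X" by blast+
    have z: "sum3 (\<lambda>i. D2 m r i \<otimes>\<^bsub>R\<^esub> P s i k) = \<zero>\<^bsub>R\<^esub>" for k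
    proof -
      have "sum3 (\<lambda>i. D2 m r i \<otimes>\<^bsub>R\<^esub> P s i k) = component Y (sum3 (\<lambda>i. dP m r i \<otimes>\<^bsub>R\<^esub> P s i k))"
        by (subst comp3) (simp_all add: c right)
      also have "\<dots> = component Y (\<ominus>\<^bsub>R\<^esub> eta_class m s r k)"
        using sm by (simp only: dP_P not_sym)
      also have "\<dots> = \<zero>\<^bsub>R\<^esub>"
        using XneY component_homogeneous[OF M_minus[OF Nms]] by simp
      finally show ?thesis .
    qed
    have "sum3 (\<lambda>i. D2 m r i \<otimes>\<^bsub>R\<^esub> sum3 (\<lambda>k. P s i k \<otimes>\<^bsub>R\<^esub> D2 p k j))
      = sum3 (\<lambda>k. sum3 (\<lambda>i. D2 m r i \<otimes>\<^bsub>R\<^esub> P s i k) \<otimes>\<^bsub>R\<^esub> D2 p k j)"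
      by (simp add: c r_distr l_distr m_assoc a_ac)
    also have "\<dots> = \<zero>\<^bsub>R\<^esub>" by (simp only: z) (simp add: c)
    finally show ?thesis .
  qed
  have obstruction: "sum3 (\<lambda>i. D2 m r i \<otimes>\<^bsub>R\<^esub> D2 p i j) = \<zero>\<^bsub>R\<^esub>"
  proof -
    define Q where "Q s i = sum3 (\<lambda>k. P s i k \<otimes>\<^bsub>R\<^esub> D2 p k j)" for s i
    have Qc: "Q s i \<in> carrier R" for s i unfolding Q_def by (simp add: c)
    have "sum3 (\<lambda>i. D2 m r i \<otimes>\<^bsub>R\<^esub> D2 p i j) = sum3 (\<lambda>i. D2 m r i \<otimes>\<^bsub>R\<^esub> sum3 (\<lambda>s. Q s i))"
      unfolding Q_def D2_res[symmetric] ..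
    also have "\<dots> = sum3 (\<lambda>s. sum3 (\<lambda>i. D2 m r i \<otimes>\<^bsub>R\<^esub> Q s i))"
      by (simp add: c Qc r_distr a_ac)
    also have "\<dots> = \<zero>\<^bsub>R\<^esub>" unfolding Q_def vanish by simp
    finally show ?thesis .
  qed
  \<comment> \<open>With the product of bidegree Y + Y gone, what is left has bidegrees X + X and X
    + Y, the two neighbours of X.\<close>
  let ?XX = "(fst X + fst X, snd X + snd X)" and ?XY = "(fst X + fst Y, snd X + snd Y)"
  have XXM: "D1 m r i \<otimes>\<^bsub>R\<^esub> D1 p i j \<in> M ?XX" for i using mult_M[OF D1 D1] .
  have XYM: "D1 m r i \<otimes>\<^bsub>R\<^esub> D2 p i j \<in> M ?XY" "D2 m r i \<otimes>\<^bsub>R\<^esub> D1 p i j \<in> M ?XY" for i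
    using mult_M[OF D1 D2] mult_M[OF D2 D1] by (simp_all add: add.commute)
  have "d (eta_class m p r j) = sum3 (\<lambda>i. D1 m r i \<otimes>\<^bsub>R\<^esub> D1 p i j)
      \<oplus>\<^bsub>R\<^esub> sum3 (\<lambda>i. D1 m r i \<otimes>\<^bsub>R\<^esub> D2 p i j \<oplus>\<^bsub>R\<^esub> D2 m r i \<otimes>\<^bsub>R\<^esub> D1 p i j)
      \<oplus>\<^bsub>R\<^esub> sum3 (\<lambda>i. D2 m r i \<otimes>\<^bsub>R\<^esub> D2 p i j)"
    unfolding d_eta_class dP_split by (simp add: c r_distr l_distr a_ac)
  also have "\<dots> = sum3 (\<lambda>i. D1 m r i \<otimes>\<^bsub>R\<^esub> D1 p i j)
      \<oplus>\<^bsub>R\<^esub> sum3 (\<lambda>i. D1 m r i \<otimes>\<^bsub>R\<^esub> D2 p i j \<oplus>\<^bsub>R\<^esub> D2 m r i \<otimes>\<^bsub>R\<^esub> D1 p i j)"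
    unfolding obstruction by (simp add: c)
  finally have eq: "d (eta_class m p r j) = sum3 (\<lambda>i. D1 m r i \<otimes>\<^bsub>R\<^esub> D1 p i j)
      \<oplus>\<^bsub>R\<^esub> sum3 (\<lambda>i. D1 m r i \<otimes>\<^bsub>R\<^esub> D2 p i j \<oplus>\<^bsub>R\<^esub> D2 m r i \<otimes>\<^bsub>R\<^esub> D1 p i j)"
    (is "_ = ?y \<oplus>\<^bsub>R\<^esub> ?z") .
  have y: "?y \<in> M ?XX" and z: "?z \<in> M ?XY"
    by (intro M_add XXM XYM)+
  \<comment> \<open>\<open>d_target\<close> lists the bidegree raised in its first index first; for
    X = (0, 1) this is the mixed part.\<close>
  have comm: "?y \<oplus>\<^bsub>R\<^esub> ?z = ?z \<oplus>\<^bsub>R\<^esub> ?y" using M_carrier[OF y] M_carrier[OF z] by (rule a_comm)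
  from XY show ?thesis
  proof
    assume X: "X = (1, 0) \<and> Y = (0, 1)"
    then have "?y \<in> Om (1 + 1) 0" "?z \<in> Om 1 (0 + 1)" using y z by (simp_all add: numeral_2_eq_2)
    then have "d (eta_class m p r j) \<in> d_target 1 0" unfolding eq by (rule d_target_I)
    then show ?thesis using mp(2)[of r j] X by (intro integrable_span.hom[of _ 1 0]) (simp add: integrable_part_def)
  next
    assume X: "X = (0, 1) \<and> Y = (1, 0)"
    then have "?y \<in> Om 0 (1 + 1)" "?z \<in> Om (0 + 1) 1" using y z by (simp_all add: numeral_2_eq_2)
    then have "d (eta_class m p r j) \<in> d_target 0 1" unfolding eq comm by (intro d_target_I)
    then show ?thesis using mp(2)[of r j] X by (intro integrable_span.hom[of _ 0 1]) (simp add: integrable_part_def)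
  qed
qed

text \<open>The injective \<open>rank\<close> encodes a linear order on the indices, so that both
  structures become instances. Linearity ensures that for p below m every s is above p or below
  m.\<close>

lemma integrable_of_order:
  fixes rank :: "3 \<Rightarrow> nat"
  assumes inj: "inj rank"
    and up: "\<And>m p r j. rank p < rank m \<Longrightarrow> eta_class m p r j \<in> Om 1 0"
    and down: "\<And>m p r j. rank m < rank p \<Longrightarrow> eta_class m p r j \<in> Om 0 1"
  shows "integrable_structure q d Om"
proof (rule integrable)
  fix m p r j :: 3
  assume "m \<noteq> p"
  then have "rank p < rank m \<or> rank m < rank p" using inj by (metis injD nat_neq_iff)
  then show "eta_class m p r j \<in> integrable_span"
  proof
    assume mp: "rank p < rank m"
    show ?thesis
    proof (rule eta_flat[where X = "(1, 0)" and Y = "(0, 1)"])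
      show "(\<forall>r j. eta_class s p r j \<in> M (1, 0)) \<or> s \<noteq> m \<and> (\<forall>r j. eta_class m s r j \<in> M (1, 0))" for s
        using up[of p s] up[of s m] mp by (cases "rank p < rank s") auto
    qed (use up mp in auto)
  next
    assume mp: "rank m < rank p"
    show ?thesis
    proof (rule eta_flat[where X = "(0, 1)" and Y = "(1, 0)"])
      show "(\<forall>r j. eta_class s p r j \<in> M (0, 1)) \<or> s \<noteq> m \<and> (\<forall>r j. eta_class m s r j \<in> M (0, 1))" for s
        using down[of s p] down[of m s] mp by (cases "rank s < rank p") auto
    qed (use down mp in auto)
  qed
qed

end

section \<open>The types of the forms eta in the two structures\<close>

lemma cot_span_iff:
  "finite I \<Longrightarrow> v \<in> cot_span I \<longleftrightarrow> (\<forall>k. k \<notin> I \<longrightarrow> v k = 0)"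
proof
  assume "finite I" "\<forall>k. k \<notin> I \<longrightarrow> v k = 0"
  then have "v = (\<lambda>j. \<Sum>k\<in>I. v k * lam_basis k j)"
    by (auto simp: fun_eq_iff lam_basis_def if_distrib[of "\<lambda>c. _ * c"] cong: if_cong)
  then show "v \<in> cot_span I" unfolding cot_span_def by blast
qed (auto simp: cot_span_def lam_basis_def intro!: sum.neutral)

lemma eta_cotensor_part:
  assumes q: "q \<notin> {-1, 0, 1}" and "finite I" and "\<And>k. k \<notin> I \<Longrightarrow> m = trow k \<Longrightarrow> tcoef q k p = 0"
  shows "eta q m p r j \<in> cotensor_part q (cot_span I)"
  using assms eta_in_omega1[OF q] by (auto simp: cotensor_part_def cot_span_iff eta_coord)

text \<open>The conditions on \<open>I\<close> and \<open>J\<close> ask that every nonzero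
  coordinate of eta m p lie on the side prescribed by the order of m and p, including the extra
  coordinate \<open>Fi Alpha12\<close> of eta 1 2.\<close>

lemma integrable_of_first_order:
  fixes rank :: "3 \<Rightarrow> nat"
  assumes q: "q \<notin> {-1, 0, 1}" and d: "is_differential q d" and Om: "almost_complex q st Om"
    and ext: "extends_first_order q (cot_span I) (cot_span J) Om" and rank: "inj rank"
    and IJ: "\<And>k p. tcoef q k p \<noteq> 0 \<Longrightarrow> rank p < rank (trow k) \<Longrightarrow> k \<in> I"
      "\<And>k p. tcoef q k p \<noteq> 0 \<Longrightarrow> rank (trow k) < rank p \<Longrightarrow> k \<in> J"
  shows "integrable_structure q d Om"
proof -
  note ac = Om[unfolded almost_complex_def]
  interpret bigraded_calculus q d Om
    by (rule bigraded_calculus.intro[OF q d ac[THEN conjunct1, rule_format]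
          ac[THEN conjunct2, THEN conjunct1, rule_format]
          ac[THEN conjunct2, THEN conjunct2, THEN conjunct1]
          ac[THEN conjunct2, THEN conjunct2, THEN conjunct2, THEN conjunct1, rule_format]
          ac[THEN conjunct2, THEN conjunct2, THEN conjunct2, THEN conjunct2, THEN conjunct1, rule_format]])
  have fin: "finite K" for K :: "tindex set" by simp
  show ?thesis
  proof (rule integrable_of_order[OF rank])
    show "of_form q (eta q m p r j) \<in> Om 1 0" if "rank p < rank m" for m p r j
      using ext that IJ(1) unfolding extends_first_order_def
      by (auto intro!: imageI eta_cotensor_part[OF q fin])
    show "of_form q (eta q m p r j) \<in> Om 0 1" if "rank m < rank p" for m p r j
      using ext that IJ(2) unfolding extends_first_order_def
      by (auto intro!: imageI eta_cotensor_part[OF q fin])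
  qed
qed

theorem proposition5p5:
  fixes q :: real
    and d st :: "dform \<Rightarrow> dform"
    and co :: "dform \<Rightarrow> uq_gen free \<Rightarrow> dform"
  assumes "q \<notin> {-1, 0, 1}"
    and "is_differential q d"
    and "is_star q d st"
    and "is_coaction q d co"
  shows "(\<forall>Om. almost_complex q st Om \<and> left_covariant q co Om \<and>
            extends_first_order q
              (cot_span {Ei Alpha1, Ei Alpha2, Ei Alpha12})
              (cot_span {Fi Alpha1, Fi Alpha2, Fi Alpha12}) Om
            \<longrightarrow> integrable_structure q d Om)
       \<and> (\<forall>Om. almost_complex q st Om \<and> left_covariant q co Om \<and>
            extends_first_order q
              (cot_span {Ei Alpha1, Fi Alpha2, Ei Alpha12})
              (cot_span {Fi Alpha1, Ei Alpha2, Fi Alpha12}) Om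
            \<longrightarrow> integrable_structure q d Om)"
proof (intro conjI allI impI; elim conjE)
  fix Om
  assume Om: "almost_complex q st Om"
    and ext: "extends_first_order q (cot_span {Ei Alpha1, Ei Alpha2, Ei Alpha12})
              (cot_span {Fi Alpha1, Fi Alpha2, Fi Alpha12}) Om"
  let ?rank = "\<lambda>i::3. if i = 1 then 1 else if i = 2 then 2 else 3 :: nat"
  show "integrable_structure q d Om"
  proof (rule integrable_of_first_order[OF assms(1,2) Om ext, of ?rank])
    show "inj ?rank" unfolding inj_def forall_3 by simp
    show "k \<in> {Ei Alpha1, Ei Alpha2, Ei Alpha12}" if "tcoef q k p \<noteq> 0" "?rank p < ?rank (trow k)" for k p
      using that by (cases k rule: trow.cases) (auto split: if_splits)
    \<comment> \<open>The case k = \<open>Fi Alpha12\<close>, p = 2 is the extra term of eta 1 2; it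
      falls on the same side as \<open>Fi Alpha1\<close>.\<close>
    show "k \<in> {Fi Alpha1, Fi Alpha2, Fi Alpha12}" if "tcoef q k p \<noteq> 0" "?rank (trow k) < ?rank p" for k p
      using that by (cases k rule: trow.cases) (auto split: if_splits)
  qed
next
  fix Om
  assume Om: "almost_complex q st Om"
    and ext: "extends_first_order q (cot_span {Ei Alpha1, Fi Alpha2, Ei Alpha12})
              (cot_span {Fi Alpha1, Ei Alpha2, Fi Alpha12}) Om"
  \<comment> \<open>The order 1 < 3 < 2. Compared with the standard order, it changes the side of
    the matrix units (3, 2) and (2, 3) only, that is, of e_{alpha_2} and f_{alpha_2}.\<close>
  let ?rank = "\<lambda>i::3. if i = 1 then 1 else if i = 2 then 3 else 2 :: nat"
  show "integrable_structure q d Om"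
  proof (rule integrable_of_first_order[OF assms(1,2) Om ext, of ?rank])
    show "inj ?rank" unfolding inj_def forall_3 by simp
    show "k \<in> {Ei Alpha1, Fi Alpha2, Ei Alpha12}" if "tcoef q k p \<noteq> 0" "?rank p < ?rank (trow k)" for k p
      using that by (cases k rule: trow.cases) (auto split: if_splits)
    show "k \<in> {Fi Alpha1, Ei Alpha2, Fi Alpha12}" if "tcoef q k p \<noteq> 0" "?rank (trow k) < ?rank p" for k p
      using that by (cases k rule: trow.cases) (auto split: if_splits)
  qed
qed

end
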